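(* Let $n\in\{2,3\}$ and let $\mathbb A=(a_{kj}^{\alpha\beta})$ be a constant real tensor satisfying the symmetry and relaxed ellipticity conditions stated in the context. Consider the anisotropic incompressible Navier-Stokes equation $$-\boldsymbol{\mathcal L}(\mathbf u,p)=\mathbf f-(\mathbf u\cdot\nabla)\mathbf u\qquad( * )$$ on the torus $\mathbb T$, understood in the sense of distributions, for divergence-free $\mathbf u$. (i) If $\mathbf f\in\dot{\mathbf H}_\#^{s-2}$ with $s\ge 1$, then equation $( * )$ has a solution $(\mathbf u,p)\in\dot{\mathbf H}_{\#\sigma}^{s}\times\dot H_\#^{s-1}$. (ii) Moreover, if $\mathbf f\in(\dot{\mathcal C}_\#^\infty)^n$, then equation $( * )$ has a solution $(\mathbf u,p)\in(\dot{\mathcal C}_\#^\infty)^n\times\dot{\mathcal C}_\#^\infty$ (with $\operatorname{div}\mathbf u=0$).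
   Context: Summation over repeated indices from $1$ to $n$ is used. Function spaces. $\mathbb T=[0,1)^n$ is the $n$-dimensional flat torus; functions and distributions on $\mathbb T$ are real-valued and identified with $1$-periodic ones on $\mathbb R^n$. $\mathcal C_\#^\infty$ is the space of $1$-periodic $C^\infty$ functions; $\mathcal D'_\#$ is its dual (periodic distributions). Fourier coefficients: $\hat g(\boldsymbol\xi)=\int_{\mathbb T}e^{-2\pi i\mathbf x\cdot\boldsymbol\xi}g(\mathbf x)\,d\mathbf x$, $\boldsymbol\xi\in\mathbb Z^n$, extended to $g\in\mathcal D'_\#$. Let $|\boldsymbol\xi|$ be the Euclidean norm and $\rho(\boldsymbol\xi)=(1+|\boldsymbol\xi|^2)^{1/2}$. For $s\in\mathbb R$, $H_\#^s$ is the space of $g\in\mathcal D'_\#$ with finite norm $\|g\|_{H_\#^s}=\big(\sum_{\boldsymbol\xi\in\mathbb Z^n}\rho(\boldsymbol\xi)^{2s}|\hat g(\boldsymbol\xi)|^2\big)^{1/2}$; $\dot H_\#^s=\{g\in H_\#^s:\langle g,1\rangle_{\mathbb T}=0\}$ and $\dot{\mathcal C}_\#^\infty=\{g\in\mathcal C_\#^\infty:\langle g,1\rangle_{\mathbb T}=0\}$. Bold letters denote spaces of $n$-component vectors: $\mathbf H_\#^s=(H_\#^s)^n$, $\dot{\mathbf H}_\#^s=(\dot H_\#^s)^n$, and $\dot{\mathbf H}_{\#\sigma}^s=\{\mathbf w\in\dot{\mathbf H}_\#^s:\operatorname{div}\mathbf w=0\}$. Viscosity tensor. $\mathbb A=(a_{kj}^{\alpha\beta})_{1\le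 k,j,\alpha,\beta\le n}$ has constant real components, with symmetries $a_{kj}^{\alpha\beta}=a_{\alpha j}^{k\beta}=a_{k\beta}^{\alpha j}$, and satisfies the relaxed ellipticity condition: there is $C_{\mathbb A}>0$ such that $a_{kj}^{\alpha\beta}\zeta_{k\alpha}\zeta_{j\beta}\ge C_{\mathbb A}^{-1}|\boldsymbol\zeta|^2$ for all real $n\times n$ matrices $\boldsymbol\zeta=(\zeta_{k\alpha})$ with $\boldsymbol\zeta=\boldsymbol\zeta^\top$ and $\sum_{k=1}^n\zeta_{kk}=0$, where $|\boldsymbol\zeta|^2=\zeta_{k\alpha}\zeta_{k\alpha}$. Stokes operator. $(\boldsymbol{\mathfrak L}\mathbf u)_k=\partial_\alpha\big(a_{kj}^{\alpha\beta}E_{j\beta}(\mathbf u)\big)=\partial_\alpha\big(a_{kj}^{\alpha\beta}\partial_\beta u_j\big)$, $k=1,\dots,n$, where $E_{j\beta}(\mathbf u)=\frac12(\partial_ju_\beta+\partial_\beta u_j)$, and $\boldsymbol{\mathcal L}(\mathbf u,p)=\boldsymbol{\mathfrak L}\mathbf u-\nabla p$. *)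

theory Defs
  imports "HOL-Analysis.Analysis"
begin

definition partial_deriv :: "'n \<Rightarrow> (real^'n \<Rightarrow> real) \<Rightarrow> real^'n \<Rightarrow> real"
  where "partial_deriv j f x = frechet_derivative f (at x) (axis j 1)"

abbreviation iterated_partial :: "'n list \<Rightarrow> (real^'n \<Rightarrow> real) \<Rightarrow> real^'n \<Rightarrow> real"
  where "iterated_partial js f \<equiv> foldr partial_deriv js f"

text \<open>Differentiability of all iterated partial derivatives makes all of them continuous,
  so this is the usual notion of a $C^\infty$ function.\<close>

definition smooth_fun :: "(real^'n \<Rightarrow> real) \<Rightarrow> bool"
  where "smooth_fun f \<longleftrightarrow> (\<forall>js x. iterated_partial js f differentiable (at x))"

definition periodic :: "(real^'n \<Rightarrow> real) \<Rightarrow> bool"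
  where "periodic f \<longleftrightarrow> (\<forall>x i. f (x + axis i 1) = f x)"

definition smooth_periodic :: "(real^'n \<Rightarrow> real) set"
  where "smooth_periodic = {f. smooth_fun f \<and> periodic f}"

text \<open>Convergence in the Frechet topology of the space of smooth periodic functions:
  uniform convergence of all derivatives.\<close>

definition test_tendsto :: "(nat \<Rightarrow> real^'n \<Rightarrow> real) \<Rightarrow> (real^'n \<Rightarrow> real) \<Rightarrow> bool"
  where "test_tendsto \<phi> \<psi> \<longleftrightarrow>
    (\<forall>js. uniform_limit UNIV (\<lambda>m. iterated_partial js (\<phi> m)) (iterated_partial js \<psi>) sequentially)"

type_synonym 'n functional = "(real^'n \<Rightarrow> real) \<Rightarrow> real"

text \<open>The test space is metrizable, so sequential continuity is continuity. The values of a
  distribution outside \<^const>\<open>smooth_periodic\<close> carry no meaning; two distributions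
  are the same if they agree on \<^const>\<open>smooth_periodic\<close>.\<close>

definition periodic_distributions :: "('n::finite) functional set"
  where "periodic_distributions = {g.
    (\<forall>\<phi>\<in>smooth_periodic. \<forall>\<psi>\<in>smooth_periodic. \<forall>a b.
        g (\<lambda>x. a * \<phi> x + b * \<psi> x) = a * g \<phi> + b * g \<psi>) \<and>
    (\<forall>\<phi> \<psi>. (\<forall>m. \<phi> m \<in> smooth_periodic) \<and> \<psi> \<in> smooth_periodic \<and> test_tendsto \<phi> \<psi>
        \<longrightarrow> (\<lambda>m. g (\<phi> m)) \<longlonglongrightarrow> g \<psi>)}"

definition dist_eq :: "('n::finite) functional \<Rightarrow> 'n functional \<Rightarrow> bool"
  where "dist_eq g h \<longleftrightarrow> (\<forall>\<phi>\<in>smooth_periodic. g \<phi> = h \<phi>)"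

definition dist_deriv :: "'n::finite \<Rightarrow> 'n functional \<Rightarrow> 'n functional"
  where "dist_deriv j g = (\<lambda>\<phi>. - g (partial_deriv j \<phi>))"

definition torus :: "(real^'n) set"
  where "torus = {x. \<forall>i. 0 \<le> x $ i \<and> x $ i < 1}"

definition regular_dist :: "(real^'n \<Rightarrow> real) \<Rightarrow> ('n::finite) functional"
  where "regular_dist F = (\<lambda>\<phi>. set_lebesgue_integral lborel torus (\<lambda>x. F x * \<phi> x))"

text \<open>\<open>w\<close> is the product of \<open>g\<close> and \<open>h\<close>: both are given by integrable
  functions whose pointwise product is integrable, and \<open>w\<close> is given by that product.
  Only the values of the representing functions on the cube \<^const>\<open>torus\<close> matter. They
  are determined almost everywhere by \<open>g\<close> and \<open>h\<close>, hence so is \<open>w\<close>.\<close>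

definition dist_product :: "('n::finite) functional \<Rightarrow> 'n functional \<Rightarrow> 'n functional \<Rightarrow> bool"
  where "dist_product g h w \<longleftrightarrow> (\<exists>F G.
    set_integrable lborel torus F \<and> set_integrable lborel torus G \<and>
    set_integrable lborel torus (\<lambda>x. F x * G x) \<and>
    dist_eq g (regular_dist F) \<and> dist_eq h (regular_dist G) \<and>
    dist_eq w (regular_dist (\<lambda>x. F x * G x)))"

definition frequency :: "int^'n \<Rightarrow> real^'n"
  where "frequency \<xi> = (\<chi> i. real_of_int (\<xi> $ i))"

text \<open>The pairing of \<open>g\<close> with $e^{-2\pi i x\cdot\xi}$, where the real functional
  \<open>g\<close> is extended complex linearly.\<close>

definition fourier_coeff :: "('n::finite) functional \<Rightarrow> int^'n \<Rightarrow> complex"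
  where "fourier_coeff g \<xi> =
    Complex (g (\<lambda>x. cos (2 * pi * (x \<bullet> frequency \<xi>)))) (- g (\<lambda>x. sin (2 * pi * (x \<bullet> frequency \<xi>))))"

definition sobolev_weight :: "int^('n::finite) \<Rightarrow> real"
  where "sobolev_weight \<xi> = sqrt (1 + (norm (frequency \<xi>))\<^sup>2)"

definition sobolev :: "real \<Rightarrow> ('n::finite) functional set"
  where "sobolev s = {g \<in> periodic_distributions.
    (\<lambda>\<xi>. sobolev_weight \<xi> powr (2 * s) * (cmod (fourier_coeff g \<xi>))\<^sup>2) summable_on UNIV}"

definition sobolev0 :: "real \<Rightarrow> ('n::finite) functional set"
  where "sobolev0 s = {g \<in> sobolev s. g (\<lambda>_. 1) = 0}"

definition smooth_periodic0 :: "(real^'n::finite \<Rightarrow> real) set"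
  where "smooth_periodic0 = {g \<in> smooth_periodic. regular_dist g (\<lambda>_. 1) = 0}"

definition sobolev0_vec :: "real \<Rightarrow> ('n \<Rightarrow> ('n::finite) functional) set"
  where "sobolev0_vec s = {w. \<forall>k. w k \<in> sobolev0 s}"

definition smooth_periodic0_vec :: "('n \<Rightarrow> real^'n::finite \<Rightarrow> real) set"
  where "smooth_periodic0_vec = {w. \<forall>k. w k \<in> smooth_periodic0}"

definition dist_div :: "('n \<Rightarrow> ('n::finite) functional) \<Rightarrow> 'n functional"
  where "dist_div w = (\<lambda>\<phi>. \<Sum>j\<in>UNIV. dist_deriv j (w j) \<phi>)"

definition sobolev0_sigma :: "real \<Rightarrow> ('n \<Rightarrow> ('n::finite) functional) set"
  where "sobolev0_sigma s = {w \<in> sobolev0_vec s. dist_eq (dist_div w) (\<lambda>_. 0)}"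

text \<open>Lower indices precede upper ones: \<open>a k j \<alpha> \<beta>\<close> is $a_{kj}^{\alpha\beta}$.\<close>

type_synonym 'n tensor = "'n \<Rightarrow> 'n \<Rightarrow> 'n \<Rightarrow> 'n \<Rightarrow> real"

definition tensor_symmetric :: "'n tensor \<Rightarrow> bool"
  where "tensor_symmetric a \<longleftrightarrow>
    (\<forall>k j \<alpha> \<beta>. a k j \<alpha> \<beta> = a \<alpha> j k \<beta> \<and> a k j \<alpha> \<beta> = a k \<beta> \<alpha> j)"

definition relaxed_elliptic :: "('n::finite) tensor \<Rightarrow> bool"
  where "relaxed_elliptic a \<longleftrightarrow> (\<exists>C>0. \<forall>\<zeta>::real^'n^'n. \<zeta> = transpose \<zeta> \<and> trace \<zeta> = 0 \<longrightarrow>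
    (\<Sum>k\<in>UNIV. \<Sum>j\<in>UNIV. \<Sum>\<alpha>\<in>UNIV. \<Sum>\<beta>\<in>UNIV. a k j \<alpha> \<beta> * \<zeta> $ k $ \<alpha> * \<zeta> $ j $ \<beta>)
      \<ge> inverse C * (\<Sum>k\<in>UNIV. \<Sum>\<alpha>\<in>UNIV. (\<zeta> $ k $ \<alpha>)\<^sup>2))"

definition strain :: "('n \<Rightarrow> ('n::finite) functional) \<Rightarrow> 'n \<Rightarrow> 'n \<Rightarrow> 'n functional"
  where "strain u j \<beta> = (\<lambda>\<phi>. (dist_deriv j (u \<beta>) \<phi> + dist_deriv \<beta> (u j) \<phi>) / 2)"

definition viscous_op :: "('n::finite) tensor \<Rightarrow> ('n \<Rightarrow> 'n functional) \<Rightarrow> 'n \<Rightarrow> 'n functional"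
  where "viscous_op a u k = (\<lambda>\<phi>. \<Sum>\<alpha>\<in>UNIV.
    dist_deriv \<alpha> (\<lambda>\<psi>. \<Sum>j\<in>UNIV. \<Sum>\<beta>\<in>UNIV. a k j \<alpha> \<beta> * strain u j \<beta> \<psi>) \<phi>)"

definition stokes_op ::
    "('n::finite) tensor \<Rightarrow> ('n \<Rightarrow> 'n functional) \<Rightarrow> 'n functional \<Rightarrow> 'n \<Rightarrow> 'n functional"
  where "stokes_op a u p k = (\<lambda>\<phi>. viscous_op a u k \<phi> - dist_deriv k p \<phi>)"

text \<open>\<open>N k\<close> is the component $((u\cdot\nabla)u)_k = u_j\,\partial_j u_k$.\<close>

definition is_convection :: "('n \<Rightarrow> ('n::finite) functional) \<Rightarrow> ('n \<Rightarrow> 'n functional) \<Rightarrow> bool"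
  where "is_convection u N \<longleftrightarrow> (\<exists>w.
    (\<forall>k j. dist_product (u j) (dist_deriv j (u k)) (w k j)) \<and>
    (\<forall>k. dist_eq (N k) (\<lambda>\<phi>. \<Sum>j\<in>UNIV. w k j \<phi>)))"

definition navier_stokes ::
    "('n::finite) tensor \<Rightarrow> ('n \<Rightarrow> 'n functional) \<Rightarrow> ('n \<Rightarrow> 'n functional) \<Rightarrow> 'n functional \<Rightarrow> bool"
  where "navier_stokes a f u p \<longleftrightarrow> (\<exists>N. is_convection u N \<and>
    (\<forall>k. dist_eq (\<lambda>\<phi>. - stokes_op a u p k \<phi>) (\<lambda>\<phi>. f k \<phi> - N k \<phi>)))"

end

theory Submission
  imports Defs "HOL-Complex_Analysis.Great_Picard"
begin

text \<open>On Fourier coefficients the equation reads $M(\xi)\hat u(\xi)+\hat N(\xi)+2\pi i\xi\hat p(\xi)=\hat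
    f(\xi)$
  with $\hat N_k(\xi)=2\pi i\,\xi_j\sum_\eta\hat u_j(\xi-\eta)\hat u_k(\eta)$. Relaxed ellipticity
      and the
  symmetries of the tensor make $M(\xi)$ coercive on $\xi^\perp$, and the convective term does no work
  on solenoidal fields. The truncated system therefore has a zero by a topological argument based on
  Kuhn's combinatorial lemma; the bound in $H^1$ gives a subsequence which converges
  coefficientwise, and the tails of the convolutions are uniformly small, so the limit solves the
  full system for $f\in H^{-1}$. For regularity, $b,c\in H^r$ with $r\ge1$
      and $n\le3$ give $bc\in H^{r-3/4}$,
  because $\sum_\eta\rho(\xi-\eta)^{-2}\rho(\eta)^{-3/2}$ is bounded by
      $2\sum_\eta\rho(\eta)^{-7/2}<\infty$; so
  $u\in H^r$ and $f\in H^{s-2}$ imply $u\in H^{\min(s,\,r+1/4)}$, and finitely many steps reach $H^s$.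
  Finally, a periodic distribution is determined by its Fourier coefficients, and square summable
  coefficients belong to square integrable functions whose products have the convolutions as
  coefficients.\<close>

section \<open>Zeros of coercive maps\<close>


text \<open>Ellipticity is assumed on symmetric trace-free matrices alone, so at \<xi> the symbol is
  coercive only on the orthogonal complement of \<xi>, and the cancellation of convection uses
  hermitian solenoidal sequences. A topological zero argument, on the other hand, wants independent
  real unknowns. Both constraints are therefore built into the map: a Hartley-type isometry produces
  hermitian sequences, the Leray projection makes them solenoidal, and the component it discards is
  added to the projected residual as a penalty that vanishes at every zero. The pressure never
  enters the truncated system; it is read off from the part of the residual parallel to \<xi>. The
  quarter of a derivative gained per round is 2 from inverting the viscous symbol, minus 1 for the
  derivative in the convective term, minus 3/4 for the product; the exponent 7/2 behind the 3/4 lies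
  above 3, the largest dimension allowed. For s \<ge> 1 data in H^(s-2) lie in H^(-1), which is what
  the energy estimate can absorb.\<close>

lemma choice3:
  assumes "\<forall>m. \<exists>q r s. Q m q r s"
  shows "\<exists>q r s. \<forall>m. Q m (q m) (r m) (s m)"
proof -
  from choice[OF assms] obtain q where "\<forall>m. \<exists>r s. Q m (q m) r s" ..
  from choice[OF this] obtain r where "\<forall>m. \<exists>s. Q m (q m) (r m) s" ..
  from choice[OF this] obtain s where "\<forall>m. Q m (q m) (r m) (s m)" ..
  then show ?thesis by (intro exI)
qed

text \<open>Coordinatewise form of the variational inequality <P y, x - y> \<ge> 0 on the cube of
  half-width R. Every grid has a cell in which each coordinate sees both labels of Kuhn's lemma;
  along a subsequence the cells shrink to a point, and continuity turns the two labels into the sign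
  conditions.\<close>

lemma cube_variational_inequality:
  fixes P :: "('i \<Rightarrow> real) \<Rightarrow> 'i \<Rightarrow> real"
  assumes fin: "finite X" and R: "0 < R"
    and cont: "\<forall>x y. (\<forall>i\<in>X. (\<lambda>m. x m i) \<longlonglongrightarrow> y i) \<longrightarrow> (\<forall>i\<in>X. (\<lambda>m. P (x m) i) \<longlonglongrightarrow> P y i)"
  obtains y where "\<And>i. i \<in> X \<Longrightarrow> P y i = 0 \<or> (y i = R \<and> P y i \<le> 0) \<or> (y i = - R \<and> P y i \<ge> 0)"
proof -
  define n where "n = card X"
  obtain h where h: "bij_betw h {..<n} X"
    using ex_bij_betw_nat_finite[OF fin] by (auto simp: n_def atLeast0LessThan)
  define h' where "h' = the_inv_into {..<n} h"
  have h': "h' i < n" "h (h' i) = i" if "i \<in> X" for i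
    using that h unfolding h'_def
    by (auto simp: bij_betw_def the_inv_into_into[of h "{..<n}" i "{..<n}", simplified] f_the_inv_into_f)
  define g where "g p x = (\<lambda>i. - R + 2 * R * real (x (h' i)) / real p)" for p :: nat and x :: "nat \<Rightarrow> nat"
  \<comment> \<open>Kuhn's lemma prescribes label 0 on the lower face and 1 on the upper one.
    Elsewhere the label is 0 exactly where the component of \<open>P\<close> is negative, so a
    vertex labelled 0 with a positive component, or labelled 1 with a negative one, must lie on the
    corresponding face.\<close>
  define lab where "lab p x i = (if x i = 0 then 0 else if x i
      = p then 1 else if P (g p x) (h i) < 0 then 0 else (1::nat))"
    for p x i
  have "\<exists>q r s. (\<forall>i<n. q i < Suc m) \<and>
     (\<forall>i<n. (\<forall>j<n. q j \<le> r i j \<and> r i j \<le> q j + 1) \<and> (\<forall>j<n. q j \<le> s i j \<and> s i j \<le> q j + 1) \<and>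
       lab (Suc m) (r i) i = 0 \<and> lab (Suc m) (s i) i = 1)" for m
  proof -
    obtain q where q: "\<forall>i<n. q i < Suc m"
      "\<forall>i<n. \<exists>r s. (\<forall>j<n. q j \<le> r j \<and> r j \<le> q j + 1) \<and> (\<forall>j<n. q j \<le> s j \<and> s j \<le> q j + 1)
          \<and> lab (Suc m) r i \<noteq> lab (Suc m) s i"
      by (rule kuhn_lemma[of "Suc m" n "lab (Suc m)"]) (auto simp: lab_def)
    have "\<exists>r s. (\<forall>j<n. q j \<le> r j \<and> r j \<le> q j + 1) \<and> (\<forall>j<n. q j \<le> s j \<and> s j \<le> q j + 1)
          \<and> lab (Suc m) r i = 0 \<and> lab (Suc m) s i = 1" if i: "i < n" for i
    proof -
      obtain r s where rs: "\<forall>j<n. q j \<le> r j \<and> r j \<le> q j + 1" "\<forall>j<n. q j \<le> s j \<and> s j \<le> q j + 1"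
          "lab (Suc m) r i \<noteq> lab (Suc m) s i"
        using q(2) i by blast
      have "lab (Suc m) r i \<in> {0,1}" "lab (Suc m) s i \<in> {0,1}"
        by (auto simp: lab_def)
      then consider "lab (Suc m) r i = 0" "lab (Suc m) s i = 1" | "lab (Suc m) r i = 1" "lab (Suc m) s i
          = 0"
        using rs(3) by auto
      then show ?thesis
        using rs(1,2) by cases blast+
    qed
    then obtain r s where "\<forall>i<n. (\<forall>j<n. q j \<le> r i j \<and> r i j \<le> q j + 1) \<and> (\<forall>j<n. q j \<le> s i j \<and> s i j
        \<le> q j + 1)
          \<and> lab (Suc m) (r i) i = 0 \<and> lab (Suc m) (s i) i = 1"
      by metis
    with q(1) show ?thesis by blast
  qed
  then have "\<exists>q r s. \<forall>m. (\<forall>i<n. q m i < Suc m) \<and>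
     (\<forall>i<n. (\<forall>j<n. q m j \<le> r m i j \<and> r m i j \<le> q m j + 1) \<and> (\<forall>j<n. q m j \<le> s m i j \<and> s m i j
         \<le> q m j + 1) \<and>
       lab (Suc m) (r m i) i = 0 \<and> lab (Suc m) (s m i) i = 1)"
    by (intro choice3) blast
  then obtain q r s where qrs: "\<forall>m. (\<forall>i<n. q m i < Suc m) \<and>
     (\<forall>i<n. (\<forall>j<n. q m j \<le> r m i j \<and> r m i j \<le> q m j + 1) \<and> (\<forall>j<n. q m j \<le> s m i j \<and> s m i j
         \<le> q m j + 1) \<and>
       lab (Suc m) (r m i) i = 0 \<and> lab (Suc m) (s m i) i = 1)"
    by (elim exE)
  have q: "q m i < Suc m" if "i < n" for m i
    using qrs that by (elim allE[of _ m]) blast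
  have r: "q m j \<le> r m i j \<and> r m i j \<le> q m j + 1" if "i < n" "j < n" for m i j
    using qrs that by (elim allE[of _ m]) blast
  have s: "q m j \<le> s m i j \<and> s m i j \<le> q m j + 1" if "i < n" "j < n" for m i j
    using qrs that by (elim allE[of _ m]) blast
  have lr: "lab (Suc m) (r m i) i = 0" if "i < n" for m i
    using qrs that by (elim allE[of _ m]) blast
  have ls: "lab (Suc m) (s m i) i = 1" if "i < n" for m i
    using qrs that by (elim allE[of _ m]) blast
  have bd: "norm (g (Suc m) (q m) i) \<le> R" if "i \<in> X" for m i
  proof -
    have "real (q m (h' i)) / real (Suc m) \<le> 1"
      using q[OF h'(1)[OF that], of m] by simp
    then have "2 * R * (real (q m (h' i)) / real (Suc m)) \<le> 2 * R * 1"
      using R by (intro mult_left_mono) auto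
    moreover have "0 \<le> 2 * R * (real (q m (h' i)) / real (Suc m))" using R by simp
    ultimately show ?thesis by (simp add: g_def)
  qed
  obtain k where k: "strict_mono k" "\<And>i. i \<in> X \<Longrightarrow> \<exists>l. (\<lambda>m. g (Suc (k m)) (q (k m)) i) \<longlonglongrightarrow> l"
    using function_convergent_subsequence[of X "\<lambda>m. g (Suc m) (q m)" R, OF _ bd] fin
    by (metis countable_finite)
  then obtain y where y: "\<And>i. i \<in> X \<Longrightarrow> (\<lambda>m. g (Suc (k m)) (q (k m)) i) \<longlonglongrightarrow> y i"
    by metis
  \<comment> \<open>All vertices of a cell differ from its corner \<open>q\<close> by at most one
    mesh width in each coordinate, so they share its limit.\<close>
  have near: "(\<lambda>m. g (Suc (k m)) (t (k m)) j) \<longlonglongrightarrow> y j"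
    if t: "\<And>m j. j < n \<Longrightarrow> q m j \<le> t m j \<and> t m j \<le> q m j + 1" and j: "j \<in> X" for t j
  proof -
    have L0: "(\<lambda>m. 2 * R / real (Suc (k m))) \<longlonglongrightarrow> 0"
      using LIMSEQ_subseq_LIMSEQ[OF LIMSEQ_Suc[OF lim_const_over_n[of "2 * R"]] k(1)]
          by (simp add: o_def)
    have D: "norm (g (Suc (k m)) (t (k m)) j - g (Suc (k m)) (q (k m)) j)
        \<le> 2 * R / real (Suc (k m))" for m
    proof -
      let ?a = "real (t (k m) (h' j))" and ?b = "real (q (k m) (h' j))"
      have "g (Suc (k m)) (t (k m)) j - g (Suc (k m)) (q (k m)) j
          = (?a - ?b) * (2 * R / real (Suc (k m)))"
        by (simp add: g_def left_diff_distrib right_diff_distrib diff_divide_distrib mult_ac)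
      moreover have "\<bar>?a - ?b\<bar> \<le> 1"
        using t[OF h'(1)[OF j], of "k m"] by linarith
      ultimately have "norm (g (Suc (k m)) (t (k m)) j - g (Suc (k m)) (q (k m)) j)
          = \<bar>?a - ?b\<bar> * (2 * R / real (Suc (k m)))"
        using R by (simp add: abs_mult)
      also have "\<dots> \<le> 1 * (2 * R / real (Suc (k m)))"
        using R \<open>\<bar>?a - ?b\<bar> \<le> 1\<close> by (intro mult_right_mono) auto
      finally show ?thesis by simp
    qed
    have "(\<lambda>m. g (Suc (k m)) (t (k m)) j - g (Suc (k m)) (q (k m)) j) \<longlonglongrightarrow> 0"
      by (rule Lim_null_comparison[OF _ L0]) (intro always_eventually allI D)
    from tendsto_add[OF this y[OF j]] show ?thesis by simp
  qed
  show ?thesis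
  proof
    fix i assume i: "i \<in> X"
    note hi = h'(1)[OF i] and hh = h'(2)[OF i]
    have ry: "(\<lambda>m. g (Suc (k m)) (r (k m) (h' i)) j) \<longlonglongrightarrow> y j" if "j \<in> X" for j
      by (rule near[OF r[OF hi] that])
    have cry: "(\<lambda>m. P (g (Suc (k m)) (r (k m) (h' i))) i) \<longlonglongrightarrow> P y i"
      using cont[rule_format, of "\<lambda>m. g (Suc (k m)) (r (k m) (h' i))" y, OF ry i] .
    have sy: "(\<lambda>m. g (Suc (k m)) (s (k m) (h' i)) j) \<longlonglongrightarrow> y j" if "j \<in> X" for j
      by (rule near[OF s[OF hi] that])
    have csy: "(\<lambda>m. P (g (Suc (k m)) (s (k m) (h' i))) i) \<longlonglongrightarrow> P y i"
      using cont[rule_format, of "\<lambda>m. g (Suc (k m)) (s (k m) (h' i))" y, OF sy i] .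
    have A: "y i = - R" if "P y i > 0"
    proof -
      have "\<forall>\<^sub>F m in sequentially. P (g (Suc (k m)) (r (k m) (h' i))) i > 0"
        using order_tendstoD(1)[OF cry that] .
      then have "\<forall>\<^sub>F m in sequentially. g (Suc (k m)) (r (k m) (h' i)) i = - R"
      proof eventually_elim
        case (elim m)
        have "r (k m) (h' i) (h' i) = 0"
          using lr[OF hi, of "k m"] elim hh by (auto simp: lab_def split: if_splits)
        then show ?case by (simp add: g_def)
      qed
      then have "(\<lambda>m. g (Suc (k m)) (r (k m) (h' i)) i) \<longlonglongrightarrow> - R"
        by (rule tendsto_eventually)
      with ry[OF i] show ?thesis by (rule LIMSEQ_unique)
    qed
    have B: "y i = R" if "P y i < 0"
    proof -
      have "\<forall>\<^sub>F m in sequentially. P (g (Suc (k m)) (s (k m) (h' i))) i < 0"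
        using order_tendstoD(2)[OF csy that] .
      then have "\<forall>\<^sub>F m in sequentially. g (Suc (k m)) (s (k m) (h' i)) i = R"
      proof eventually_elim
        case (elim m)
        have "s (k m) (h' i) (h' i) = Suc (k m)"
          using ls[OF hi, of "k m"] elim hh by (auto simp: lab_def split: if_splits)
        then show ?case by (simp add: g_def)
      qed
      then have "(\<lambda>m. g (Suc (k m)) (s (k m) (h' i)) i) \<longlonglongrightarrow> R"
        by (rule tendsto_eventually)
      with sy[OF i] show ?thesis by (rule LIMSEQ_unique)
    qed
    show "P y i = 0 \<or> (y i = R \<and> P y i \<le> 0) \<or> (y i = - R \<and> P y i \<ge> 0)"
      using A B by linarith
  qed
qed

text \<open>If a component of \<open>P\<close> were non-zero at the point of the variational
  inequality, that point would have a coordinate of modulus R, so its squared norm would exceed K,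
  whereas the sign conditions give <P y, y> \<le> 0.\<close>

lemma coercive_zero:
  fixes P :: "('i \<Rightarrow> real) \<Rightarrow> 'i \<Rightarrow> real"
  assumes fin: "finite X" 
    and cont: "\<forall>x y. (\<forall>i\<in>X. (\<lambda>m. x m i) \<longlonglongrightarrow> y i) \<longrightarrow> (\<forall>i\<in>X. (\<lambda>m. P (x m) i) \<longlonglongrightarrow> P y i)"
    and coer: "\<And>x. K < (\<Sum>i\<in>X. (x i)\<^sup>2) \<Longrightarrow> 0 < (\<Sum>i\<in>X. P x i * x i)"
  obtains y where "\<And>i. i \<in> X \<Longrightarrow> P y i = 0"
proof -
  \<comment> \<open>The square of |K| + 1 exceeds K whatever the sign of K.\<close>
  define R where "R = \<bar>K\<bar> + 1"
  have R: "0 < R" by (simp add: R_def)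
  obtain y where y: "\<And>i. i \<in> X \<Longrightarrow> P y i = 0 \<or> (y i = R \<and> P y i \<le> 0) \<or> (y i = - R \<and> P y i \<ge> 0)"
    using cube_variational_inequality[of X R P, OF fin R cont] by blast
  have "P y i = 0" if i: "i \<in> X" for i
  proof (rule ccontr)
    assume "P y i \<noteq> 0"
    then have "(y i)\<^sup>2 = R\<^sup>2" using y[OF i] by auto
    moreover have "(y i)\<^sup>2 \<le> (\<Sum>i\<in>X. (y i)\<^sup>2)" by (rule member_le_sum[OF i _ fin]) auto
    moreover have "K < R\<^sup>2"
      unfolding R_def power2_eq_square by (smt (verit) mult_left_mono mult_cancel_left1 abs_ge_self
          abs_ge_zero)
    ultimately have "0 < (\<Sum>i\<in>X. P y i * y i)" using coer[of y] by simp
    moreover have "(\<Sum>i\<in>X. P y i * y i) \<le> 0"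
      using y R by (intro sum_nonpos) (fastforce simp: mult_le_0_iff)
    ultimately show False by simp
  qed
  then show ?thesis using that by blast
qed

section \<open>Sequences on the integer lattice\<close>

notation sobolev_weight ("\<rho>")


lemma nonneg_summable_bounded:
  fixes f :: "'a \<Rightarrow> real"
  assumes "\<And>x. x \<in> A \<Longrightarrow> 0 \<le> f x" and "\<And>F. finite F \<Longrightarrow> F \<subseteq> A \<Longrightarrow> sum f F \<le> B"
  shows "f summable_on A" "infsum f A \<le> B"
proof -
  show s: "f summable_on A"
    by (rule nonneg_bdd_above_summable_on) (use assms in \<open>auto intro!: bdd_aboveI2\<close>)
  show "infsum f A \<le> B"
    by (rule infsum_le_finite_sums[OF s]) (use assms in auto)
qed

section \<open>Frequencies and the Sobolev weight\<close>

lemma frequency_nth [simp]: "frequency \<xi> $ i = real_of_int (\<xi> $ i)"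
  by (simp add: frequency_def)

lemma frequency_add: "frequency (\<xi> + \<eta>) = frequency \<xi> + frequency \<eta>"
  by (simp add: vec_eq_iff)

lemma frequency_diff: "frequency (\<xi> - \<eta>) = frequency \<xi> - frequency \<eta>"
  by (simp add: vec_eq_iff)

lemma frequency_minus [simp]: "frequency (- \<xi>) = - frequency \<xi>"
  by (simp add: vec_eq_iff)

lemma frequency_0 [simp]: "frequency 0 = 0"
  by (simp add: vec_eq_iff)

lemma frequency_eq_0_iff [simp]: "frequency \<xi> = 0 \<longleftrightarrow> \<xi> = 0"
  by (simp add: vec_eq_iff)

lemma abs_nth_le_norm_frequency: "\<bar>real_of_int (\<xi> $ i)\<bar> \<le> norm (frequency \<xi>)"
  using component_le_norm_cart[of "frequency \<xi>" i] by simp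

lemma norm_frequency_ge_1: "\<xi> \<noteq> 0 \<Longrightarrow> 1 \<le> norm (frequency \<xi>)"
proof -
  assume "\<xi> \<noteq> 0"
  then obtain i where "\<xi> $ i \<noteq> 0" by (auto simp: vec_eq_iff)
  then have "1 \<le> \<bar>\<xi> $ i\<bar>" by linarith
  then have "1 \<le> \<bar>real_of_int (\<xi> $ i)\<bar>" by linarith
  then show ?thesis using abs_nth_le_norm_frequency[of \<xi> i] by linarith
qed

lemma sobolev_weight_ge_1 [simp]: "1 \<le> \<rho> \<xi>"
  by (simp add: sobolev_weight_def)

lemma sobolev_weight_pos [simp]: "0 < \<rho> \<xi>"
  using sobolev_weight_ge_1[of \<xi>] by linarith

lemma sobolev_weight_nonneg [simp]: "0 \<le> \<rho> \<xi>"
  using sobolev_weight_ge_1[of \<xi>] by linarith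

lemma sobolev_weight_nz [simp]: "\<rho> \<xi> \<noteq> 0"
  using sobolev_weight_ge_1[of \<xi>] by linarith

lemma sobolev_weight_sq: "(\<rho> \<xi>)\<^sup>2 = 1 + (norm (frequency \<xi>))\<^sup>2"
  by (simp add: sobolev_weight_def)

lemma norm_frequency_le_weight: "norm (frequency \<xi>) \<le> \<rho> \<xi>"
  unfolding sobolev_weight_def by (rule real_le_rsqrt) simp

text \<open>Non-zero lattice points have length at least 1, so the homogeneous and the inhomogeneous
  weight are comparable. The factor 2 returns in the energy bound and in the regularity
  step.\<close>

lemma weight_sq_le: "\<xi> \<noteq> 0 \<Longrightarrow> (\<rho> \<xi>)\<^sup>2 \<le> 2 * (norm (frequency \<xi>))\<^sup>2"
  using norm_frequency_ge_1[of \<xi>] by (simp add: sobolev_weight_sq)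

text \<open>The weight is the length of the vector (1, \<xi>); adding the vectors of \<xi> - \<eta>
  and \<eta> gives (2, \<xi>), which is longer still.\<close>

lemma sobolev_weight_triangle: "\<rho> \<xi> \<le> \<rho> (\<xi> - \<eta>) + \<rho> \<eta>"
proof (rule power2_le_imp_le)
  let ?a = "norm (frequency (\<xi> - \<eta>))" and ?b = "norm (frequency \<eta>)"
  let ?A = "\<rho> (\<xi> - \<eta>)" and ?B = "\<rho> \<eta>"
  have "norm (frequency \<xi>) \<le> ?a + ?b"
    using norm_triangle_ineq[of "frequency (\<xi> - \<eta>)" "frequency \<eta>"] by (simp add: frequency_diff)
  then have "(norm (frequency \<xi>))\<^sup>2 \<le> (?a + ?b)\<^sup>2" by (rule power_mono) simp
  moreover have "?a * ?b \<le> ?A * ?B"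
    by (intro mult_mono norm_frequency_le_weight) auto
  ultimately show "(\<rho> \<xi>)\<^sup>2 \<le> (?A + ?B)\<^sup>2"
    by (simp add: sobolev_weight_sq power2_sum)
qed simp

section \<open>Exhaustion of the lattice by cubes\<close>

definition freq_box :: "nat \<Rightarrow> (int^'n) set"
  where "freq_box N = {\<xi>. \<forall>i. \<bar>\<xi> $ i\<bar> \<le> int N}"

text \<open>Cubes rather than balls, because a cube is a product set: sums of product functions over
  it factor into one-dimensional sums.\<close>

lemma freq_box_bij:
  "bij_betw vec_nth (freq_box N :: (int^'n::finite) set) (PiE UNIV (\<lambda>_. {- int N..int N}))"
  by (rule bij_betw_byWitness[where f' = vec_lambda]) (auto simp: freq_box_def abs_le_iff PiE_def Pi_def
      minus_le_iff)

lemma finite_freq_box [simp]: "finite (freq_box N :: (int^'n::finite) set)"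
  using bij_betw_finite[OF freq_box_bij] by (simp add: finite_PiE)

lemma freq_box_mono: "M \<le> N \<Longrightarrow> freq_box M \<subseteq> freq_box N"
  by (auto simp: freq_box_def intro: order_trans)

lemma uminus_freq_box [simp]: "- \<xi> \<in> freq_box N \<longleftrightarrow> \<xi> \<in> freq_box N"
  by (simp add: freq_box_def)

lemma finite_subset_freq_box:
  fixes A :: "(int^'n::finite) set"
  assumes "finite A"
  obtains N where "A \<subseteq> freq_box N"
proof -
  have "\<exists>N. \<xi> \<in> freq_box N" for \<xi> :: "int^'n"
  proof
    show "\<xi> \<in> freq_box (\<Sum>i\<in>UNIV. nat \<bar>\<xi> $ i\<bar>)"
      unfolding freq_box_def
    proof (intro CollectI allI)
      fix i
      have "nat \<bar>\<xi> $ i\<bar> \<le> (\<Sum>i\<in>UNIV. nat \<bar>\<xi> $ i\<bar>)"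
        by (rule member_le_sum) auto
      then show "\<bar>\<xi> $ i\<bar> \<le> int (\<Sum>i\<in>UNIV. nat \<bar>\<xi> $ i\<bar>)"
        using le_nat_iff by linarith
    qed
  qed
  then obtain M where M: "\<And>\<xi> :: int^'n. \<xi> \<in> freq_box (M \<xi>)" by metis
  have "A \<subseteq> freq_box (Max (insert 0 (M ` A)))"
  proof
    fix \<xi> assume "\<xi> \<in> A"
    then have "M \<xi> \<le> Max (insert 0 (M ` A))" using assms by (intro Max_ge) auto
    then show "\<xi> \<in> freq_box (Max (insert 0 (M ` A)))" using M[of \<xi>] freq_box_mono by blast
  qed
  then show ?thesis by (rule that)
qed

lemma freq_box_truncation_tendsto:
  fixes c :: "int^'n::finite \<Rightarrow> 'b::{topological_space, zero}"
  shows "(\<lambda>N. if \<xi> \<in> freq_box N then c \<xi> else 0) \<longlonglongrightarrow> c \<xi>"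
proof (rule tendsto_eventually)
  obtain M where "{\<xi>} \<subseteq> freq_box M" using finite_subset_freq_box[of "{\<xi>}"] by blast
  then have "\<xi> \<in> freq_box N" if "M \<le> N" for N using freq_box_mono[OF that] by blast
  then show "\<forall>\<^sub>F N in sequentially. (if \<xi> \<in> freq_box N then c \<xi> else 0) = c \<xi>"
    by (intro eventually_sequentiallyI[of M]) simp
qed

text \<open>Unordered sums converge along the net of all finite sets. The cubes are cofinal in it,
  which makes sequences available and with them dominated convergence.\<close>

lemma filterlim_freq_box:
  "filterlim (freq_box :: nat \<Rightarrow> (int^'n::finite) set) (finite_subsets_at_top UNIV) sequentially"
  unfolding filterlim_finite_subsets_at_top
proof (intro allI impI)
  fix X :: "(int^'n) set" assume "finite X \<and> X \<subseteq> UNIV"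
  then obtain N where N: "X \<subseteq> freq_box N" using finite_subset_freq_box by blast
  show "\<forall>\<^sub>F y in sequentially. finite (freq_box y :: (int^'n) set) \<and> X \<subseteq> freq_box y \<and> freq_box y \<subseteq> UNIV"
    using eventually_ge_at_top[of N]
    by eventually_elim (use N freq_box_mono in \<open>auto\<close>)
qed

lemma sum_freq_box_tendsto:
  fixes f :: "int^'n::finite \<Rightarrow> 'b::{t2_space,comm_monoid_add}"
  assumes "f summable_on UNIV"
  shows "(\<lambda>N. sum f (freq_box N)) \<longlonglongrightarrow> infsum f UNIV"
  using filterlim_compose[OF infsum_tendsto[OF assms] filterlim_freq_box] .

text \<open>The point is that 7/2 > 3. As n \<le> 3, the weight to the power -7/2 is at most its
  square to the power -7n/12; this splits into n factors, each bounded by a function of one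
  coordinate that decays like |k|^(-7/6).\<close>

lemma summable_weight:
  assumes dim: "CARD('n::finite) \<le> 3"
  shows "(\<lambda>\<xi>::int^'n. \<rho> \<xi> powr (-(7/2))) summable_on UNIV"
proof -
  define f where "f k = (1 + (real_of_int k)\<^sup>2) powr (-(7/12))" for k
  have f1: "f k \<le> real (nat \<bar>k\<bar>) powr (-(7/6))" if "k \<noteq> 0" for k
  proof -
    have "f k \<le> ((real (nat \<bar>k\<bar>))\<^sup>2) powr (-(7/12))"
      unfolding f_def using that by (intro powr_mono2') auto
    also have "\<dots> = real (nat \<bar>k\<bar>) powr (-(7/6))"
    proof -
      have "(real (nat \<bar>k\<bar>))\<^sup>2 = real (nat \<bar>k\<bar>) powr 2" using that by simp
      then show ?thesis by (simp only: powr_powr) simp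
    qed
    finally show ?thesis .
  qed
  have sm: "summable (\<lambda>n. real n powr (-(7/6)))"
    using summable_real_powr_iff[of "-(7/6)"] by simp
  \<comment> \<open>The 1 is the term k = 0, the factor 2 accounts for the two signs of k.\<close>
  define S where "S = 1 + 2 * (\<Sum>n. real n powr (-(7/6)))"
  have fS: "(\<Sum>k = - int N..int N. f k) \<le> S" for N
  proof -
    let ?g = "\<lambda>n::nat. real n powr (-(7/6))"
    have "(\<Sum>k = - int N..int N. f k) = (\<Sum>k\<in>{0} \<union> int ` {1..N} \<union> (\<lambda>n. - int n) ` {1..N}. f k)"
    proof (rule sum.cong[OF _ refl])
      show "{- int N..int N} = {0} \<union> int ` {1..N} \<union> (\<lambda>n. - int n) ` {1..N}"
      proof (intro set_eqI iffI)
        fix k assume k: "k \<in> {- int N..int N}"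
        consider "k = 0" | "k > 0" | "k < 0" by linarith
        then show "k \<in> {0} \<union> int ` {1..N} \<union> (\<lambda>n. - int n) ` {1..N}"
        proof cases
          case 2 then have "k = int (nat k)" "nat k \<in> {1..N}" using k by auto
          then show ?thesis by blast
        next
          case 3 then have "k = - int (nat (-k))" "nat (-k) \<in> {1..N}" using k by auto
          then show ?thesis by blast
        qed auto
      qed auto
    qed
    also have "\<dots> \<le> (\<Sum>k\<in>{0}. f k) + (\<Sum>k\<in>int ` {1..N}. f k) + (\<Sum>k\<in>(\<lambda>n. - int n) ` {1..N}. f k)"
      by (subst sum.union_disjoint; (subst sum.union_disjoint)?) auto
    also have "\<dots> = 1 + (\<Sum>n\<in>{1..N}. f (int n)) + (\<Sum>n\<in>{1..N}. f (- int n))"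
      by (subst (1 2) sum.reindex) (auto simp: inj_on_def f_def)
    also have "\<dots> \<le> 1 + (\<Sum>n\<in>{1..N}. ?g n) + (\<Sum>n\<in>{1..N}. ?g n)"
      using f1[of "int _"] f1[of "- int _"] by (intro add_mono sum_mono) fastforce+
    also have "\<dots> \<le> S"
      unfolding S_def using sum_le_suminf[OF sm, of "{1..N}"] by simp
    finally show ?thesis .
  qed
  have w: "\<rho> \<xi> powr (-(7/2)) \<le> (\<Prod>i\<in>UNIV. f (\<xi> $ i))" for \<xi> :: "int^'n"
  proof -
    let ?r = "(\<rho> \<xi>)\<^sup>2"
    have r1: "1 \<le> ?r" by (simp add: sobolev_weight_sq)
    have "\<rho> \<xi> powr (-(7/2)) = ?r powr (-(7/4))"
      by (simp add: powr_powr flip: powr_numeral)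
    also have "\<dots> \<le> ?r powr (-(7/12) * real CARD('n))"
      using dim r1 by (intro powr_mono) auto
    also have "\<dots> = (\<Prod>i\<in>(UNIV::'n set). ?r powr (-(7/12)))"
      using r1 by (simp add: powr_power mult.commute)
    also have "\<dots> \<le> (\<Prod>i\<in>UNIV. f (\<xi> $ i))"
    proof (intro prod_mono conjI)
      fix i :: 'n
      have "(real_of_int (\<xi> $ i))\<^sup>2 \<le> (norm (frequency \<xi>))\<^sup>2"
        using power_mono[OF abs_nth_le_norm_frequency, of \<xi> i 2] by simp
      then show "?r powr (-(7/12)) \<le> f (\<xi> $ i)"
        unfolding f_def sobolev_weight_sq by (intro powr_mono2') (auto intro: add_pos_nonneg)
    qed auto
    finally show ?thesis .
  qed
  show ?thesis
  proof (rule nonneg_summable_bounded(1))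
    fix F :: "(int^'n) set" assume "finite F"
    then obtain N where N: "F \<subseteq> freq_box N" using finite_subset_freq_box by blast
    have "(\<Sum>\<xi>\<in>F. \<rho> \<xi> powr (-(7/2))) \<le> (\<Sum>\<xi>\<in>(freq_box N :: (int^'n) set). \<rho> \<xi> powr (-(7/2)))"
      by (rule sum_mono2) (use N in auto)
    also have "\<dots> \<le> (\<Sum>\<xi>\<in>(freq_box N :: (int^'n) set). \<Prod>i\<in>UNIV. f (\<xi> $ i))"
      by (intro sum_mono w)
    also have "\<dots> = (\<Sum>g\<in>PiE (UNIV::'n set) (\<lambda>_. {- int N..int N}). \<Prod>i\<in>UNIV. f (g i))"
      by (rule sum.reindex_bij_betw[OF freq_box_bij])
    also have "\<dots> = (\<Prod>i\<in>(UNIV::'n set). \<Sum>k = - int N..int N. f k)"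
      by (subst prod_sum_PiE) auto
    also have "\<dots> \<le> (\<Prod>i\<in>(UNIV::'n set). S)"
      by (intro prod_mono conjI fS sum_nonneg) (auto simp: f_def)
    finally show "(\<Sum>\<xi>\<in>F. \<rho> \<xi> powr (-(7/2))) \<le> (\<Prod>i\<in>(UNIV::'n set). S)" .
  qed auto
qed

section \<open>Convolutions of Sobolev sequences\<close>

definition conv :: "(int^'n \<Rightarrow> complex) \<Rightarrow> (int^'n \<Rightarrow> complex) \<Rightarrow> int^'n \<Rightarrow> complex"
  where "conv c d \<xi> = (\<Sum>\<^sub>\<infinity>\<eta>. c (\<xi> - \<eta>) * d \<eta>)"

text \<open>The summability condition of \<open>sobolev\<close> on a bare sequence: the analysis
  takes place on coefficients before any distribution carries them.\<close>

definition sobolev_seq :: "real \<Rightarrow> (int^'n::finite \<Rightarrow> complex) \<Rightarrow> bool"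
  where "sobolev_seq s c \<longleftrightarrow> (\<lambda>\<xi>. \<rho> \<xi> powr (2 * s) * (cmod (c \<xi>))\<^sup>2) summable_on UNIV"

lemma sobolev_seq_dominated:
  fixes c :: "int^'n::finite \<Rightarrow> complex"
  assumes "g summable_on UNIV" "\<And>\<xi>. \<rho> \<xi> powr (2 * s) * (cmod (c \<xi>))\<^sup>2 \<le> g \<xi>"
  shows "sobolev_seq s c"
  unfolding sobolev_seq_def by (rule summable_on_comparison_test[OF assms(1)]) (use assms(2) in auto)

lemma sobolev_seq_mono:
  assumes "sobolev_seq s c" "t \<le> s"
  shows "sobolev_seq t c"
  using assms(1) unfolding sobolev_seq_def[of s]
  by (rule sobolev_seq_dominated) (use assms(2) in \<open>auto intro!: mult_right_mono powr_mono\<close>)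

lemma sobolev_seq_0: "sobolev_seq 0 c \<longleftrightarrow> (\<lambda>\<xi>. (cmod (c \<xi>))\<^sup>2) summable_on UNIV"
  by (simp add: sobolev_seq_def)

lemma bij_diff_left: "bij_betw (\<lambda>\<eta>. \<xi> - \<eta>) UNIV (UNIV :: 'a::ab_group_add set)"
  by (rule bij_betw_byWitness[where f' = "\<lambda>\<eta>. \<xi> - \<eta>"]) auto

text \<open>Cauchy-Schwarz after the reflection \<eta> \<mapsto> \<xi> - \<eta>. Hence
  \<open>conv\<close> of square summable sequences is a genuine sum and not the default value of
  \<open>infsum\<close>.\<close>

lemma abs_summable_conv:
  assumes "sobolev_seq 0 c" "sobolev_seq 0 d"
  shows "(\<lambda>\<eta>. norm (c (\<xi> - \<eta>) * d \<eta>)) summable_on UNIV"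
proof (rule abs_summable_product)
  show "(\<lambda>\<eta>. norm (c (\<xi> - \<eta>) * c (\<xi> - \<eta>))) summable_on UNIV"
    using assms(1) summable_on_reindex_bij_betw[OF bij_diff_left, of "\<lambda>\<xi>. (cmod (c \<xi>))\<^sup>2" \<xi>]
    by (simp add: sobolev_seq_0 norm_mult power2_eq_square)
  show "(\<lambda>\<eta>. norm (d \<eta> * d \<eta>)) summable_on UNIV"
    using assms(2) by (simp add: sobolev_seq_0 norm_mult power2_eq_square)
qed

text \<open>Replacing the larger base by the smaller one enlarges a negative power, and 3/2 + 2 =
  7/2 is the exponent that is summable over the lattice.\<close>

lemma powr_mult_le_sum:
  fixes x y :: real
  assumes "1 \<le> x" "1 \<le> y" "a \<ge> 3/2" "b \<ge> 2"
  shows "x powr (-a) * y powr (-b) \<le> x powr (-(7/2)) + y powr (-(7/2))"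
proof -
  have le: "x powr (-a) * y powr (-b) \<le> x powr (-(3/2)) * y powr (-2)"
    using assms by (intro mult_mono powr_mono) auto
  show ?thesis
  proof (cases "x \<le> y")
    case True
    then have "x powr (-(3/2)) * y powr (-2) \<le> x powr (-(3/2)) * x powr (-2)"
      using assms by (intro mult_left_mono powr_mono2') auto
    also have "\<dots> = x powr (-(7/2))" by (simp flip: powr_add)
    finally show ?thesis using le by (smt (verit) powr_ge_zero)
  next
    case False
    then have "x powr (-(3/2)) * y powr (-2) \<le> y powr (-(3/2)) * y powr (-2)"
      using assms by (intro mult_right_mono powr_mono2') auto
    also have "\<dots> = y powr (-(7/2))" by (simp flip: powr_add)
    finally show ?thesis using le by (smt (verit) powr_ge_zero)
  qed
qed

text \<open>Cauchy-Schwarz with inserted weights of exponents -r and r splits the convolution into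
  two factors: a sum of weights alone, which the weight of the target space keeps bounded uniformly
  in \<xi>, and the convolution of the two summable sequences A and B, which is again
  summable.\<close>

lemma sobolev_seq_conv:
  fixes c d :: "int^'n::finite \<Rightarrow> complex"
  assumes dim: "CARD('n) \<le> 3" and r: "1 \<le> r" and c: "sobolev_seq r c" and d: "sobolev_seq r d"
  shows "sobolev_seq (r - 3/4) (conv c d)"
proof -
  let ?w = "\<lambda>\<xi>::int^'n. \<rho> \<xi>"
  define t where "t = 2 * (r - 3/4)"
  have t: "t \<ge> 0" "t = 2 * r - 3/2" using r by (auto simp: t_def)
  define S where "S = (\<Sum>\<^sub>\<infinity>\<xi>. ?w \<xi> powr (-(7/2)))"
  note sw = summable_weight[OF dim]
  \<comment> \<open>The factor \<open>2 powr t\<close> comes from bounding the weight of \<xi> by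
    twice the larger of the two weights. Each of the two resulting terms is at most
    \<open>?z\<close>, whose sum is at most 2S.\<close>
  define K where "K = 2 powr t * (4 * S)"
  have K: "?w \<xi> powr t * (\<Sum>\<eta>\<in>H. ?w (\<xi> - \<eta>) powr (-(2*r)) * ?w \<eta> powr (-(2*r))) \<le> K"
    if "finite H" for \<xi> and H :: "(int^'n) set"
  proof -
    let ?z = "\<lambda>\<eta>. ?w (\<xi> - \<eta>) powr (-(7/2)) + ?w \<eta> powr (-(7/2))"
    have "?w \<xi> powr t * (?w (\<xi> - \<eta>) powr (-(2*r)) * ?w \<eta> powr (-(2*r))) \<le> 2 powr t * (2 * ?z \<eta>)" for \<eta>
    proof -
      let ?x = "?w (\<xi> - \<eta>)" and ?y = "?w \<eta>"
      have "?w \<xi> powr t \<le> (2 * max ?x ?y) powr t"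
        using sobolev_weight_triangle[of \<xi> \<eta>] t(1) by (intro powr_mono2) auto
      also have "\<dots> \<le> 2 powr t * (?x powr t + ?y powr t)"
        by (auto simp: powr_mult max_def)
      finally have "?w \<xi> powr t * (?x powr (-(2*r)) * ?y powr (-(2*r)))
           \<le> 2 powr t * (?x powr t + ?y powr t) * (?x powr (-(2*r)) * ?y powr (-(2*r)))"
        by (rule mult_right_mono) simp
      also have "\<dots> = 2 powr t * ((?x powr t * ?x powr (-(2*r))) * ?y powr (-(2*r))
            + (?y powr t * ?y powr (-(2*r))) * ?x powr (-(2*r)))"
        by (simp add: algebra_simps)
      also have "\<dots> = 2 powr t * (?x powr (-(3/2)) * ?y powr (-(2*r))
          + ?y powr (-(3/2)) * ?x powr (-(2*r)))"
        by (simp add: t(2) flip: powr_add)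
      also have "\<dots> \<le> 2 powr t * (2 * ?z \<eta>)"
        using powr_mult_le_sum[of ?x ?y "3/2" "2*r"] powr_mult_le_sum[of ?y ?x "3/2" "2*r"] r
        by (intro mult_left_mono) auto
      finally show ?thesis .
    qed
    then have "?w \<xi> powr t * (\<Sum>\<eta>\<in>H. ?w (\<xi> - \<eta>) powr (-(2*r)) * ?w \<eta> powr (-(2*r)))
        \<le> (\<Sum>\<eta>\<in>H. 2 powr t * (2 * ?z \<eta>))"
      unfolding sum_distrib_left by (rule sum_mono)
    also have "\<dots> = 2 powr t * (2 * ((\<Sum>\<eta>\<in>H. ?w (\<xi> - \<eta>) powr (-(7/2))) + (\<Sum>\<eta>\<in>H. ?w \<eta> powr (-(7/2)))))"
      by (simp add: sum.distrib flip: sum_distrib_left)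
    also have "\<dots> \<le> 2 powr t * (2 * (S + S))"
    proof (intro mult_left_mono add_mono)
      show "(\<Sum>\<eta>\<in>H. ?w \<eta> powr (-(7/2))) \<le> S"
        unfolding S_def by (rule finite_sum_le_infsum[OF sw that]) auto
      have "(\<Sum>\<eta>\<in>H. ?w (\<xi> - \<eta>) powr (-(7/2))) = (\<Sum>\<eta>\<in>(\<lambda>\<eta>. \<xi> - \<eta>) ` H. ?w \<eta> powr (-(7/2)))"
        by (subst sum.reindex) (auto simp: inj_on_def)
      also have "\<dots> \<le> S"
        unfolding S_def by (rule finite_sum_le_infsum[OF sw]) (use that in auto)
      finally show "(\<Sum>\<eta>\<in>H. ?w (\<xi> - \<eta>) powr (-(7/2))) \<le> S" .
    qed auto
    finally show ?thesis by (simp add: K_def)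
  qed
  have K0: "0 \<le> K" using K[of "{}"] by simp
  define A where "A = (\<lambda>\<xi>. ?w \<xi> powr (2*r) * (cmod (c \<xi>))\<^sup>2)"
  define B where "B = (\<lambda>\<xi>. ?w \<xi> powr (2*r) * (cmod (d \<xi>))\<^sup>2)"
  have A: "A summable_on UNIV" "\<And>\<xi>. 0 \<le> A \<xi>" and B: "B summable_on UNIV" "\<And>\<xi>. 0 \<le> B \<xi>"
    using c d by (auto simp: A_def B_def sobolev_seq_def)
  have "(\<lambda>(x,y). A x * B y) summable_on UNIV \<times> UNIV"
    by (rule summable_on_SigmaI[where g = "\<lambda>x. A x * infsum B UNIV"])
      (use A B in \<open>auto intro!: has_sum_cmult_right has_sum_infsum summable_on_cmult_left\<close>)
  \<comment> \<open>The shear (\<xi>, \<eta>) \<mapsto> (\<xi> - \<eta>, \<eta>) turns the summable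
    product family into the terms of the convolution of A and B.\<close>
  moreover have bij: "bij_betw (\<lambda>(\<xi>,\<eta>). (\<xi> - \<eta>, \<eta>)) (UNIV \<times> UNIV) (UNIV \<times> (UNIV :: (int^'n) set))"
    by (rule bij_betw_byWitness[where f' = "\<lambda>(x,y). (x + y, y)"]) auto
  ultimately have s2: "(\<lambda>(\<xi>,\<eta>). A (\<xi> - \<eta>) * B \<eta>) summable_on UNIV \<times> UNIV"
    using summable_on_reindex_bij_betw[OF bij, of "\<lambda>(x,y). A x * B y"] by (simp add: case_prod_unfold)
  have AB: "(\<lambda>\<eta>. A (\<xi> - \<eta>) * B \<eta>) summable_on UNIV" for \<xi>
    using summable_on_SigmaD1[OF s2[folded split_def], of \<xi>] by simp
  \<comment> \<open>Cauchy-Schwarz is applied to finite sums; the resulting bound is uniform in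
    \<open>H\<close> and so passes to the full convolution.\<close>
  have fin: "?w \<xi> powr t * (\<Sum>\<eta>\<in>H. cmod (c (\<xi> - \<eta>) * d \<eta>))\<^sup>2 \<le> K * (\<Sum>\<^sub>\<infinity>\<eta>. A (\<xi> - \<eta>) * B \<eta>)"
    if H: "finite H" for \<xi> and H :: "(int^'n) set"
  proof -
    let ?p = "\<lambda>\<eta>. ?w (\<xi> - \<eta>) powr (-r) * ?w \<eta> powr (-r)"
    let ?q = "\<lambda>\<eta>. (?w (\<xi> - \<eta>) powr r * cmod (c (\<xi> - \<eta>))) * (?w \<eta> powr r * cmod (d \<eta>))"
    have "(\<Sum>\<eta>\<in>H. cmod (c (\<xi> - \<eta>) * d \<eta>)) = (\<Sum>\<eta>\<in>H. ?p \<eta> * ?q \<eta>)"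
      by (intro sum.cong) (auto simp: norm_mult powr_minus field_simps)
    then have "(\<Sum>\<eta>\<in>H. cmod (c (\<xi> - \<eta>) * d \<eta>))\<^sup>2 \<le> (\<Sum>\<eta>\<in>H. (?p \<eta>)\<^sup>2) * (\<Sum>\<eta>\<in>H. (?q \<eta>)\<^sup>2)"
      using Cauchy_Schwarz_ineq_sum[of ?p ?q H] by simp
    moreover have "(?p \<eta>)\<^sup>2 = ?w (\<xi> - \<eta>) powr (-(2*r)) * ?w \<eta> powr (-(2*r))" for \<eta>
      by (simp add: power_mult_distrib powr_power)
    moreover have "(?q \<eta>)\<^sup>2 = A (\<xi> - \<eta>) * B \<eta>" for \<eta>
      by (simp add: A_def B_def power_mult_distrib powr_power)
    ultimately have "?w \<xi> powr t * (\<Sum>\<eta>\<in>H. cmod (c (\<xi> - \<eta>) * d \<eta>))\<^sup>2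
       \<le> ?w \<xi> powr t * ((\<Sum>\<eta>\<in>H. ?w (\<xi> - \<eta>) powr (-(2*r)) * ?w \<eta> powr (-(2*r))) * (\<Sum>\<eta>\<in>H. A (\<xi> - \<eta>) * B \<eta>))"
      by (intro mult_left_mono) auto
    also have "\<dots> = (?w \<xi> powr t * (\<Sum>\<eta>\<in>H. ?w (\<xi> - \<eta>) powr (-(2*r)) * ?w \<eta> powr (-(2*r)))) * (\<Sum>\<eta>\<in>H. A (\<xi>
        - \<eta>) * B \<eta>)"
      by simp
    also have "\<dots> \<le> K * (\<Sum>\<^sub>\<infinity>\<eta>. A (\<xi> - \<eta>) * B \<eta>)"
      by (intro mult_mono K[OF H] finite_sum_le_infsum AB H) (auto simp: K0 A B sum_nonneg)
    finally show ?thesis .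
  qed
  have c0: "sobolev_seq 0 c" "sobolev_seq 0 d" using c d r by (auto elim: sobolev_seq_mono)
  have "?w \<xi> powr t * (cmod (conv c d \<xi>))\<^sup>2 \<le> K * (\<Sum>\<^sub>\<infinity>\<eta>. A (\<xi> - \<eta>) * B \<eta>)" for \<xi>
  proof -
    have "((\<lambda>H. \<Sum>\<eta>\<in>H. c (\<xi> - \<eta>) * d \<eta>) \<longlongrightarrow> conv c d \<xi>) (finite_subsets_at_top UNIV)"
      unfolding conv_def by (rule infsum_tendsto[OF abs_summable_summable[OF abs_summable_conv[OF c0]]])
    then have "((\<lambda>H. ?w \<xi> powr t * (cmod (\<Sum>\<eta>\<in>H. c (\<xi>
        - \<eta>) * d \<eta>))\<^sup>2) \<longlongrightarrow> ?w \<xi> powr t * (cmod (conv c d \<xi>))\<^sup>2)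
        (finite_subsets_at_top UNIV)"
      by (intro tendsto_intros)
    then show ?thesis
    proof (rule tendsto_upperbound)
      show "\<forall>\<^sub>F H in finite_subsets_at_top UNIV. ?w \<xi> powr t * (cmod (\<Sum>\<eta>\<in>H. c (\<xi> - \<eta>) * d \<eta>))\<^sup>2
           \<le> K * (\<Sum>\<^sub>\<infinity>\<eta>. A (\<xi> - \<eta>) * B \<eta>)"
      proof (rule eventually_finite_subsets_at_top_weakI)
        fix H :: "(int^'n) set" assume "finite H"
        have "(cmod (\<Sum>\<eta>\<in>H. c (\<xi> - \<eta>) * d \<eta>))\<^sup>2 \<le> (\<Sum>\<eta>\<in>H. cmod (c (\<xi> - \<eta>) * d \<eta>))\<^sup>2"
          by (intro power_mono norm_sum) auto
        then have "?w \<xi> powr t * (cmod (\<Sum>\<eta>\<in>H. c (\<xi> - \<eta>) * d \<eta>))\<^sup>2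
            \<le> ?w \<xi> powr t * (\<Sum>\<eta>\<in>H. cmod (c (\<xi> - \<eta>) * d \<eta>))\<^sup>2"
          by (rule mult_left_mono) simp
        also note fin[OF \<open>finite H\<close>, of \<xi>]
        finally show "?w \<xi> powr t * (cmod (\<Sum>\<eta>\<in>H. c (\<xi> - \<eta>) * d \<eta>))\<^sup>2 \<le> K * (\<Sum>\<^sub>\<infinity>\<eta>. A (\<xi> - \<eta>) * B \<eta>)" .
      qed
    qed simp
  qed
  then show ?thesis
    by (intro sobolev_seq_dominated[where g = "\<lambda>\<xi>. K * (\<Sum>\<^sub>\<infinity>\<eta>. A (\<xi> - \<eta>) * B \<eta>)"])
      (use summable_on_Sigma_banach[OF s2[folded split_def]] in \<open>auto simp: t_def intro!:
          summable_on_cmult_right\<close>)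
qed

section \<open>The viscous symbol and the Leray projection\<close>


text \<open>Fourier multiplier of the negative viscous operator: two derivatives contribute (2 pi
  i)^2 = -4 pi^2, and the symmetry of the tensor permits the gradient in place of the
  strain.\<close>

definition viscous_symbol :: "('n::finite) tensor \<Rightarrow> (real^'n) \<Rightarrow> ('n \<Rightarrow> complex) \<Rightarrow> 'n \<Rightarrow> complex"
  where "viscous_symbol a x z k = complex_of_real (4 * pi\<^sup>2) *
    (\<Sum>\<alpha>\<in>UNIV. \<Sum>j\<in>UNIV. \<Sum>\<beta>\<in>UNIV. complex_of_real (a k j \<alpha> \<beta> * x $ \<alpha> * x $ \<beta>) * z j)"

text \<open>Coefficients of the divergence form \<partial>_j (u_j u_k): the derivative acts after
  the product, so only U itself has to be square summable. Agreement with u_j \<partial>_j u_k is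
  \<open>convection_coeff_eq\<close>.\<close>

definition convection_coeff :: "('n \<Rightarrow> int^'n \<Rightarrow> complex) \<Rightarrow> 'n::finite \<Rightarrow> int^'n \<Rightarrow> complex"
  where "convection_coeff U k \<xi> = 2 * pi * \<i> * (\<Sum>j\<in>UNIV. of_int (\<xi> $ j) * conv (U j) (U k) \<xi>)"

definition hermitian :: "(int^'n \<Rightarrow> complex) \<Rightarrow> bool"
  where "hermitian c \<longleftrightarrow> (\<forall>\<xi>. c (- \<xi>) = cnj (c \<xi>))"

definition solenoidal :: "('n::finite \<Rightarrow> int^'n \<Rightarrow> complex) \<Rightarrow> bool"
  where "solenoidal U \<longleftrightarrow> (\<forall>\<xi>. (\<Sum>k\<in>UNIV. of_int (\<xi> $ k) * U k \<xi>) = 0)"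

text \<open>An algebraic Korn inequality. Ellipticity is tested with the symmetric part \<zeta> of
  the matrix with entries x_k v_\<alpha>, whose trace is x . v = 0. The symmetries of the tensor
  make the four products inside \<zeta> \<zeta> contribute equally, and x . v = 0 also gives
  |\<zeta>|^2 = |x|^2 |v|^2 / 2, the origin of the factor 1/2.\<close>

lemma korn_quadratic_form:
  fixes a :: "('n::finite) tensor" and x v :: "'n \<Rightarrow> real"
  assumes sym: "tensor_symmetric a"
    and ell: "\<And>\<zeta>::real^'n^'n. \<zeta> = transpose \<zeta> \<Longrightarrow> trace \<zeta> = 0 \<Longrightarrow>
      (\<Sum>k\<in>UNIV. \<Sum>j\<in>UNIV. \<Sum>\<alpha>\<in>UNIV. \<Sum>\<beta>\<in>UNIV. a k j \<alpha> \<beta> * \<zeta> $ k $ \<alpha> * \<zeta> $ j $ \<beta>)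
      \<ge> C * (\<Sum>k\<in>UNIV. \<Sum>\<alpha>\<in>UNIV. (\<zeta> $ k $ \<alpha>)\<^sup>2)"
    and div: "(\<Sum>k\<in>UNIV. x k * v k) = 0"
  shows "C / 2 * (\<Sum>k\<in>UNIV. (x k)\<^sup>2) * (\<Sum>k\<in>UNIV. (v k)\<^sup>2)
     \<le> (\<Sum>k\<in>UNIV. \<Sum>j\<in>UNIV. \<Sum>\<alpha>\<in>UNIV. \<Sum>\<beta>\<in>UNIV. a k j \<alpha> \<beta> * x \<alpha> * x \<beta> * v k * v j)"
proof -
  define \<zeta> :: "real^'n^'n" where "\<zeta> = (\<chi> k \<alpha>. (x k * v \<alpha> + x \<alpha> * v k) / 2)"
  let ?S = "\<lambda>g::'n\<Rightarrow>'n\<Rightarrow>'n\<Rightarrow>'n\<Rightarrow>real. \<Sum>k\<in>UNIV. \<Sum>j\<in>UNIV. \<Sum>\<alpha>\<in>UNIV. \<Sum>\<beta>\<in>UNIV. g k j \<alpha> \<beta>"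
  have s1: "a k j \<alpha> \<beta> = a \<alpha> j k \<beta>" and s2: "a k j \<alpha> \<beta> = a k \<beta> \<alpha> j" for k j \<alpha> \<beta>
    using sym unfolding tensor_symmetric_def by blast+
  \<comment> \<open>The bound indices k and \<alpha> exchange names; \<open>sw2\<close> does the
    same for j and \<beta>.\<close>
  have sw1: "?S g = ?S (\<lambda>k j \<alpha> \<beta>. g \<alpha> j k \<beta>)" for g
  proof -
    have "?S g = (\<Sum>k\<in>UNIV. \<Sum>\<alpha>\<in>UNIV. \<Sum>j\<in>UNIV. \<Sum>\<beta>\<in>UNIV. g k j \<alpha> \<beta>)"
      by (rule sum.cong[OF refl], rule sum.swap)
    also have "\<dots> = (\<Sum>\<alpha>\<in>UNIV. \<Sum>k\<in>UNIV. \<Sum>j\<in>UNIV. \<Sum>\<beta>\<in>UNIV. g k j \<alpha> \<beta>)"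
      by (rule sum.swap)
    also have "\<dots> = (\<Sum>\<alpha>\<in>UNIV. \<Sum>j\<in>UNIV. \<Sum>k\<in>UNIV. \<Sum>\<beta>\<in>UNIV. g k j \<alpha> \<beta>)"
      by (rule sum.cong[OF refl], rule sum.swap)
    finally show ?thesis .
  qed
  have sw2: "?S g = ?S (\<lambda>k j \<alpha> \<beta>. g k \<beta> \<alpha> j)" for g
  proof -
    have "?S g = (\<Sum>k\<in>UNIV. \<Sum>\<alpha>\<in>UNIV. \<Sum>j\<in>UNIV. \<Sum>\<beta>\<in>UNIV. g k j \<alpha> \<beta>)"
      by (rule sum.cong[OF refl], rule sum.swap)
    also have "\<dots> = (\<Sum>k\<in>UNIV. \<Sum>\<alpha>\<in>UNIV. \<Sum>\<beta>\<in>UNIV. \<Sum>j\<in>UNIV. g k j \<alpha> \<beta>)"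
      by (rule sum.cong[OF refl], rule sum.cong[OF refl], rule sum.swap)
    also have "\<dots> = (\<Sum>k\<in>UNIV. \<Sum>\<beta>\<in>UNIV. \<Sum>\<alpha>\<in>UNIV. \<Sum>j\<in>UNIV. g k j \<alpha> \<beta>)"
      by (rule sum.cong[OF refl], rule sum.swap)
    finally show ?thesis .
  qed
  define q where "q k j \<alpha> \<beta> = a k j \<alpha> \<beta> * x \<alpha> * x \<beta> * v k * v j" for k j \<alpha> \<beta>
  have "\<zeta> = transpose \<zeta>" by (simp add: \<zeta>_def transpose_def vec_eq_iff add.commute)
  moreover have "trace \<zeta> = 0" using div by (simp add: trace_def \<zeta>_def mult.commute)
  ultimately have "C * (\<Sum>k\<in>UNIV. \<Sum>\<alpha>\<in>UNIV. (\<zeta> $ k $ \<alpha>)\<^sup>2)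
      \<le> ?S (\<lambda>k j \<alpha> \<beta>. a k j \<alpha> \<beta> * \<zeta> $ k $ \<alpha> * \<zeta> $ j $ \<beta>)"
    by (rule ell)
  also have "\<dots> = ?S (\<lambda>k j \<alpha> \<beta>. q \<alpha> \<beta> k j / 4 + q \<alpha> j k \<beta> / 4 + q k \<beta> \<alpha> j / 4 + q k j \<alpha> \<beta> / 4)"
  proof (intro sum.cong refl)
    fix k j \<alpha> \<beta>
    have "a \<alpha> \<beta> k j = a k j \<alpha> \<beta>" "a \<alpha> j k \<beta> = a k j \<alpha> \<beta>" "a k \<beta> \<alpha> j = a k j \<alpha> \<beta>"
      using s1 s2 by metis+
    then show "a k j \<alpha> \<beta> * \<zeta> $ k $ \<alpha> * \<zeta> $ j $ \<beta> = q \<alpha> \<beta> k j / 4 + q \<alpha> j k \<beta> / 4 + q k \<beta> \<alpha> j / 4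
        + q k j \<alpha> \<beta> / 4"
      by (simp add: q_def \<zeta>_def algebra_simps add_divide_distrib)
  qed
  also have "\<dots> = ?S (\<lambda>k j \<alpha> \<beta>. q \<alpha> \<beta> k j) / 4 + ?S (\<lambda>k j \<alpha> \<beta>. q \<alpha> j k \<beta>) / 4
      + ?S (\<lambda>k j \<alpha> \<beta>. q k \<beta> \<alpha> j) / 4 + ?S q / 4"
    by (simp add: sum.distrib sum_divide_distrib)
  also have "?S (\<lambda>k j \<alpha> \<beta>. q \<alpha> \<beta> k j) = ?S q"
    using sw1[of q] sw2[of "\<lambda>k j \<alpha> \<beta>. q \<alpha> j k \<beta>"] by simp
  also have "?S (\<lambda>k j \<alpha> \<beta>. q \<alpha> j k \<beta>) = ?S q" using sw1[of q] by simp
  also have "?S (\<lambda>k j \<alpha> \<beta>. q k \<beta> \<alpha> j) = ?S q" using sw2[of q] by simp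
  also have "(\<Sum>k\<in>UNIV. \<Sum>\<alpha>\<in>UNIV. (\<zeta> $ k $ \<alpha>)\<^sup>2) = (\<Sum>k\<in>UNIV. (x k)\<^sup>2) * (\<Sum>k\<in>UNIV. (v k)\<^sup>2) / 2"
  proof -
    have "(\<Sum>k\<in>UNIV. \<Sum>\<alpha>\<in>UNIV. (\<zeta> $ k $ \<alpha>)\<^sup>2)
      = (\<Sum>k\<in>UNIV. \<Sum>\<alpha>\<in>UNIV. ((x k)\<^sup>2 * (v \<alpha>)\<^sup>2 + (v k)\<^sup>2 * (x \<alpha>)\<^sup>2
          + 2 * ((x k * v k) * (x \<alpha> * v \<alpha>))) / 4)"
      by (intro sum.cong refl) (simp add: \<zeta>_def power2_eq_square algebra_simps)
    also have "\<dots> = ((\<Sum>k\<in>UNIV. (x k)\<^sup>2) * (\<Sum>k\<in>UNIV. (v k)\<^sup>2) + (\<Sum>k\<in>UNIV. (v k)\<^sup>2) * (\<Sum>k\<in>UNIV. (x k)\<^sup>2)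
        + 2 * ((\<Sum>k\<in>UNIV. x k * v k) * (\<Sum>k\<in>UNIV. x k * v k))) / 4"
      unfolding sum_product by (simp add: sum.distrib sum_distrib_left flip: sum_divide_distrib)
    finally show ?thesis using div by simp
  qed
  finally show ?thesis unfolding q_def by simp
qed

text \<open>As x is real, orthogonality passes to the real and the imaginary part of z, and the real
  part of the sesquilinear form is the sum of the real quadratic forms at these two vectors.\<close>

lemma viscous_symbol_coercive:
  fixes a :: "('n::finite) tensor"
  assumes sym: "tensor_symmetric a" and ell: "relaxed_elliptic a"
  obtains c where "c > 0" and "\<And>x z. (\<Sum>k\<in>UNIV. complex_of_real (x $ k) * z k) = 0 \<Longrightarrow>
    c * (norm x)\<^sup>2 * (\<Sum>k\<in>UNIV. (cmod (z k))\<^sup>2) \<le> Re (\<Sum>k\<in>UNIV. viscous_symbol a x z k * cnj (z k))"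
proof -
  obtain C where C: "C > 0" and
    E: "\<And>\<zeta>::real^'n^'n. \<zeta> = transpose \<zeta> \<Longrightarrow> trace \<zeta> = 0 \<Longrightarrow>
      (\<Sum>k\<in>UNIV. \<Sum>j\<in>UNIV. \<Sum>\<alpha>\<in>UNIV. \<Sum>\<beta>\<in>UNIV. a k j \<alpha> \<beta> * \<zeta> $ k $ \<alpha> * \<zeta> $ j $ \<beta>)
      \<ge> inverse C * (\<Sum>k\<in>UNIV. \<Sum>\<alpha>\<in>UNIV. (\<zeta> $ k $ \<alpha>)\<^sup>2)"
    using ell unfolding relaxed_elliptic_def by blast
  define c where "c = 4 * pi\<^sup>2 * (inverse C / 2)"
  show ?thesis
  proof
    show "c > 0" using C by (simp add: c_def)
    fix x :: "real^'n" and z :: "'n \<Rightarrow> complex"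
    assume d: "(\<Sum>k\<in>UNIV. complex_of_real (x $ k) * z k) = 0"
    have dR: "(\<Sum>k\<in>UNIV. x $ k * Re (z k)) = 0" and dI: "(\<Sum>k\<in>UNIV. x $ k * Im (z k)) = 0"
      using arg_cong[OF d, of Re] arg_cong[OF d, of Im] by simp_all
    let ?Q = "\<lambda>v. \<Sum>k\<in>UNIV. \<Sum>j\<in>UNIV. \<Sum>\<alpha>\<in>UNIV. \<Sum>\<beta>\<in>UNIV. a k j \<alpha> \<beta> * x $ \<alpha> * x $ \<beta> * v k * v j"
    have nx: "(norm x)\<^sup>2 = (\<Sum>k\<in>UNIV. (x $ k)\<^sup>2)"
      unfolding power2_norm_eq_inner inner_vec_def by (simp add: power2_eq_square)
    have "Re (\<Sum>k\<in>UNIV. viscous_symbol a x z k * cnj (z k))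
      = (\<Sum>k\<in>UNIV. \<Sum>\<alpha>\<in>UNIV. \<Sum>j\<in>UNIV. \<Sum>\<beta>\<in>UNIV. 4 * pi\<^sup>2 * (a k j \<alpha> \<beta> * x $ \<alpha> * x $ \<beta> * (Re (z k) * Re (z j)
          + Im (z k) * Im (z j))))"
      unfolding viscous_symbol_def sum_distrib_left sum_distrib_right Re_sum
      by (intro sum.cong refl) (simp add: algebra_simps)
    also have "\<dots> = (\<Sum>k\<in>UNIV. \<Sum>j\<in>UNIV. \<Sum>\<alpha>\<in>UNIV. \<Sum>\<beta>\<in>UNIV. 4 * pi\<^sup>2 * (a k j \<alpha> \<beta> * x $ \<alpha> * x $ \<beta> * (Re (z k)
        * Re (z j) + Im (z k) * Im (z j))))"
      by (rule sum.cong[OF refl], rule sum.swap)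
    also have "\<dots> = 4 * pi\<^sup>2 * (?Q (\<lambda>k. Re (z k)) + ?Q (\<lambda>k. Im (z k)))"
      by (simp add: sum_distrib_left sum.distrib algebra_simps)
    also have "\<dots> \<ge> 4 * pi\<^sup>2 * (inverse C / 2 * (norm x)\<^sup>2 * (\<Sum>k\<in>UNIV. (Re (z k))\<^sup>2)
        + inverse C / 2 * (norm x)\<^sup>2 * (\<Sum>k\<in>UNIV. (Im (z k))\<^sup>2))"
      unfolding nx
      by (intro mult_left_mono add_mono korn_quadratic_form[OF sym E] dR dI) auto
    finally show "c * (norm x)\<^sup>2 * (\<Sum>k\<in>UNIV. (cmod (z k))\<^sup>2)
        \<le> Re (\<Sum>k\<in>UNIV. viscous_symbol a x z k * cnj (z k))"
      by (simp add: c_def cmod_power2 sum.distrib algebra_simps)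
  qed
qed

lemma conv_finite_support:
  assumes "finite I" "\<And>\<xi>. \<xi> \<notin> I \<Longrightarrow> d \<xi> = 0"
  shows "conv c d \<xi> = (\<Sum>\<eta>\<in>I. c (\<xi> - \<eta>) * d \<eta>)"
  unfolding conv_def
  by (subst infsum_cong_neutral[where T = I and g = "\<lambda>\<eta>. c (\<xi> - \<eta>) * d \<eta>"]) (use assms in auto)

text \<open>Fourier version of the vanishing integral of ((u . \<nabla>) u) . u. For solenoidal U
  the \<xi> in \<xi> . U(\<xi> - \<eta>) may be replaced by \<eta>, so \<open>T \<eta> \<xi>\<close>
  is the conjugate of \<open>T \<xi> \<eta>\<close>. The double sum is thus real, and the factor 2
  pi i makes the total purely imaginary.\<close>

lemma convection_energy_zero:
  assumes fin: "finite I" and supp: "\<And>k \<xi>. \<xi> \<notin> I \<Longrightarrow> U k \<xi> = 0"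
    and herm: "\<And>k. hermitian (U k)" and sol: "solenoidal U"
  shows "Re (\<Sum>\<xi>\<in>I. \<Sum>k\<in>UNIV. convection_coeff U k \<xi> * cnj (U k \<xi>)) = 0"
proof -
  define T where "T \<xi> \<eta> = (\<Sum>k\<in>UNIV. (\<Sum>j\<in>UNIV. of_int (\<xi> $ j) * U j (\<xi>
      - \<eta>)) * (U k \<eta> * cnj (U k \<xi>)))" for \<xi> \<eta>
  have h: "cnj (U k \<xi>) = U k (- \<xi>)" for k \<xi>
    using herm[of k] by (simp add: hermitian_def)
  have "cnj (T \<xi> \<eta>) = T \<eta> \<xi>" for \<xi> \<eta>
  proof -
    have "(\<Sum>j\<in>UNIV. of_int ((\<eta> - \<xi>) $ j) * U j (\<eta> - \<xi>)) = 0"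
      using sol by (simp only: solenoidal_def)
    then have "(\<Sum>j\<in>UNIV. of_int (\<xi> $ j) * U j (\<eta> - \<xi>)) = (\<Sum>j\<in>UNIV. of_int (\<eta> $ j) * U j (\<eta> - \<xi>))"
      by (simp add: left_diff_distrib sum_subtractf)
    then have "T \<eta> \<xi> = (\<Sum>k\<in>UNIV. (\<Sum>j\<in>UNIV. of_int (\<xi> $ j) * U j (\<eta> - \<xi>)) * (U k \<xi> * cnj (U k \<eta>)))"
      by (simp add: T_def)
    also have "\<dots> = cnj (T \<xi> \<eta>)"
      by (simp add: T_def h mult.commute)
    finally show ?thesis by simp
  qed
  then have "cnj (\<Sum>\<xi>\<in>I. \<Sum>\<eta>\<in>I. T \<xi> \<eta>) = (\<Sum>\<xi>\<in>I. \<Sum>\<eta>\<in>I. T \<eta> \<xi>)"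
    by simp
  also have "\<dots> = (\<Sum>\<xi>\<in>I. \<Sum>\<eta>\<in>I. T \<xi> \<eta>)" by (rule sum.swap)
  finally have real: "Im (\<Sum>\<xi>\<in>I. \<Sum>\<eta>\<in>I. T \<xi> \<eta>) = 0"
    using complex_cnj_cancel_iff by (metis Reals_cnj_iff complex_is_Real_iff)
  have "(\<Sum>\<xi>\<in>I. \<Sum>k\<in>UNIV. convection_coeff U k \<xi> * cnj (U k \<xi>))
     = 2 * pi * \<i> * (\<Sum>\<xi>\<in>I. \<Sum>k\<in>UNIV. \<Sum>\<eta>\<in>I. (\<Sum>j\<in>UNIV. of_int (\<xi> $ j) * U j (\<xi>
         - \<eta>)) * (U k \<eta> * cnj (U k \<xi>)))"
    unfolding sum_distrib_left
  proof (intro sum.cong refl)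
    fix \<xi> k
    have "(\<Sum>j\<in>UNIV. of_int (\<xi> $ j) * conv (U j) (U k) \<xi>)
        = (\<Sum>j\<in>UNIV. \<Sum>\<eta>\<in>I. of_int (\<xi> $ j) * U j (\<xi> - \<eta>) * U k \<eta>)"
      by (simp add: conv_finite_support[OF fin supp] sum_distrib_left mult.assoc)
    also have "\<dots> = (\<Sum>\<eta>\<in>I. (\<Sum>j\<in>UNIV. of_int (\<xi> $ j) * U j (\<xi> - \<eta>)) * U k \<eta>)"
      by (subst sum.swap) (simp add: sum_distrib_right)
    finally show "convection_coeff U k \<xi> * cnj (U k \<xi>) =
         (\<Sum>\<eta>\<in>I. 2 * pi * \<i> * ((\<Sum>j\<in>UNIV. of_int (\<xi> $ j) * U j (\<xi> - \<eta>)) * (U k \<eta> * cnj (U k \<xi>))))"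
      by (simp add: convection_coeff_def sum_distrib_left sum_distrib_right mult.assoc)
  qed
  also have "(\<Sum>\<xi>\<in>I. \<Sum>k\<in>UNIV. \<Sum>\<eta>\<in>I. (\<Sum>j\<in>UNIV. of_int (\<xi> $ j) * U j (\<xi> - \<eta>)) * (U k \<eta> * cnj (U k \<xi>)))
      = (\<Sum>\<xi>\<in>I. \<Sum>\<eta>\<in>I. T \<xi> \<eta>)"
    unfolding T_def by (rule sum.cong[OF refl], rule sum.swap)
  finally show ?thesis using real by simp
qed

text \<open>Orthogonal projection onto the complement of x, the symbol of the Leray projection. At x
  = 0 the formula is the identity.\<close>

definition leray :: "(real^'n) \<Rightarrow> ('n \<Rightarrow> complex) \<Rightarrow> 'n::finite \<Rightarrow> complex"
  where "leray x z k = z k - complex_of_real (x $ k) * (\<Sum>j\<in>UNIV. complex_of_real (x $ j)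
      * z j) / complex_of_real ((norm x)\<^sup>2)"

lemma norm_sq_cart_complex: "complex_of_real ((norm x)\<^sup>2)
    = (\<Sum>k\<in>UNIV. complex_of_real (x $ k) * complex_of_real (x $ k))"
  for x :: "real^'n::finite"
  unfolding power2_norm_eq_inner inner_vec_def by simp

lemma leray_orthogonal:
  fixes x :: "real^'n::finite"
  assumes "x \<noteq> 0"
  shows "(\<Sum>k\<in>UNIV. complex_of_real (x $ k) * leray x z k) = 0"
proof -
  define s where "s = (\<Sum>j\<in>UNIV. complex_of_real (x $ j) * z j)"
  have "(\<Sum>k\<in>UNIV. complex_of_real (x $ k) * leray x z k)
     = s - (\<Sum>k\<in>UNIV. complex_of_real (x $ k) * complex_of_real (x $ k))
         * (s / complex_of_real ((norm x)\<^sup>2))"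
    unfolding leray_def s_def[symmetric] by (simp add: right_diff_distrib sum_subtractf sum_distrib_right
        s_def[symmetric] mult.assoc
        flip: sum_divide_distrib)
  also have "\<dots> = 0"
    unfolding norm_sq_cart_complex[symmetric] using assms by simp
  finally show ?thesis .
qed

lemma leray_self_adjoint:
  "(\<Sum>k\<in>UNIV. leray x z k * cnj (w k)) = (\<Sum>k\<in>UNIV. z k * cnj (leray x w k))"
  by (simp add: leray_def left_diff_distrib right_diff_distrib sum_subtractf sum_distrib_left
      sum_distrib_right
      mult_ac flip: sum_divide_distrib)
    (subst sum.swap, simp add: mult_ac)

lemma leray_diff: "leray x (\<lambda>k. z k - w k) k = leray x z k - leray x w k"
  by (simp add: leray_def sum_subtractf algebra_simps diff_divide_distrib)

lemma leray_of_orthogonal: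
  "(\<Sum>k\<in>UNIV. complex_of_real (x $ k) * z k) = 0 \<Longrightarrow> leray x z k = z k"
  by (simp add: leray_def)

text \<open>Pythagoras for the projection. In the Galerkin argument the first identity evaluates the
  work of the penalty, the second recovers the full norm from the two components.\<close>

lemma leray_complement_norm:
  fixes x :: "real^'n::finite"
  assumes "x \<noteq> 0"
  shows "(\<Sum>k\<in>UNIV. (z k - leray x z k) * cnj (z k))
      = (\<Sum>k\<in>UNIV. complex_of_real ((cmod (z k - leray x z k))\<^sup>2))"
    and "(\<Sum>k\<in>UNIV. (cmod (z k))\<^sup>2) = (\<Sum>k\<in>UNIV. (cmod (leray x z k))\<^sup>2)
        + (\<Sum>k\<in>UNIV. (cmod (z k - leray x z k))\<^sup>2)"
proof -
  have idem: "leray x (leray x z) k = leray x z k" for k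
    by (rule leray_of_orthogonal[OF leray_orthogonal[OF assms]])
  have 0: "(\<Sum>k\<in>UNIV. (z k - leray x z k) * cnj (leray x z k)) = 0"
    unfolding leray_self_adjoint[symmetric] by (simp add: leray_diff idem)
  have orth: "(\<Sum>k\<in>UNIV. leray x z k * cnj (z k - leray x z k)) = 0"
    using arg_cong[OF 0, of cnj] by (simp add: mult.commute)
  have "(\<Sum>k\<in>UNIV. (z k - leray x z k) * cnj (z k)) =
     (\<Sum>k\<in>UNIV. (z k - leray x z k) * cnj (z k - leray x z k))
         + (\<Sum>k\<in>UNIV. (z k - leray x z k) * cnj (leray x z k))"
    by (simp add: sum.distrib[symmetric] algebra_simps)
  then show 1: "(\<Sum>k\<in>UNIV. (z k - leray x z k) * cnj (z k))
      = (\<Sum>k\<in>UNIV. complex_of_real ((cmod (z k - leray x z k))\<^sup>2))"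
    using 0 by (simp only: complex_norm_square add_0_right)
  have "(\<Sum>k\<in>UNIV. complex_of_real ((cmod (z k))\<^sup>2)) =
     (\<Sum>k\<in>UNIV. (z k - leray x z k) * cnj (z k)) + (\<Sum>k\<in>UNIV. leray x z k * cnj (z k - leray x z k))
      + (\<Sum>k\<in>UNIV. leray x z k * cnj (leray x z k))"
    unfolding complex_norm_square by (simp add: sum.distrib[symmetric] algebra_simps)
  also have "\<dots> = (\<Sum>k\<in>UNIV. complex_of_real ((cmod (z k - leray x z k))\<^sup>2)) + 0
      + (\<Sum>k\<in>UNIV. complex_of_real ((cmod (leray x z k))\<^sup>2))"
    by (simp only: 1 orth complex_norm_square)
  finally have "complex_of_real (\<Sum>k\<in>UNIV. (cmod (z k))\<^sup>2)
      = complex_of_real ((\<Sum>k\<in>UNIV. (cmod (leray x z k))\<^sup>2) + (\<Sum>k\<in>UNIV. (cmod (z k - leray x z k))\<^sup>2))"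
    by simp
  then show "(\<Sum>k\<in>UNIV. (cmod (z k))\<^sup>2) = (\<Sum>k\<in>UNIV. (cmod (leray x z k))\<^sup>2)
      + (\<Sum>k\<in>UNIV. (cmod (z k - leray x z k))\<^sup>2)"
    by (simp only: of_real_eq_iff)
qed

section \<open>Galerkin approximation\<close>


lemma leray_cnj: "leray (- x) (\<lambda>k. cnj (z k)) k = cnj (leray x z k)"
  by (simp add: leray_def sum_negf)

lemma viscous_symbol_cnj: "viscous_symbol a (- x) (\<lambda>k. cnj (z k)) k = cnj (viscous_symbol a x z k)"
  by (simp add: viscous_symbol_def)

lemma hermitianD: "hermitian c \<Longrightarrow> c (- \<xi>) = cnj (c \<xi>)"
  by (simp add: hermitian_def)

lemma hermitian_conv:
  assumes "hermitian c" "hermitian d"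
  shows "conv c d (- \<xi>) = cnj (conv c d \<xi>)"
proof -
  have bij: "bij_betw uminus UNIV (UNIV :: (int^'a) set)"
    by (rule bij_betw_byWitness[where f' = uminus]) auto
  have "conv c d (- \<xi>) = (\<Sum>\<^sub>\<infinity>\<eta>. c (- \<xi> - (- \<eta>)) * d (- \<eta>))"
    unfolding conv_def using infsum_reindex_bij_betw[OF bij, of "\<lambda>\<eta>. c (- \<xi> - \<eta>) * d \<eta>"] by simp
  also have "\<dots> = (\<Sum>\<^sub>\<infinity>\<eta>. cnj (c (\<xi> - \<eta>) * d \<eta>))"
  proof (rule infsum_cong)
    fix \<eta>
    have e: "- \<xi> - (- \<eta>) = - (\<xi> - \<eta>)" by simp
    show "c (- \<xi> - (- \<eta>)) * d (- \<eta>) = cnj (c (\<xi> - \<eta>) * d \<eta>)"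
      by (simp only: e hermitianD[OF assms(1)] hermitianD[OF assms(2)] complex_cnj_mult)
  qed
  finally show ?thesis by (simp only: infsum_cnj conv_def)
qed

text \<open>Residual of the equation with the pressure left out. For \<xi> \<noteq> 0 a pressure
  coefficient exists exactly when this vector is parallel to \<open>frequency \<xi>\<close>.\<close>

definition momentum :: "('n::finite) tensor \<Rightarrow> ('n \<Rightarrow> int^'n \<Rightarrow> complex) \<Rightarrow> ('n \<Rightarrow> int^'n \<Rightarrow> complex) \<Rightarrow> 'n \<Rightarrow>
    int^'n \<Rightarrow> complex"
  where "momentum a f U k \<xi> = viscous_symbol a (frequency \<xi>) (\<lambda>j. U j \<xi>) k
      + convection_coeff U k \<xi> - f k \<xi>"

lemma hermitian_momentum:
  assumes "\<And>k. hermitian (f k)" "\<And>k. hermitian (U k)"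
  shows "hermitian (momentum a f U k)"
  unfolding hermitian_def
proof
  fix \<xi>
  have U: "(\<lambda>j. U j (- \<xi>)) = (\<lambda>j. cnj (U j \<xi>))" using assms(2) by (simp add: hermitian_def)
  have "convection_coeff U k (- \<xi>) = cnj (convection_coeff U k \<xi>)"
    by (simp add: convection_coeff_def hermitian_conv assms(2) sum_negf)
  then show "momentum a f U k (- \<xi>) = cnj (momentum a f U k \<xi>)"
    unfolding momentum_def frequency_minus U viscous_symbol_cnj
    using assms(1)[of k] by (simp add: hermitian_def)
qed

text \<open>The Fourier coefficients of the sum of the functions $x_\xi(\cos+\sin)(2\pi\xi\cdot y)$:
  an isometry which parametrizes the hermitian sequences by unconstrained real ones.\<close>

definition hartley :: "(int^'n \<Rightarrow> real) \<Rightarrow> int^'n \<Rightarrow> complex"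
  where "hartley x \<xi> = Complex ((x \<xi> + x (- \<xi>)) / 2) ((x (- \<xi>) - x \<xi>) / 2)"

lemma sum_symmetric_reindex:
  fixes h :: "int^'n \<Rightarrow> 'b::comm_monoid_add"
  assumes "\<And>\<xi>. \<xi> \<in> I \<Longrightarrow> - \<xi> \<in> I"
  shows "(\<Sum>\<xi>\<in>I. h (- \<xi>)) = sum h I"
  by (rule sum.reindex_bij_witness[of _ uminus uminus]) (use assms in auto)

text \<open>Computes the transpose of \<open>hartley\<close> on hermitian data, which sends g to Re
  g - Im g. The symmetry of I moves the terms with x(-\<xi>) to \<xi>.\<close>

lemma hartley_pairing:
  assumes "\<And>\<xi>. \<xi> \<in> I \<Longrightarrow> - \<xi> \<in> I" "\<And>\<xi>. g (- \<xi>) = cnj (g \<xi>)"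
  shows "Re (\<Sum>\<xi>\<in>I. g \<xi> * cnj (hartley x \<xi>)) = (\<Sum>\<xi>\<in>I. (Re (g \<xi>) - Im (g \<xi>)) * x \<xi>)"
proof -
  have "(\<Sum>\<xi>\<in>I. (Re (g \<xi>) + Im (g \<xi>)) * x (- \<xi>)) = (\<Sum>\<xi>\<in>I. (Re (g (- \<xi>)) - Im (g (- \<xi>))) * x (- \<xi>))"
    by (simp add: assms(2))
  also have "\<dots> = (\<Sum>\<xi>\<in>I. (Re (g \<xi>) - Im (g \<xi>)) * x \<xi>)"
    by (rule sum_symmetric_reindex[OF assms(1)])
  finally have eq: "(\<Sum>\<xi>\<in>I. (Re (g \<xi>) + Im (g \<xi>)) * x (- \<xi>)) = (\<Sum>\<xi>\<in>I. (Re (g \<xi>) - Im (g \<xi>)) * x \<xi>)" .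
  have "Re (\<Sum>\<xi>\<in>I. g \<xi> * cnj (hartley x \<xi>))
     = (\<Sum>\<xi>\<in>I. (Re (g \<xi>) - Im (g \<xi>)) * x \<xi> / 2 + (Re (g \<xi>) + Im (g \<xi>)) * x (- \<xi>) / 2)"
    unfolding Re_sum by (intro sum.cong refl) (simp add: hartley_def field_simps)
  also have "\<dots> = (\<Sum>\<xi>\<in>I. (Re (g \<xi>) - Im (g \<xi>)) * x \<xi>)"
    by (simp add: sum.distrib eq flip: sum_divide_distrib)
  finally show ?thesis .
qed

text \<open>The cross terms cancel at each frequency, and the reflected squares recombine over the
  symmetric set.\<close>

lemma hartley_isometry:
  assumes "\<And>\<xi>. \<xi> \<in> I \<Longrightarrow> - \<xi> \<in> I"
  shows "(\<Sum>\<xi>\<in>I. (cmod (hartley x \<xi>))\<^sup>2) = (\<Sum>\<xi>\<in>I. (x \<xi>)\<^sup>2)"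
proof -
  have "(\<Sum>\<xi>\<in>I. (cmod (hartley x \<xi>))\<^sup>2) = (\<Sum>\<xi>\<in>I. (x \<xi>)\<^sup>2 / 2 + (x (- \<xi>))\<^sup>2 / 2)"
    by (intro sum.cong refl) (simp add: hartley_def cmod_power2, simp add: power2_eq_square field_simps)
  also have "\<dots> = (\<Sum>\<xi>\<in>I. (x \<xi>)\<^sup>2)"
    by (simp add: sum.distrib sum_symmetric_reindex[OF assms, where h
        = "\<lambda>\<xi>. (x \<xi>)\<^sup>2"] flip: sum_divide_distrib)
  finally show ?thesis .
qed

lemma hermitian_hartley: "hartley x (- \<xi>) = cnj (hartley x \<xi>)"
  by (simp add: hartley_def complex_eq_iff field_simps)

lemma tendsto_leray:
  assumes "\<And>k. (\<lambda>m. z m k) \<longlonglongrightarrow> w k"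
  shows "(\<lambda>m. leray x (z m) k) \<longlonglongrightarrow> leray x w k"
  unfolding leray_def divide_inverse by (intro tendsto_intros assms)

lemma tendsto_viscous_symbol:
  assumes "\<And>k. (\<lambda>m. z m k) \<longlonglongrightarrow> w k"
  shows "(\<lambda>m. viscous_symbol a x (z m) k) \<longlonglongrightarrow> viscous_symbol a x w k"
  unfolding viscous_symbol_def by (intro tendsto_intros assms)

text \<open>Young's inequality. The weight will be the coercivity constant, possibly times
  |\<xi>|^2, so that the last term can be absorbed by viscosity.\<close>

lemma Re_mult_cnj_le: "\<bar>Re (a * cnj b)\<bar> \<le> (cmod a)\<^sup>2 / (2 * c) + c / 2 * (cmod b)\<^sup>2" if "c > 0"
proof -
  have "\<bar>Re (a * cnj b)\<bar> \<le> cmod a * cmod b"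
    using abs_Re_le_cmod[of "a * cnj b"] by (simp add: norm_mult)
  also have "\<dots> = (2 * cmod a * (c * cmod b)) / (2 * c)" using that by simp
  also have "\<dots> \<le> ((cmod a)\<^sup>2 + (c * cmod b)\<^sup>2) / (2 * c)"
    using that sum_squares_bound[of "cmod a" "c * cmod b"] by (intro divide_right_mono) auto
  also have "\<dots> = (cmod a)\<^sup>2 / (2 * c) + c / 2 * (cmod b)\<^sup>2"
    using that by (simp add: power2_eq_square field_simps)
  finally show ?thesis .
qed

text \<open>Fixes one coercivity constant for the symbol on solenoidal vectors; existence and
  regularity both draw on it.\<close>

locale coercive_system =
  fixes a :: "('n::finite) tensor" and c :: real and f :: "'n \<Rightarrow> int^'n \<Rightarrow> complex"
  assumes c: "c > 0"
    and coercive: "\<And>x z. (\<Sum>k\<in>UNIV. complex_of_real (x $ k) * z k) = 0 \<Longrightarrow>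
      c * (norm x)\<^sup>2 * (\<Sum>k\<in>UNIV. (cmod (z k))\<^sup>2) \<le> Re (\<Sum>k\<in>UNIV. viscous_symbol a x z k * cnj (z k))"
    and hf: "\<And>k. hermitian (f k)"
begin

text \<open>The residual is paired with U: viscosity is bounded below by coercivity, convection
  cancels. The residual stays on the right because in the zero argument U is not yet a
  solution.\<close>

lemma galerkin_energy:
  assumes fin: "finite I" and supp: "\<And>k \<xi>. \<xi> \<notin> I \<Longrightarrow> U k \<xi> = 0"
    and herm: "\<And>k. hermitian (U k)" and sol: "solenoidal U"
  shows "c * (\<Sum>\<xi>\<in>I. (norm (frequency \<xi>))\<^sup>2 * (\<Sum>k\<in>UNIV. (cmod (U k \<xi>))\<^sup>2))
     \<le> Re (\<Sum>\<xi>\<in>I. \<Sum>k\<in>UNIV. momentum a f U k \<xi> * cnj (U k \<xi>)) + Re (\<Sum>\<xi>\<in>I. \<Sum>k\<in>UNIV. f k \<xi> * cnj (U k \<xi>))"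
proof -
  have "c * (\<Sum>\<xi>\<in>I. (norm (frequency \<xi>))\<^sup>2 * (\<Sum>k\<in>UNIV. (cmod (U k \<xi>))\<^sup>2))
    \<le> (\<Sum>\<xi>\<in>I. Re (\<Sum>k\<in>UNIV. viscous_symbol a (frequency \<xi>) (\<lambda>j. U j \<xi>) k * cnj (U k \<xi>)))"
    unfolding sum_distrib_left[of c]
  proof (rule sum_mono)
    fix \<xi>
    show "c * ((norm (frequency \<xi>))\<^sup>2 * (\<Sum>k\<in>UNIV. (cmod (U k \<xi>))\<^sup>2))
        \<le> Re (\<Sum>k\<in>UNIV. viscous_symbol a (frequency \<xi>) (\<lambda>j. U j \<xi>) k * cnj (U k \<xi>))"
      using coercive[of "frequency \<xi>" "\<lambda>k. U k \<xi>"] sol by (simp add: solenoidal_def mult.assoc)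
  qed
  also have "\<dots> = Re (\<Sum>\<xi>\<in>I. \<Sum>k\<in>UNIV. momentum a f U k \<xi> * cnj (U k \<xi>))
      - Re (\<Sum>\<xi>\<in>I. \<Sum>k\<in>UNIV. convection_coeff U k \<xi> * cnj (U k \<xi>))
      + Re (\<Sum>\<xi>\<in>I. \<Sum>k\<in>UNIV. f k \<xi> * cnj (U k \<xi>))"
    unfolding momentum_def left_diff_distrib distrib_right sum.distrib sum_subtractf by simp
  finally show ?thesis
    using convection_energy_zero[OF fin supp herm sol] by simp
qed

text \<open>From unconstrained real unknowns x, \<open>hartley\<close> gives a hermitian v and the
  projection a solenoidal u. The map \<open>G\<close> adds the penalty v - u to the projected
  residual at u, which makes it coercive in both components of v. At a zero, pairing with \<xi>
  removes all projected terms and leaves \<xi> . v = 0, hence v = u.\<close>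

lemma galerkin_solution:
  assumes fin: "finite I" and zero: "0 \<notin> I" and symI: "\<And>\<xi>. \<xi> \<in> I \<Longrightarrow> - \<xi> \<in> I"
  obtains U where "\<And>k. hermitian (U k)" "\<And>k \<xi>. \<xi> \<notin> I \<Longrightarrow> U k \<xi> = 0" "solenoidal U"
    "\<And>k \<xi>. \<xi> \<in> I \<Longrightarrow> leray (frequency \<xi>) (\<lambda>k. momentum a f U k \<xi>) k = 0"
proof -
  define v where "v x k \<xi> = (if \<xi> \<in> I then hartley (\<lambda>\<eta>. x (k, \<eta>)) \<xi> else 0)" for x :: "'n \<times> (int^'n) \<Rightarrow>
      real" and k \<xi>
  define u where "u x k \<xi> = leray (frequency \<xi>) (\<lambda>k. v x k \<xi>) k" for x k \<xi>
  define F where "F x k \<xi> = momentum a f (u x) k \<xi>" for x k \<xi>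
  define G where "G x k \<xi> = leray (frequency \<xi>) (\<lambda>k. F x k \<xi>) k + (v x k \<xi> - u x k \<xi>)" for x k \<xi>
  \<comment> \<open>Re G - Im G is the transpose of \<open>hartley\<close> applied to
    \<open>G\<close>, so the pairing of \<open>P x\<close> with x is the work of \<open>G\<close> on
    v.\<close>
  define P where "P x = (\<lambda>(k,\<xi>). Re (G x k \<xi>) - Im (G x k \<xi>))" for x
  define X where "X = (UNIV :: 'n set) \<times> I"
  have nz: "frequency \<xi> \<noteq> 0" if "\<xi> \<in> I" for \<xi> using that zero by auto
  have symI': "- \<xi> \<in> I \<longleftrightarrow> \<xi> \<in> I" for \<xi> using symI[of \<xi>] symI[of "- \<xi>"] by auto
  have v_herm: "v x k (- \<xi>) = cnj (v x k \<xi>)" for x k \<xi>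
    by (simp add: v_def symI' hermitian_hartley)
  have u_herm: "u x k (- \<xi>) = cnj (u x k \<xi>)" for x k \<xi>
    unfolding u_def frequency_minus v_herm leray_cnj ..
  then have u_herm': "hermitian (u x k)" for x k by (simp add: hermitian_def)
  have F_herm: "F x k (- \<xi>) = cnj (F x k \<xi>)" for x k \<xi>
    using hermitian_momentum[OF hf u_herm'] by (simp add: F_def hermitian_def)
  have G_herm: "G x k (- \<xi>) = cnj (G x k \<xi>)" for x k \<xi>
    unfolding G_def frequency_minus F_herm leray_cnj u_herm v_herm by simp
  have u_supp: "u x k \<xi> = 0" if "\<xi> \<notin> I" for x k \<xi>
    using that by (simp add: u_def v_def leray_def)
  have u_sol: "solenoidal (u x)" for x
    unfolding solenoidal_def
  proof
    fix \<xi>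
    show "(\<Sum>k\<in>UNIV. of_int (\<xi> $ k) * u x k \<xi>) = 0"
    proof (cases "\<xi> \<in> I")
      case True
      then show ?thesis using leray_orthogonal[OF nz, of \<xi>] by (simp add: u_def)
    qed (simp add: u_supp)
  qed
  have cont: "\<forall>x y. (\<forall>i\<in>X. (\<lambda>m. x m i) \<longlonglongrightarrow> y i) \<longrightarrow> (\<forall>i\<in>X. (\<lambda>m. P (x m) i) \<longlonglongrightarrow> P y i)"
  proof (intro allI impI ballI)
    fix x :: "nat \<Rightarrow> 'n \<times> (int^'n) \<Rightarrow> real" and y i assume xy: "\<forall>i\<in>X. (\<lambda>m. x m i) \<longlonglongrightarrow> y i" and i: "i \<in> X"
    have vt: "(\<lambda>m. v (x m) k \<xi>) \<longlonglongrightarrow> v y k \<xi>" for k \<xi>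
    proof (cases "\<xi> \<in> I")
      case True
      have 1: "(\<lambda>m. x m (k, \<xi>)) \<longlonglongrightarrow> y (k, \<xi>)" "(\<lambda>m. x m (k, - \<xi>)) \<longlonglongrightarrow> y (k, - \<xi>)"
        using xy True symI by (auto simp: X_def)
      show ?thesis
        using True by (simp add: v_def hartley_def tendsto_complex_iff) (intro conjI tendsto_intros 1;
            simp)
    qed (simp add: v_def)
    have ut: "(\<lambda>m. u (x m) k \<xi>) \<longlonglongrightarrow> u y k \<xi>" for k \<xi>
      unfolding u_def by (intro tendsto_leray vt)
    have ct: "(\<lambda>m. conv (u (x m) j) (u (x m) k) \<xi>) \<longlonglongrightarrow> conv (u y j) (u y k) \<xi>" for j k \<xi>
    proof -
      have "conv (u x j) (u x k) \<xi> = (\<Sum>\<eta>\<in>I. u x j (\<xi> - \<eta>) * u x k \<eta>)" for x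
        by (rule conv_finite_support[OF fin]) (rule u_supp)
      then show ?thesis by (simp only:) (intro tendsto_intros ut)
    qed
    have "(\<lambda>m. F (x m) k \<xi>) \<longlonglongrightarrow> F y k \<xi>" for k \<xi>
      unfolding F_def momentum_def convection_coeff_def
      by (intro tendsto_intros ct tendsto_viscous_symbol ut)
    then have "(\<lambda>m. G (x m) k \<xi>) \<longlonglongrightarrow> G y k \<xi>" for k \<xi>
      unfolding G_def by (intro tendsto_intros tendsto_leray ut vt)
    then show "(\<lambda>m. P (x m) i) \<longlonglongrightarrow> P y i"
      unfolding P_def case_prod_unfold by (intro tendsto_intros)
  qed
  \<comment> \<open>Young's inequality bounds the work of f by \<open>B\<close> plus half of the
    viscous term. What remains is c/2 for the component u and 1 for the penalty; \<gamma> is the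
    smaller of the two.\<close>
  define B where "B = (\<Sum>\<xi>\<in>I. \<Sum>k\<in>UNIV. (cmod (f k \<xi>))\<^sup>2 / (2 * c))"
  define \<gamma> where "\<gamma> = min (c / 2) 1"
  have \<gamma>: "\<gamma> > 0" using c by (simp add: \<gamma>_def)
  have coer: "0 < (\<Sum>i\<in>X. P x i * x i)" if big: "B / \<gamma> < (\<Sum>i\<in>X. (x i)\<^sup>2)" for x
  proof -
    have vI: "(\<Sum>\<xi>\<in>I. g \<xi> * cnj (v x k \<xi>)) = (\<Sum>\<xi>\<in>I. g \<xi> * cnj (hartley (\<lambda>\<eta>. x (k, \<eta>)) \<xi>))" for g k
      by (intro sum.cong refl) (simp add: v_def)
    have pair: "Re (\<Sum>\<xi>\<in>I. G x k \<xi> * cnj (hartley (\<lambda>\<eta>. x (k, \<eta>)) \<xi>))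
        = (\<Sum>\<xi>\<in>I. (Re (G x k \<xi>) - Im (G x k \<xi>)) * x (k, \<xi>))" for k
      by (rule hartley_pairing) (use symI G_herm in auto)
    have "(\<Sum>i\<in>X. P x i * x i) = (\<Sum>k\<in>UNIV. \<Sum>\<xi>\<in>I. (Re (G x k \<xi>) - Im (G x k \<xi>)) * x (k, \<xi>))"
      unfolding X_def P_def by (simp add: sum.cartesian_product split_def)
    also have "\<dots> = Re (\<Sum>k\<in>UNIV. \<Sum>\<xi>\<in>I. G x k \<xi> * cnj (v x k \<xi>))"
      unfolding vI Re_sum[of _ UNIV] by (simp only: pair)
    also have "\<dots> = Re (\<Sum>\<xi>\<in>I. \<Sum>k\<in>UNIV. G x k \<xi> * cnj (v x k \<xi>))"
      by (subst sum.swap) simp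
    \<comment> \<open>Self-adjointness moves the projection from \<open>F\<close> onto v, where it
      produces u.\<close>
    also have "(\<Sum>\<xi>\<in>I. \<Sum>k\<in>UNIV. G x k \<xi> * cnj (v x k \<xi>))
       = (\<Sum>\<xi>\<in>I. (\<Sum>k\<in>UNIV. F x k \<xi> * cnj (u x k \<xi>)) + (\<Sum>k\<in>UNIV. complex_of_real ((cmod (v x k \<xi>
           - u x k \<xi>))\<^sup>2)))"
    proof (rule sum.cong[OF refl])
      fix \<xi> assume "\<xi> \<in> I"
      have "(\<Sum>k\<in>UNIV. G x k \<xi> * cnj (v x k \<xi>))
         = (\<Sum>k\<in>UNIV. leray (frequency \<xi>) (\<lambda>k. F x k \<xi>) k * cnj (v x k \<xi>))
             + (\<Sum>k\<in>UNIV. (v x k \<xi> - u x k \<xi>) * cnj (v x k \<xi>))"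
        by (simp add: G_def distrib_right sum.distrib)
      then show "(\<Sum>k\<in>UNIV. G x k \<xi> * cnj (v x k \<xi>))
          = (\<Sum>k\<in>UNIV. F x k \<xi> * cnj (u x k \<xi>)) + (\<Sum>k\<in>UNIV. complex_of_real ((cmod (v x k \<xi>
          - u x k \<xi>))\<^sup>2))"
        unfolding leray_self_adjoint u_def leray_complement_norm(1)[OF nz[OF \<open>\<xi> \<in> I\<close>]] .
    qed
    also have "Re \<dots> = Re (\<Sum>\<xi>\<in>I. \<Sum>k\<in>UNIV. F x k \<xi> * cnj (u x k \<xi>))
        + (\<Sum>\<xi>\<in>I. \<Sum>k\<in>UNIV. (cmod (v x k \<xi> - u x k \<xi>))\<^sup>2)"
      by (simp add: sum.distrib)
    finally have eq: "(\<Sum>i\<in>X. P x i * x i) = Re (\<Sum>\<xi>\<in>I. \<Sum>k\<in>UNIV. F x k \<xi> * cnj (u x k \<xi>))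
        + (\<Sum>\<xi>\<in>I. \<Sum>k\<in>UNIV. (cmod (v x k \<xi> - u x k \<xi>))\<^sup>2)" .
    let ?u2 = "\<Sum>\<xi>\<in>I. \<Sum>k\<in>UNIV. (cmod (u x k \<xi>))\<^sup>2" and ?w2 = "\<Sum>\<xi>\<in>I. \<Sum>k\<in>UNIV. (cmod (v x k \<xi> - u x k \<xi>))\<^sup>2"
    \<comment> \<open>A discrete Poincare inequality: all frequencies in \<open>I\<close> have
      length at least 1.\<close>
    have "c * ?u2 \<le> c * (\<Sum>\<xi>\<in>I. (norm (frequency \<xi>))\<^sup>2 * (\<Sum>k\<in>UNIV. (cmod (u x k \<xi>))\<^sup>2))"
    proof (intro mult_left_mono sum_mono)
      fix \<xi> assume "\<xi> \<in> I"
      then have "1 \<le> (norm (frequency \<xi>))\<^sup>2"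
        using norm_frequency_ge_1[of \<xi>] zero by (metis one_le_power)
      then show "(\<Sum>k\<in>UNIV. (cmod (u x k \<xi>))\<^sup>2) \<le> (norm (frequency \<xi>))\<^sup>2 * (\<Sum>k\<in>UNIV. (cmod (u x k \<xi>))\<^sup>2)"
        using mult_right_mono[of 1 "(norm (frequency \<xi>))\<^sup>2" "\<Sum>k\<in>UNIV. (cmod (u x k \<xi>))\<^sup>2"]
            by (simp add: sum_nonneg)
    qed (use c in auto)
    also have "\<dots> \<le> Re (\<Sum>\<xi>\<in>I. \<Sum>k\<in>UNIV. F x k \<xi> * cnj (u x k \<xi>))
        + Re (\<Sum>\<xi>\<in>I. \<Sum>k\<in>UNIV. f k \<xi> * cnj (u x k \<xi>))"
      unfolding F_def by (rule galerkin_energy[OF fin u_supp u_herm' u_sol])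
    also have "Re (\<Sum>\<xi>\<in>I. \<Sum>k\<in>UNIV. f k \<xi> * cnj (u x k \<xi>)) \<le> B + c / 2 * ?u2"
      unfolding B_def sum_distrib_left Re_sum sum.distrib[symmetric]
      by (intro sum_mono order_trans[OF abs_ge_self Re_mult_cnj_le[OF c]])
    finally have low: "c / 2 * ?u2 - B \<le> Re (\<Sum>\<xi>\<in>I. \<Sum>k\<in>UNIV. F x k \<xi> * cnj (u x k \<xi>))"
        by (simp add: algebra_simps)
    have "(\<Sum>i\<in>X. (x i)\<^sup>2) = (\<Sum>k\<in>UNIV. \<Sum>\<xi>\<in>I. (x (k, \<xi>))\<^sup>2)"
      unfolding X_def by (simp add: sum.cartesian_product split_def)
    also have "\<dots> = (\<Sum>k\<in>UNIV. \<Sum>\<xi>\<in>I. (cmod (v x k \<xi>))\<^sup>2)"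
      by (simp add: v_def hartley_isometry[OF symI])
    also have "\<dots> = (\<Sum>\<xi>\<in>I. \<Sum>k\<in>UNIV. (cmod (v x k \<xi>))\<^sup>2)" by (rule sum.swap)
    also have "\<dots> = (\<Sum>\<xi>\<in>I. (\<Sum>k\<in>UNIV. (cmod (u x k \<xi>))\<^sup>2) + (\<Sum>k\<in>UNIV. (cmod (v x k \<xi> - u x k \<xi>))\<^sup>2))"
      unfolding u_def by (intro sum.cong refl leray_complement_norm(2) nz)
    also have "\<dots> = ?u2 + ?w2" by (simp add: sum.distrib)
    finally have x2: "(\<Sum>i\<in>X. (x i)\<^sup>2) = ?u2 + ?w2" .
    have "B < \<gamma> * (?u2 + ?w2)" using big \<gamma> by (simp add: x2 field_simps)
    also have "\<dots> \<le> c / 2 * ?u2 + 1 * ?w2"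
      unfolding distrib_left by (intro add_mono mult_right_mono) (auto simp: \<gamma>_def sum_nonneg)
    finally show ?thesis using low eq by linarith
  qed
  have finX: "finite X" using fin by (simp add: X_def)
  obtain x where x: "\<And>i. i \<in> X \<Longrightarrow> P x i = 0"
    using coercive_zero[OF finX cont coer] by blast
  \<comment> \<open>The conditions at \<xi> and -\<xi> read Re G - Im G = 0 and Re G + Im G =
    0.\<close>
  have G0: "G x k \<xi> = 0" if "\<xi> \<in> I" for k \<xi>
  proof -
    have "P x (k, \<xi>) = 0" "P x (k, - \<xi>) = 0" using x that symI by (auto simp: X_def)
    then show ?thesis by (simp add: P_def G_herm complex_eq_iff)
  qed
  have vu: "v x k \<xi> = u x k \<xi>" if "\<xi> \<in> I" for k \<xi>
  proof -
    let ?s = "\<lambda>z. \<Sum>k\<in>UNIV. complex_of_real (frequency \<xi> $ k) * z k"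
    have "0 = ?s (\<lambda>k. G x k \<xi>)" using G0[OF that] by simp
    also have "\<dots> = ?s (leray (frequency \<xi>) (\<lambda>k. F x k \<xi>)) + (?s (\<lambda>k. v x k \<xi>) - ?s (\<lambda>k. u x k \<xi>))"
      by (simp add: G_def distrib_left right_diff_distrib sum.distrib sum_subtractf)
    also have "\<dots> = ?s (\<lambda>k. v x k \<xi>)"
      unfolding u_def using leray_orthogonal[OF nz[OF that]] by simp
    finally show ?thesis unfolding u_def by (intro leray_of_orthogonal[symmetric]) simp
  qed
  show ?thesis
  proof (rule that[of "u x"])
    fix k \<xi> assume "\<xi> \<in> I"
    then show "leray (frequency \<xi>) (\<lambda>k. momentum a f (u x) k \<xi>) k = 0"
      using G0[of \<xi> k] vu[of \<xi> k] by (simp add: G_def F_def)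
  qed (use u_herm' u_supp u_sol in auto)
qed

end

section \<open>Passage to the limit and regularity\<close>


lemma sobolev_seq_1_bounded:
  fixes c :: "int^'n::finite \<Rightarrow> complex"
  assumes "\<And>H. finite H \<Longrightarrow> (\<Sum>\<xi>\<in>H. (\<rho> \<xi>)\<^sup>2 * (cmod (c \<xi>))\<^sup>2) \<le> K"
  shows "sobolev_seq 1 c"
  unfolding sobolev_seq_def by (rule nonneg_summable_bounded(1)) (use assms in auto)

text \<open>Outside the box of size L the weight is at least L + 1, so the H^1 bound makes d small
  there, and Cauchy-Schwarz gives sqrt K * sqrt K / (L + 1). The bound depends on K and L only; this
  uniformity plays the part of Rellich compactness when coefficients are known to converge only one
  at a time.\<close>

lemma conv_tail:
  fixes c d :: "int^'n::finite \<Rightarrow> complex"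
  assumes c: "\<And>H. finite H \<Longrightarrow> (\<Sum>\<xi>\<in>H. (\<rho> \<xi>)\<^sup>2 * (cmod (c \<xi>))\<^sup>2) \<le> K"
    and d: "\<And>H. finite H \<Longrightarrow> (\<Sum>\<xi>\<in>H. (\<rho> \<xi>)\<^sup>2 * (cmod (d \<xi>))\<^sup>2) \<le> K"
  shows "cmod (conv c d \<xi> - (\<Sum>\<eta>\<in>freq_box L. c (\<xi> - \<eta>) * d \<eta>)) \<le> K / real (Suc L)"
proof -
  have K0: "0 \<le> K" using c[of "{}"] by simp
  have c0: "sobolev_seq 0 c" "sobolev_seq 0 d"
    using sobolev_seq_mono[OF sobolev_seq_1_bounded[OF c]] sobolev_seq_mono[OF sobolev_seq_1_bounded[OF
        d]] by auto
  have "(\<lambda>N. \<Sum>\<eta>\<in>freq_box N. c (\<xi> - \<eta>) * d \<eta>) \<longlonglongrightarrow> conv c d \<xi>"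
    unfolding conv_def by (rule sum_freq_box_tendsto[OF abs_summable_summable[OF abs_summable_conv[OF
        c0]]])
  then have "(\<lambda>N. cmod ((\<Sum>\<eta>\<in>freq_box N. c (\<xi> - \<eta>) * d \<eta>) - (\<Sum>\<eta>\<in>freq_box L. c (\<xi> - \<eta>) * d \<eta>)))
     \<longlonglongrightarrow> cmod (conv c d \<xi> - (\<Sum>\<eta>\<in>freq_box L. c (\<xi> - \<eta>) * d \<eta>))"
    by (intro tendsto_intros)
  then show ?thesis
  proof (rule tendsto_upperbound)
    show "\<forall>\<^sub>F N in sequentially. cmod ((\<Sum>\<eta>\<in>freq_box N. c (\<xi> - \<eta>) * d \<eta>) - (\<Sum>\<eta>\<in>freq_box L. c (\<xi>
        - \<eta>) * d \<eta>)) \<le> K / real (Suc L)"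
      using eventually_ge_at_top[of L]
    proof eventually_elim
      case (elim N)
      define H where "H = freq_box N - (freq_box L :: (int^'n) set)"
      have fH: "finite H" by (simp add: H_def)
      have wH: "real (Suc L) \<le> \<rho> \<eta>" if "\<eta> \<in> H" for \<eta>
      proof -
        obtain i where "int L < \<bar>\<eta> $ i\<bar>" using \<open>\<eta> \<in> H\<close> by (auto simp: H_def freq_box_def not_le)
        then have "real (Suc L) \<le> \<bar>real_of_int (\<eta> $ i)\<bar>" by linarith
        then show ?thesis
          using abs_nth_le_norm_frequency[of \<eta> i] norm_frequency_le_weight[of \<eta>] by linarith
      qed
      have "cmod ((\<Sum>\<eta>\<in>freq_box N. c (\<xi> - \<eta>) * d \<eta>) - (\<Sum>\<eta>\<in>freq_box L. c (\<xi> - \<eta>) * d \<eta>))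
          = cmod (\<Sum>\<eta>\<in>H. c (\<xi> - \<eta>) * d \<eta>)"
        unfolding H_def by (subst sum_diff) (use freq_box_mono[OF elim] in auto)
      also have "\<dots> \<le> (\<Sum>\<eta>\<in>H. cmod (c (\<xi> - \<eta>)) * cmod (d \<eta>))"
        by (rule order_trans[OF norm_sum]) (simp add: norm_mult)
      also have "\<dots> \<le> K / real (Suc L)"
      proof (rule power2_le_imp_le)
        have "(\<Sum>\<eta>\<in>H. (cmod (c (\<xi> - \<eta>)))\<^sup>2) \<le> (\<Sum>\<eta>\<in>H. (\<rho> (\<xi> - \<eta>))\<^sup>2 * (cmod (c (\<xi> - \<eta>)))\<^sup>2)"
        proof (rule sum_mono)
          fix \<eta>
          show "(cmod (c (\<xi> - \<eta>)))\<^sup>2 \<le> (\<rho> (\<xi> - \<eta>))\<^sup>2 * (cmod (c (\<xi> - \<eta>)))\<^sup>2"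
            using mult_right_mono[OF one_le_power[OF sobolev_weight_ge_1], of "(cmod (c (\<xi> - \<eta>)))\<^sup>2" "\<xi>
                - \<eta>" 2] by simp
        qed
        also have "\<dots> = (\<Sum>\<eta>\<in>(\<lambda>\<eta>. \<xi> - \<eta>) ` H. (\<rho> \<eta>)\<^sup>2 * (cmod (c \<eta>))\<^sup>2)"
          by (subst sum.reindex) (auto simp: inj_on_def)
        also have "\<dots> \<le> K" by (rule c) (use fH in auto)
        finally have 1: "(\<Sum>\<eta>\<in>H. (cmod (c (\<xi> - \<eta>)))\<^sup>2) \<le> K" .
        have "(real (Suc L))\<^sup>2 * (\<Sum>\<eta>\<in>H. (cmod (d \<eta>))\<^sup>2) \<le> (\<Sum>\<eta>\<in>H. (\<rho> \<eta>)\<^sup>2 * (cmod (d \<eta>))\<^sup>2)"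
          unfolding sum_distrib_left by (intro sum_mono mult_right_mono power_mono wH) auto
        also have "\<dots> \<le> K" by (rule d[OF fH])
        finally have 2: "(\<Sum>\<eta>\<in>H. (cmod (d \<eta>))\<^sup>2) \<le> K / (real (Suc L))\<^sup>2"
          by (simp add: pos_le_divide_eq mult.commute)
        have "(\<Sum>\<eta>\<in>H. cmod (c (\<xi> - \<eta>)) * cmod (d \<eta>))\<^sup>2
            \<le> (\<Sum>\<eta>\<in>H. (cmod (c (\<xi> - \<eta>)))\<^sup>2) * (\<Sum>\<eta>\<in>H. (cmod (d \<eta>))\<^sup>2)"
          by (rule Cauchy_Schwarz_ineq_sum)
        also have "\<dots> \<le> K * (K / (real (Suc L))\<^sup>2)"
          by (intro mult_mono 1 2) (auto simp: K0 sum_nonneg)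
        finally show "(\<Sum>\<eta>\<in>H. cmod (c (\<xi> - \<eta>)) * cmod (d \<eta>))\<^sup>2 \<le> (K / real (Suc L))\<^sup>2"
          by (simp add: power_divide power2_eq_square)
      qed (simp add: K0)
      finally show ?case .
    qed
  qed simp
qed

lemma sobolev_bound_limit:
  fixes c :: "nat \<Rightarrow> int^'n::finite \<Rightarrow> complex"
  assumes "\<And>\<eta>. (\<lambda>m. c m \<eta>) \<longlonglongrightarrow> c' \<eta>"
    and "\<And>m. (\<Sum>\<xi>\<in>H. (\<rho> \<xi>)\<^sup>2 * (cmod (c m \<xi>))\<^sup>2) \<le> K"
  shows "(\<Sum>\<xi>\<in>H. (\<rho> \<xi>)\<^sup>2 * (cmod (c' \<xi>))\<^sup>2) \<le> K"
proof (rule LIMSEQ_le_const2)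
  show "(\<lambda>m. \<Sum>\<xi>\<in>H. (\<rho> \<xi>)\<^sup>2 * (cmod (c m \<xi>))\<^sup>2) \<longlonglongrightarrow> (\<Sum>\<xi>\<in>H. (\<rho> \<xi>)\<^sup>2 * (cmod (c' \<xi>))\<^sup>2)"
    by (intro tendsto_intros assms)
qed (use assms in auto)

text \<open>The sum over a box converges because it is finite, and the two tails are at most K / (L
  + 1) each. The limit sequences inherit the bound K, so the tail estimate covers them too.\<close>

lemma conv_tendsto:
  fixes c d :: "nat \<Rightarrow> int^'n::finite \<Rightarrow> complex"
  assumes cl: "\<And>\<eta>. (\<lambda>m. c m \<eta>) \<longlonglongrightarrow> c' \<eta>" and dl: "\<And>\<eta>. (\<lambda>m. d m \<eta>) \<longlonglongrightarrow> d' \<eta>"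
    and c: "\<And>m H. finite H \<Longrightarrow> (\<Sum>\<xi>\<in>H. (\<rho> \<xi>)\<^sup>2 * (cmod (c m \<xi>))\<^sup>2) \<le> K"
    and d: "\<And>m H. finite H \<Longrightarrow> (\<Sum>\<xi>\<in>H. (\<rho> \<xi>)\<^sup>2 * (cmod (d m \<xi>))\<^sup>2) \<le> K"
  shows "(\<lambda>m. conv (c m) (d m) \<xi>) \<longlonglongrightarrow> conv c' d' \<xi>"
proof (rule metric_LIMSEQ_I)
  fix e :: real assume e: "e > 0"
  have K0: "0 \<le> K" using c[of "{}"] by simp
  obtain L where L: "3 * K / e < real L" using reals_Archimedean2 by blast
  then have L: "K / real (Suc L) < e / 3" using e K0 by (simp add: field_simps)
  let ?S = "\<lambda>c d. \<Sum>\<eta>\<in>freq_box L. c (\<xi> - \<eta>) * d \<eta>"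
  have "(\<lambda>m. ?S (c m) (d m)) \<longlonglongrightarrow> ?S c' d'" by (intro tendsto_intros cl dl)
  then obtain M where M: "\<And>m. m \<ge> M \<Longrightarrow> dist (?S (c m) (d m)) (?S c' d') < e / 3"
    using e unfolding lim_sequentially by (meson divide_pos_pos zero_less_numeral)
  show "\<exists>no. \<forall>n\<ge>no. dist (conv (c n) (d n) \<xi>) (conv c' d' \<xi>) < e"
  proof (intro exI allI impI)
    fix m assume m: "m \<ge> M"
    have "dist (conv (c m) (d m) \<xi>) (?S (c m) (d m)) \<le> K / real (Suc L)"
      unfolding dist_norm by (rule conv_tail[OF c d])
    moreover have "dist (conv c' d' \<xi>) (?S c' d') \<le> K / real (Suc L)"
      unfolding dist_norm by (rule conv_tail[OF sobolev_bound_limit[OF cl c] sobolev_bound_limit[OF dl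
          d]])
    moreover note M[OF m] L
    ultimately show "dist (conv (c m) (d m) \<xi>) (conv c' d' \<xi>) < e"
      using dist_triangle[of "conv (c m) (d m) \<xi>" "conv c' d' \<xi>" "?S (c m) (d m)"]
        dist_triangle[of "?S (c m) (d m)" "conv c' d' \<xi>" "?S c' d'"]
      by (simp add: dist_commute)
  qed
qed

text \<open>U(\<xi>) is fixed by the projection, which self-adjointness moves onto the
  residual.\<close>

lemma momentum_orthogonal:
  assumes "solenoidal U" "\<And>k. leray (frequency \<xi>) (\<lambda>k. momentum a f U k \<xi>) k = 0"
  shows "(\<Sum>k\<in>UNIV. momentum a f U k \<xi> * cnj (U k \<xi>)) = 0"
proof -
  have "leray (frequency \<xi>) (\<lambda>k. U k \<xi>) k = U k \<xi>" for k
    by (rule leray_of_orthogonal) (use assms(1) in \<open>simp add: solenoidal_def\<close>)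
  then have "(\<Sum>k\<in>UNIV. momentum a f U k \<xi> * cnj (U k \<xi>))
      = (\<Sum>k\<in>UNIV. momentum a f U k \<xi> * cnj (leray (frequency \<xi>) (\<lambda>k. U k \<xi>) k))"
    by simp
  also have "\<dots> = 0"
    unfolding leray_self_adjoint[symmetric] using assms(2) by simp
  finally show ?thesis .
qed

lemma absorb_half: "c * x \<le> b + c / 2 * x \<Longrightarrow> c / 2 * x \<le> b" for c x b :: real
  by (simp add: field_simps)

context coercive_system
begin

lemma stationary_coefficients:
  assumes f: "\<And>k. sobolev_seq (-1) (f k)"
  obtains U where "\<And>k. hermitian (U k)" "\<And>k. U k 0 = 0" "solenoidal U" "\<And>k. sobolev_seq 1 (U k)"
    "\<And>k \<xi>. \<xi> \<noteq> 0 \<Longrightarrow> leray (frequency \<xi>) (\<lambda>k. momentum a f U k \<xi>) k = 0"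
proof -
  let ?w = "\<lambda>\<xi>::int^'n. \<rho> \<xi>"
  \<comment> \<open>\<open>M\<close> is the squared H^(-1) norm of f. Absorbing half of the viscous
    term leaves 2M/c^2 as bound for the sum of |\<xi>|^2 |U|^2, and passing from |\<xi>|^2 to the
    squared weight doubles this to \<open>K\<close>.\<close>
  define M where "M = (\<Sum>k\<in>UNIV. \<Sum>\<^sub>\<infinity>\<xi>. ?w \<xi> powr (-2) * (cmod (f k \<xi>))\<^sup>2)"
  define K where "K = 4 * M / c\<^sup>2"
  have "\<exists>U. (\<forall>k. hermitian (U k)) \<and> (\<forall>k \<xi>. \<xi> \<notin> freq_box N - {0} \<longrightarrow> U k \<xi> = 0) \<and> solenoidal U \<and>
     (\<forall>k. \<forall>\<xi>\<in>freq_box N - {0}. leray (frequency \<xi>) (\<lambda>k. momentum a f U k \<xi>) k = 0)" for N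
    by (rule galerkin_solution[of "freq_box N - {0}"]) (auto, blast)
  then obtain U where U: "\<And>N k. hermitian (U N k)" "\<And>N k \<xi>. \<xi> \<notin> freq_box N - {0} \<Longrightarrow>
      U N k \<xi> = 0" "\<And>N. solenoidal (U N)"
     and UL: "\<And>N k \<xi>. \<xi> \<in> freq_box N - {0} \<Longrightarrow> leray (frequency \<xi>) (\<lambda>k. momentum a f (U N) k \<xi>) k = 0"
    by metis
  have bd: "(\<Sum>\<xi>\<in>H. (?w \<xi>)\<^sup>2 * (cmod (U N k \<xi>))\<^sup>2) \<le> K" if "finite H" for H N k
  proof -
    define I where "I = freq_box N - {0 :: int^'n}"
    have fI: "finite I" by (simp add: I_def)
    let ?q = "\<lambda>\<xi>::int^'n. (norm (frequency \<xi>))\<^sup>2" and ?u = "\<lambda>\<xi>. \<Sum>k\<in>UNIV. (cmod (U N k \<xi>))\<^sup>2"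
    have q: "0 < ?q \<xi>" "(?w \<xi>)\<^sup>2 \<le> 2 * ?q \<xi>" if "\<xi> \<in> I" for \<xi>
      using that weight_sq_le[of \<xi>] by (auto simp: I_def)
    have "c * (\<Sum>\<xi>\<in>I. ?q \<xi> * ?u \<xi>) \<le> Re (\<Sum>\<xi>\<in>I. \<Sum>k\<in>UNIV. momentum a f (U N) k \<xi> * cnj (U N k \<xi>))
        + Re (\<Sum>\<xi>\<in>I. \<Sum>k\<in>UNIV. f k \<xi> * cnj (U N k \<xi>))"
      by (rule galerkin_energy[OF fI]) (use U in \<open>auto simp: I_def\<close>)
    also have "(\<Sum>\<xi>\<in>I. \<Sum>k\<in>UNIV. momentum a f (U N) k \<xi> * cnj (U N k \<xi>)) = 0"
      by (intro sum.neutral ballI momentum_orthogonal U UL) (simp add: I_def)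
    also have "Re (\<Sum>\<xi>\<in>I. \<Sum>k\<in>UNIV. f k \<xi> * cnj (U N k \<xi>))
        \<le> (\<Sum>\<xi>\<in>I. \<Sum>k\<in>UNIV. ?w \<xi> powr (-2) * (cmod (f k \<xi>))\<^sup>2 / c + c / 2 * ?q \<xi> * (cmod (U N k \<xi>))\<^sup>2)"
      unfolding Re_sum
    proof (intro sum_mono)
      fix \<xi> k assume \<xi>: "\<xi> \<in> I"
      \<comment> \<open>Young's inequality with weight c |\<xi>|^2, the amount that viscosity
        provides at this frequency.\<close>
      have "Re (f k \<xi> * cnj (U N k \<xi>)) \<le> (cmod (f k \<xi>))\<^sup>2 / (2 * (c * ?q \<xi>))
          + c * ?q \<xi> / 2 * (cmod (U N k \<xi>))\<^sup>2"
        using Re_mult_cnj_le[of "c * ?q \<xi>" "f k \<xi>" "U N k \<xi>"] c q(1)[OF \<xi>] by simp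
      also have "(cmod (f k \<xi>))\<^sup>2 / (2 * (c * ?q \<xi>)) \<le> ?w \<xi> powr (-2) * (cmod (f k \<xi>))\<^sup>2 / c"
      proof -
        have "inverse (2 * ?q \<xi>) \<le> inverse ((?w \<xi>)\<^sup>2)" by (rule le_imp_inverse_le[OF q(2)[OF \<xi>]]) simp
        then have "inverse (2 * ?q \<xi>) * ((cmod (f k \<xi>))\<^sup>2 / c)
            \<le> inverse ((?w \<xi>)\<^sup>2) * ((cmod (f k \<xi>))\<^sup>2 / c)"
          using c by (intro mult_right_mono) auto
        moreover have "(cmod (f k \<xi>))\<^sup>2 / (2 * (c * ?q \<xi>)) = inverse (2 * ?q \<xi>) * ((cmod (f k \<xi>))\<^sup>2 / c)"
          by (simp add: field_simps)
        moreover have "?w \<xi> powr (-2) * (cmod (f k \<xi>))\<^sup>2 / c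
            = inverse ((?w \<xi>)\<^sup>2) * ((cmod (f k \<xi>))\<^sup>2 / c)"
          by (simp add: powr_minus)
        ultimately show ?thesis by (simp only:)
      qed
      finally show "Re (f k \<xi> * cnj (U N k \<xi>)) \<le> ?w \<xi> powr (-2) * (cmod (f k \<xi>))\<^sup>2 / c
          + c / 2 * ?q \<xi> * (cmod (U N k \<xi>))\<^sup>2"
        by simp
    qed
    also have "\<dots> = (\<Sum>k\<in>UNIV. \<Sum>\<xi>\<in>I. ?w \<xi> powr (-2) * (cmod (f k \<xi>))\<^sup>2) / c + c / 2 * (\<Sum>\<xi>\<in>I. ?q \<xi> * ?u \<xi>)"
      unfolding sum.distrib by (subst sum.swap) (simp add: sum_distrib_left sum_divide_distrib
          mult.assoc)
    also have "(\<Sum>k\<in>UNIV. \<Sum>\<xi>\<in>I. ?w \<xi> powr (-2) * (cmod (f k \<xi>))\<^sup>2) \<le> M"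
      unfolding M_def
      by (intro sum_mono finite_sum_le_infsum) (use f fI in \<open>auto simp: sobolev_seq_def\<close>)
    finally have "c * (\<Sum>\<xi>\<in>I. ?q \<xi> * ?u \<xi>) \<le> M / c + c / 2 * (\<Sum>\<xi>\<in>I. ?q \<xi> * ?u \<xi>)"
      using c by (simp add: divide_right_mono)
    from absorb_half[OF this] have "(\<Sum>\<xi>\<in>I. ?q \<xi> * ?u \<xi>) \<le> M / c / (c / 2)"
      using c by (subst pos_le_divide_eq) (auto simp: mult.commute)
    then have e1: "2 * (\<Sum>\<xi>\<in>I. ?q \<xi> * ?u \<xi>) \<le> K" by (simp add: K_def power2_eq_square)
    have "(\<Sum>\<xi>\<in>H. (?w \<xi>)\<^sup>2 * (cmod (U N k \<xi>))\<^sup>2) = (\<Sum>\<xi>\<in>H \<inter> I. (?w \<xi>)\<^sup>2 * (cmod (U N k \<xi>))\<^sup>2)"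
      by (rule sum.mono_neutral_right[OF that]) (use U(2) in \<open>auto simp: I_def\<close>)
    also have "\<dots> \<le> (\<Sum>\<xi>\<in>I. (?w \<xi>)\<^sup>2 * (cmod (U N k \<xi>))\<^sup>2)"
      by (rule sum_mono2[OF fI]) auto
    also have "\<dots> \<le> (\<Sum>\<xi>\<in>I. 2 * ?q \<xi> * ?u \<xi>)"
      by (intro sum_mono mult_mono q member_le_sum) auto
    also have "\<dots> \<le> K" using e1 by (simp add: sum_distrib_left mult.assoc)
    finally show ?thesis .
  qed
  have bd1: "cmod (U N k \<xi>) \<le> sqrt K" for N k \<xi>
  proof -
    have "(cmod (U N k \<xi>))\<^sup>2 \<le> (?w \<xi>)\<^sup>2 * (cmod (U N k \<xi>))\<^sup>2"
      using mult_right_mono[OF one_le_power[OF sobolev_weight_ge_1], of "(cmod (U N k \<xi>))\<^sup>2" \<xi> 2] by simp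
    then have "(cmod (U N k \<xi>))\<^sup>2 \<le> K" using bd[of "{\<xi>}" N k] by simp
    then show ?thesis by (rule real_le_rsqrt)
  qed
  \<comment> \<open>A diagonal subsequence: the pairs (k, \<xi>) are countable and the coefficients
    uniformly bounded.\<close>
  obtain r where r: "strict_mono r" "\<And>i. i \<in> (UNIV :: ('n \<times> (int^'n)) set) \<Longrightarrow>
      \<exists>l. (\<lambda>m. (\<lambda>(k,\<xi>). U (r m) k \<xi>) i) \<longlonglongrightarrow> l"
    by (rule function_convergent_subsequence[of "UNIV :: ('n \<times> (int^'n)) set" "\<lambda>m (k,\<xi>). U m k \<xi>" "sqrt
        K"])
      (use bd1 in auto)
  then have "\<exists>l. (\<lambda>m. U (r m) k \<xi>) \<longlonglongrightarrow> l" for k \<xi> using r(2)[of "(k,\<xi>)"] by simp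
  then obtain V where V: "\<And>k \<xi>. (\<lambda>m. U (r m) k \<xi>) \<longlonglongrightarrow> V k \<xi>" by metis
  have cv: "(\<lambda>m. conv (U (r m) j) (U (r m) k) \<xi>) \<longlonglongrightarrow> conv (V j) (V k) \<xi>" for j k \<xi>
    by (rule conv_tendsto[OF V V bd bd])
  have mv: "(\<lambda>m. momentum a f (U (r m)) k \<xi>) \<longlonglongrightarrow> momentum a f V k \<xi>" for k \<xi>
    unfolding momentum_def convection_coeff_def by (intro tendsto_intros cv V tendsto_viscous_symbol)
  show ?thesis
  proof (rule that[of V])
    show "hermitian (V k)" for k
      unfolding hermitian_def
    proof
      fix \<xi>
      have "(\<lambda>m. U (r m) k (- \<xi>)) \<longlonglongrightarrow> cnj (V k \<xi>)"
        unfolding hermitianD[OF U(1)] by (intro tendsto_intros V)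
      then show "V k (- \<xi>) = cnj (V k \<xi>)" using V LIMSEQ_unique by blast
    qed
    show "V k 0 = 0" for k
      using V[of k 0] U(2)[of 0 _ k] by (simp add: LIMSEQ_const_iff)
    show "solenoidal V"
      unfolding solenoidal_def
    proof
      fix \<xi>
      have "(\<lambda>m. \<Sum>k\<in>UNIV. of_int (\<xi> $ k) * U (r m) k \<xi>) \<longlonglongrightarrow> (\<Sum>k\<in>UNIV. of_int (\<xi> $ k) * V k \<xi>)"
        by (intro tendsto_intros V)
      then show "(\<Sum>k\<in>UNIV. of_int (\<xi> $ k) * V k \<xi>) = 0"
        using U(3) by (simp add: solenoidal_def LIMSEQ_const_iff)
    qed
    show "sobolev_seq 1 (V k)" for k
      by (rule sobolev_seq_1_bounded[OF sobolev_bound_limit[OF V bd]])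
    show "leray (frequency \<xi>) (\<lambda>k. momentum a f V k \<xi>) k = 0" if "\<xi> \<noteq> 0" for k \<xi>
    proof (rule LIMSEQ_unique)
      show "(\<lambda>m. leray (frequency \<xi>) (\<lambda>k. momentum a f (U (r m)) k \<xi>) k)
          \<longlonglongrightarrow> leray (frequency \<xi>) (\<lambda>k. momentum a f V k \<xi>) k"
        by (intro tendsto_leray mv)
      \<comment> \<open>A fixed frequency belongs to all large boxes, so its projected equation
        holds exactly from some index on.\<close>
      obtain N where N: "{\<xi>} \<subseteq> freq_box N" using finite_subset_freq_box[of "{\<xi>}"] by blast
      have "\<forall>\<^sub>F m in sequentially. leray (frequency \<xi>) (\<lambda>k. momentum a f (U (r m)) k \<xi>) k = 0"
        using eventually_ge_at_top[of N]
      proof eventually_elim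
        case (elim m)
        then have "N \<le> r m" using seq_suble[OF r(1), of m] by linarith
        then have "\<xi> \<in> freq_box (r m) - {0}" using N freq_box_mono that by blast
        then show ?case by (rule UL)
      qed
      then show "(\<lambda>m. leray (frequency \<xi>) (\<lambda>k. momentum a f (U (r m)) k \<xi>) k) \<longlonglongrightarrow> 0"
        by (rule tendsto_eventually)
    qed
  qed
qed

end

section \<open>Multiplier estimates and the bootstrap\<close>

lemma summable_on_finite_sum:
  fixes f :: "'j \<Rightarrow> 'a \<Rightarrow> 'b::{topological_comm_monoid_add}"
  assumes "finite J" "\<And>j. j \<in> J \<Longrightarrow> f j summable_on A"
  shows "(\<lambda>x. \<Sum>j\<in>J. f j x) summable_on A"
  using assms by (induction J rule: finite_induct) (auto intro: summable_on_add)

text \<open>Multiplier estimate of order m. Derivatives (m = 1), the viscous symbol (m = 2), the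
  pressure (m = -1) and the inverted viscous symbol (m = -2) are all instances. Cauchy-Schwarz over
  \<open>J\<close> costs the factor \<open>card J\<close>.\<close>

lemma sobolev_seq_weight:
  fixes d :: "int^'n::finite \<Rightarrow> complex"
  assumes J: "finite J" and c: "\<And>j. j \<in> J \<Longrightarrow> sobolev_seq s (c j)"
    and d: "\<And>\<xi>. cmod (d \<xi>) \<le> C * \<rho> \<xi> powr m * (\<Sum>j\<in>J. cmod (c j \<xi>))" and t: "t \<le> s - m"
  shows "sobolev_seq t d"
proof -
  let ?w = "\<rho>"
  have "sobolev_seq (s - m) d"
  proof (rule sobolev_seq_dominated)
    show "(\<lambda>\<xi>. C\<^sup>2 * real (card J) * (\<Sum>j\<in>J. ?w \<xi> powr (2 * s) * (cmod (c j \<xi>))\<^sup>2)) summable_on UNIV"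
      using c by (intro summable_on_cmult_right summable_on_finite_sum J) (auto simp: sobolev_seq_def)
    fix \<xi>
    have "?w \<xi> powr (2 * (s - m)) * (cmod (d \<xi>))\<^sup>2 \<le> ?w \<xi> powr (2 * (s
        - m)) * (C * ?w \<xi> powr m * (\<Sum>j\<in>J. cmod (c j \<xi>)))\<^sup>2"
      by (intro mult_left_mono power_mono d) auto
    also have "\<dots> = C\<^sup>2 * ((?w \<xi> powr (2 * (s - m)) * ?w \<xi> powr (2 * m)) * (\<Sum>j\<in>J. 1 * cmod (c j \<xi>))\<^sup>2)"
      by (simp add: power_mult_distrib powr_power mult_ac)
    also have "\<dots> \<le> C\<^sup>2 * (?w \<xi> powr (2 * s) * ((\<Sum>j\<in>J. 1\<^sup>2) * (\<Sum>j\<in>J. (cmod (c j \<xi>))\<^sup>2)))"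
      unfolding powr_add[symmetric]
      by (intro mult_mono Cauchy_Schwarz_ineq_sum) (auto simp: algebra_simps)
    finally show "?w \<xi> powr (2 * (s - m)) * (cmod (d \<xi>))\<^sup>2
        \<le> C\<^sup>2 * real (card J) * (\<Sum>j\<in>J. ?w \<xi> powr (2 * s) * (cmod (c j \<xi>))\<^sup>2)"
      unfolding sum_distrib_left[symmetric] by (simp add: mult_ac)
  qed
  then show ?thesis using t by (rule sobolev_seq_mono)
qed

lemma sobolev_seq_add:
  assumes "sobolev_seq s c" "sobolev_seq s d"
  shows "sobolev_seq s (\<lambda>\<xi>. c \<xi> + d \<xi>)"
  by (rule sobolev_seq_weight[of "UNIV :: bool set" s "\<lambda>b. if b then c else d" _ 1 0])
    (use assms in \<open>auto simp: UNIV_bool add.commute norm_triangle_ineq\<close>)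

lemma sobolev_seq_minus: "sobolev_seq s c \<Longrightarrow> sobolev_seq s (\<lambda>\<xi>. - c \<xi>)"
  by (simp add: sobolev_seq_def)

lemma cmod_viscous_symbol_le:
  "cmod (viscous_symbol a x z k) \<le> (4 * pi\<^sup>2 * (\<Sum>\<alpha>\<in>UNIV. \<Sum>j\<in>UNIV. \<Sum>\<beta>\<in>UNIV. \<bar>a k j \<alpha> \<beta>\<bar>)) * (norm x)\<^sup>2
      * (\<Sum>j\<in>UNIV. cmod (z j))"
proof -
  let ?S = "\<Sum>j\<in>UNIV. cmod (z j)"
  have "cmod (viscous_symbol a x z k) \<le> 4 * pi\<^sup>2 * (\<Sum>\<alpha>\<in>UNIV. \<Sum>j\<in>UNIV. \<Sum>\<beta>\<in>UNIV. \<bar>a k j \<alpha> \<beta>\<bar> * ((norm x)\<^sup>2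
      * ?S))"
    unfolding viscous_symbol_def norm_mult
  proof (intro mult_mono sum_norm_le)
    fix \<alpha> j \<beta>
    have "\<bar>a k j \<alpha> \<beta> * x $ \<alpha> * x $ \<beta>\<bar> \<le> \<bar>a k j \<alpha> \<beta>\<bar> * (norm x)\<^sup>2"
      unfolding abs_mult power2_eq_square mult.assoc
      by (intro mult_mono component_le_norm_cart mult_nonneg_nonneg) auto
    moreover have "cmod (z j) \<le> ?S" by (rule member_le_sum) auto
    ultimately have "\<bar>a k j \<alpha> \<beta> * x $ \<alpha> * x $ \<beta>\<bar> * cmod (z j) \<le> (\<bar>a k j \<alpha> \<beta>\<bar> * (norm x)\<^sup>2) * ?S"
      by (intro mult_mono) auto
    then show "cmod (complex_of_real (a k j \<alpha> \<beta> * x $ \<alpha> * x $ \<beta>) * z j)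
        \<le> \<bar>a k j \<alpha> \<beta>\<bar> * ((norm x)\<^sup>2 * ?S)"
      by (simp add: norm_mult abs_mult mult_ac)
  qed (auto simp: norm_power)
  then show ?thesis unfolding sum_distrib_right[symmetric] by (simp add: mult_ac)
qed

text \<open>The loss 7/4 is 3/4 for the product plus 1 for the derivative in front of it.\<close>

lemma sobolev_seq_convection:
  fixes U :: "'n::finite \<Rightarrow> int^'n \<Rightarrow> complex"
  assumes "CARD('n) \<le> 3" "1 \<le> r" "\<And>k. sobolev_seq r (U k)" "t \<le> r - 7/4"
  shows "sobolev_seq t (convection_coeff U k)"
proof (rule sobolev_seq_weight[of UNIV "r - 3/4" "\<lambda>j. conv (U j) (U k)" _ "2 * pi" 1])
  show "sobolev_seq (r - 3/4) (conv (U j) (U k))" for j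
    by (rule sobolev_seq_conv) (use assms in auto)
  fix \<xi> :: "int^'n"
  have "cmod (\<Sum>j\<in>UNIV. of_int (\<xi> $ j) * conv (U j) (U k) \<xi>) \<le> (\<Sum>j\<in>UNIV. \<rho> \<xi> * cmod (conv (U j) (U k) \<xi>))"
    by (rule sum_norm_le, unfold norm_mult, rule mult_right_mono)
      (use order_trans[OF abs_nth_le_norm_frequency norm_frequency_le_weight] in auto)
  then show "cmod (convection_coeff U k \<xi>) \<le> 2 * pi * \<rho> \<xi> powr 1 * (\<Sum>j\<in>UNIV. cmod (conv (U j) (U k) \<xi>))"
    by (simp add: convection_coeff_def norm_mult sum_distrib_left[symmetric])
qed (use assms in auto)

context coercive_system
begin

text \<open>Testing with U(\<xi>) removes the part of the residual parallel to \<xi> and leaves c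
  |\<xi>|^2 |U| bounded by the size of g = f - convection: an estimate of order -2, with constant
  2/c after passing to the weight. As the new index is at most r + 1/4, it asks g for no more than
  the r - 7/4 that convection provides.\<close>

lemma regularity_step:
  assumes dim: "CARD('n) \<le> 3" and U: "\<And>k. U k 0 = 0" "solenoidal U" "\<And>k. sobolev_seq r (U k)"
      and r: "1 \<le> r"
    and L: "\<And>k \<xi>. \<xi> \<noteq> 0 \<Longrightarrow> leray (frequency \<xi>) (\<lambda>k. momentum a f U k \<xi>) k = 0"
    and f: "\<And>k. sobolev_seq (s - 2) (f k)"
  shows "sobolev_seq (min s (r + 1/4)) (U k)"
proof -
  define g where "g k \<xi> = f k \<xi> + - convection_coeff U k \<xi>" for k \<xi>
  let ?t = "min s (r + 1/4)"
  have g: "sobolev_seq (?t - 2) (g k)" for k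
    unfolding g_def
    by (intro sobolev_seq_add sobolev_seq_minus sobolev_seq_convection[OF dim r U(3)] sobolev_seq_mono[OF
        f]) auto
  show ?thesis
  proof (rule sobolev_seq_weight[of UNIV "?t - 2" g "U k" "2 / c" "-2"])
    fix \<xi> :: "int^'n"
    show "cmod (U k \<xi>) \<le> 2 / c * \<rho> \<xi> powr (-2) * (\<Sum>j\<in>UNIV. cmod (g j \<xi>))"
    proof (cases "\<xi> = 0")
      case True
      then show ?thesis using c U(1) by (simp add: sum_nonneg)
    next
      case False
      let ?q = "(norm (frequency \<xi>))\<^sup>2" and ?u = "\<Sum>k\<in>UNIV. (cmod (U k \<xi>))\<^sup>2"
      have q: "0 < ?q" using False by simp
      have "c * ?q * ?u \<le> Re (\<Sum>k\<in>UNIV. viscous_symbol a (frequency \<xi>) (\<lambda>j. U j \<xi>) k * cnj (U k \<xi>))"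
        using coercive[of "frequency \<xi>" "\<lambda>k. U k \<xi>"] U(2) by (simp add: solenoidal_def)
      also have "\<dots> = Re ((\<Sum>k\<in>UNIV. momentum a f U k \<xi> * cnj (U k \<xi>)) + (\<Sum>k\<in>UNIV. g k \<xi> * cnj (U k \<xi>)))"
        unfolding sum.distrib[symmetric] by (simp add: momentum_def g_def algebra_simps)
      also have "\<dots> = (\<Sum>k\<in>UNIV. Re (g k \<xi> * cnj (U k \<xi>)))"
        by (simp add: momentum_orthogonal[OF U(2) L[OF False]])
      also have "\<dots> \<le> (\<Sum>k\<in>UNIV. (cmod (g k \<xi>))\<^sup>2 / (2 * (c * ?q)) + c * ?q / 2 * (cmod (U k \<xi>))\<^sup>2)"
        using c q by (intro sum_mono order_trans[OF abs_ge_self Re_mult_cnj_le]) auto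
      also have "\<dots> = (\<Sum>k\<in>UNIV. (cmod (g k \<xi>))\<^sup>2) / (2 * (c * ?q)) + c * ?q / 2 * ?u"
        by (simp add: sum.distrib sum_divide_distrib sum_distrib_left)
      finally have "c * ?q * ?u \<le> (\<Sum>k\<in>UNIV. (cmod (g k \<xi>))\<^sup>2) / (2 * (c * ?q)) + c * ?q / 2 * ?u" .
      from absorb_half[OF this] have "(c * ?q / 2 * ?u) * (2 * (c * ?q)) \<le> (\<Sum>k\<in>UNIV. (cmod (g k \<xi>))\<^sup>2)"
        using c q by (subst (asm) pos_le_divide_eq) auto
      then have e1: "(c * ?q)\<^sup>2 * ?u \<le> (\<Sum>k\<in>UNIV. (cmod (g k \<xi>))\<^sup>2)"
        by (simp add: power2_eq_square mult_ac)
      have "c * ?q * cmod (U k \<xi>) \<le> (\<Sum>j\<in>UNIV. cmod (g j \<xi>))"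
      proof (rule power2_le_imp_le)
        have "(c * ?q * cmod (U k \<xi>))\<^sup>2 \<le> (c * ?q)\<^sup>2 * ?u"
          unfolding power_mult_distrib[of _ "cmod _"] by (intro mult_left_mono member_le_sum) auto
        also note e1
        also have "(\<Sum>j\<in>UNIV. (cmod (g j \<xi>))\<^sup>2) \<le> (\<Sum>j\<in>UNIV. cmod (g j \<xi>) * (\<Sum>j\<in>UNIV. cmod (g j \<xi>)))"
          unfolding power2_eq_square by (intro sum_mono mult_left_mono member_le_sum) auto
        finally show "(c * ?q * cmod (U k \<xi>))\<^sup>2 \<le> (\<Sum>j\<in>UNIV. cmod (g j \<xi>))\<^sup>2"
          by (simp add: power2_eq_square sum_distrib_right)
      qed (simp add: sum_nonneg)
      moreover have "c * (\<rho> \<xi>)\<^sup>2 * cmod (U k \<xi>) \<le> c * (2 * ?q) * cmod (U k \<xi>)"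
        using c weight_sq_le[OF False] by (intro mult_right_mono mult_left_mono) auto
      ultimately have "c * (\<rho> \<xi>)\<^sup>2 * cmod (U k \<xi>) \<le> 2 * (\<Sum>j\<in>UNIV. cmod (g j \<xi>))" by simp
      then show ?thesis using c by (simp add: powr_minus field_simps)
    qed
  qed (use g in auto)
qed

lemma regularity:
  assumes dim: "CARD('n) \<le> 3" and U: "\<And>k. U k 0 = 0" "solenoidal U" "\<And>k. sobolev_seq 1 (U k)"
      and s: "1 \<le> s"
    and L: "\<And>k \<xi>. \<xi> \<noteq> 0 \<Longrightarrow> leray (frequency \<xi>) (\<lambda>k. momentum a f U k \<xi>) k = 0"
    and f: "\<And>k. sobolev_seq (s - 2) (f k)"
  shows "sobolev_seq s (U k)"
proof -
  have "\<forall>k. sobolev_seq (min s (1 + real m / 4)) (U k)" for m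
  proof (induction m)
    case 0
    then show ?case using U(3) s by (simp add: min_def sobolev_seq_mono)
  next
    case (Suc m)
    have step: "sobolev_seq (min s (min s (1 + real m / 4) + 1/4)) (U k)" for k
      by (rule regularity_step[OF dim U(1,2) _ _ L f]) (use Suc s in auto)
    show ?case
      by (intro allI sobolev_seq_mono[OF step]) (auto simp: min_def field_simps)
  qed
  \<comment> \<open>Each round adds 1/4 until s is reached, so \<lceil>4s\<rceil> rounds are
    enough.\<close>
  then have "sobolev_seq (min s (1 + real (nat \<lceil>4 * s\<rceil>) / 4)) (U k)" by blast
  moreover have "s \<le> 1 + real (nat \<lceil>4 * s\<rceil>) / 4" using s by linarith
  ultimately show ?thesis by (simp add: min_def)
qed

end

section \<open>The pressure\<close>

definition pressure_coeff :: "('n::finite) tensor \<Rightarrow> ('n \<Rightarrow> int^'n \<Rightarrow> complex) \<Rightarrow> ('n \<Rightarrow> int^'n \<Rightarrow> complex) \<Rightarrow>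
    int^'n \<Rightarrow> complex"
  where "pressure_coeff a f U \<xi> = \<i> * (\<Sum>j\<in>UNIV. of_int (\<xi> $ j) * momentum a f U j \<xi>) / complex_of_real (2
      * pi * (norm (frequency \<xi>))\<^sup>2)"

lemma pressure_coeff_0 [simp]: "pressure_coeff a f U 0 = 0"
  by (simp add: pressure_coeff_def)

text \<open>A vanishing projection says that the residual equals \<xi> (\<xi> . momentum) /
  |\<xi>|^2; its factor along \<xi> must be -2 pi i times the pressure, which explains the i and the
  |\<xi>|^2 in \<open>pressure_coeff\<close>. At \<xi> = 0 the division by zero there yields mean
  value 0.\<close>

lemma pressure_coeff_eq:
  assumes "\<And>k. leray (frequency \<xi>) (\<lambda>k. momentum a f U k \<xi>) k = 0" "\<xi> \<noteq> 0"
  shows "momentum a f U k \<xi> + 2 * pi * \<i> * of_int (\<xi> $ k) * pressure_coeff a f U \<xi> = 0"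
  using assms(1)[of k] assms(2) by (simp add: leray_def pressure_coeff_def field_simps)

lemma hermitian_pressure_coeff:
  assumes "\<And>k. hermitian (f k)" "\<And>k. hermitian (U k)"
  shows "hermitian (pressure_coeff a f U)"
  unfolding hermitian_def pressure_coeff_def
  by (simp add: hermitianD[OF hermitian_momentum[OF assms]] sum_negf)

text \<open>Every term of the residual lies in H^(s-2), convection with a quarter to spare, and the
  pressure gains one order on it. For \<xi> \<noteq> 0 the weight is at most 2 |\<xi>|, hence at
  most 2 pi |\<xi>|, so the constant can be 1.\<close>

lemma sobolev_seq_pressure:
  fixes U :: "'n::finite \<Rightarrow> int^'n \<Rightarrow> complex"
  assumes dim: "CARD('n) \<le> 3" and s: "1 \<le> s" and U: "\<And>k. sobolev_seq s (U k)"
      and f: "\<And>k. sobolev_seq (s - 2) (f k)"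
  shows "sobolev_seq (s - 1) (pressure_coeff a f U)"
proof -
  have v: "sobolev_seq (s - 2) (\<lambda>\<xi>. viscous_symbol a (frequency \<xi>) (\<lambda>j. U j \<xi>) k)" for k
  proof (rule sobolev_seq_weight[OF _ U, of UNIV _ _ 2])
    fix \<xi> :: "int^'n"
    let ?C = "4 * pi\<^sup>2 * (\<Sum>\<alpha>\<in>UNIV. \<Sum>j\<in>UNIV. \<Sum>\<beta>\<in>UNIV. \<bar>a k j \<alpha> \<beta>\<bar>)"
    have "cmod (viscous_symbol a (frequency \<xi>) (\<lambda>j. U j \<xi>) k)
        \<le> ?C * (norm (frequency \<xi>))\<^sup>2 * (\<Sum>j\<in>UNIV. cmod (U j \<xi>))"
      by (rule cmod_viscous_symbol_le)
    also have "\<dots> \<le> ?C * (\<rho> \<xi>)\<^sup>2 * (\<Sum>j\<in>UNIV. cmod (U j \<xi>))"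
      by (intro mult_right_mono mult_left_mono power_mono norm_frequency_le_weight mult_nonneg_nonneg
          sum_nonneg) auto
    finally show "cmod (viscous_symbol a (frequency \<xi>) (\<lambda>j. U j \<xi>) k)
        \<le> ?C * \<rho> \<xi> powr 2 * (\<Sum>j\<in>UNIV. cmod (U j \<xi>))"
      by simp
  qed auto
  have m: "sobolev_seq (s - 2) (momentum a f U k)" for k
    unfolding momentum_def diff_conv_add_uminus[of "_ + _" "f _ _"]
    by (intro sobolev_seq_add sobolev_seq_minus v f sobolev_seq_convection[OF dim s U]) auto
  show ?thesis
  proof (rule sobolev_seq_weight[OF _ m, of UNIV _ 1 "-1"])
    fix \<xi> :: "int^'n"
    let ?S = "\<Sum>j\<in>UNIV. cmod (momentum a f U j \<xi>)"
    show "cmod (pressure_coeff a f U \<xi>) \<le> 1 * \<rho> \<xi> powr (-1) * ?S"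
    proof (cases "\<xi> = 0")
      case False
      let ?n = "norm (frequency \<xi>)"
      have n: "1 \<le> ?n" using norm_frequency_ge_1[OF False] .
      have "cmod (\<Sum>j\<in>UNIV. of_int (\<xi> $ j) * momentum a f U j \<xi>)
          \<le> (\<Sum>j\<in>UNIV. ?n * cmod (momentum a f U j \<xi>))"
        by (rule sum_norm_le, unfold norm_mult, rule mult_right_mono)
          (use abs_nth_le_norm_frequency in auto)
      then have "cmod (pressure_coeff a f U \<xi>) \<le> (?n * ?S) / (2 * pi * ?n\<^sup>2)"
        by (simp add: pressure_coeff_def norm_divide norm_mult sum_distrib_left[symmetric] norm_power
            divide_right_mono)
      also have "\<dots> = (1 / (2 * pi * ?n)) * ?S" using n by (simp add: power2_eq_square)
      also have "\<dots> \<le> (1 / \<rho> \<xi>) * ?S"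
      proof (intro mult_right_mono divide_left_mono)
        have "\<rho> \<xi> \<le> 2 * ?n"
        proof (rule power2_le_imp_le)
          show "(\<rho> \<xi>)\<^sup>2 \<le> (2 * ?n)\<^sup>2"
          proof -
            have "(2 * ?n)\<^sup>2 = 4 * ?n\<^sup>2" by (simp add: power_mult_distrib)
            then show ?thesis using weight_sq_le[OF False] zero_le_power2[of ?n] by linarith
          qed
        qed simp
        also have "\<dots> \<le> 2 * pi * ?n" using n pi_gt3 mult_right_mono[of 1 pi ?n] by simp
        finally show "\<rho> \<xi> \<le> 2 * pi * ?n" .
      qed (use n in \<open>auto intro!: sum_nonneg mult_pos_pos\<close>)
      finally show ?thesis by (simp add: powr_minus_divide)
    qed (simp add: sum_nonneg)
  qed auto
qed

section \<open>Fourier synthesis of smooth functions\<close>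


definition wave :: "int^'n::finite \<Rightarrow> real^'n \<Rightarrow> complex"
  where "wave \<xi> x = cis (2 * pi * (x \<bullet> frequency \<xi>))"

text \<open>The real part keeps this a real function for every c. For hermitian rapid c nothing is
  lost (\<open>hermitian_synth_complex\<close>), and sequences with one non-zero entry yield sines
  and cosines.\<close>

definition synth :: "(int^'n::finite \<Rightarrow> complex) \<Rightarrow> real^'n \<Rightarrow> real"
  where "synth c x = Re (\<Sum>\<^sub>\<infinity>\<xi>. c \<xi> * wave \<xi> x)"

text \<open>Rapid decay in l^1 form: the series of every derivative of \<open>synth c\<close>
  converges absolutely and uniformly.\<close>

definition rapid :: "(int^'n::finite \<Rightarrow> complex) \<Rightarrow> bool"
  where "rapid c \<longleftrightarrow> (\<forall>m::nat. (\<lambda>\<xi>. \<rho> \<xi> ^ m * cmod (c \<xi>)) summable_on UNIV)"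

definition deriv_coeff :: "'n::finite \<Rightarrow> (int^'n \<Rightarrow> complex) \<Rightarrow> int^'n \<Rightarrow> complex"
  where "deriv_coeff j c \<xi> = 2 * pi * \<i> * of_int (\<xi> $ j) * c \<xi>"

lemma norm_wave [simp]: "cmod (wave \<xi> x) = 1"
  by (simp add: wave_def)

lemma wave_uminus: "wave (- \<xi>) x = cnj (wave \<xi> x)"
  by (simp add: wave_def cis_cnj)

lemma wave_add: "wave (\<xi> + \<eta>) x = wave \<xi> x * wave \<eta> x"
  by (simp add: wave_def frequency_add inner_add_right cis_mult distrib_left)

lemma wave_0 [simp]: "wave 0 x = 1"
  by (simp add: wave_def)

lemma wave_periodic: "wave \<xi> (x + axis i 1) = wave \<xi> x"
proof -
  have "wave \<xi> (x + axis i 1) = wave \<xi> x * cis (2 * pi * real_of_int (\<xi> $ i))"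
    by (simp only: wave_def inner_add_left inner_axis' cis_mult distrib_left inner_real_def mult_1_left
        frequency_nth)
  also have "cis (2 * pi * real_of_int (\<xi> $ i)) = 1"
    by (rule cis_multiple_2pi) simp
  finally show ?thesis by simp
qed

lemma continuous_on_wave: "continuous_on A (wave \<xi>)"
  unfolding wave_def by (intro continuous_intros)

text \<open>Comparison of tails as in the Weierstrass test. The right side depends on b only, so
  convergence is uniform in x when the terms a carry a wave at x.\<close>

lemma infsum_truncation_le:
  fixes a :: "int^'n::finite \<Rightarrow> 'b::banach"
  assumes b: "b summable_on UNIV" and ab: "\<And>\<xi>. norm (a \<xi>) \<le> b \<xi>"
  shows "norm (infsum a UNIV - sum a (freq_box N)) \<le> infsum b UNIV - sum b (freq_box N)"
proof (rule LIMSEQ_le)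
  have "(\<lambda>\<xi>. norm (a \<xi>)) summable_on UNIV"
    by (rule summable_on_comparison_test[OF b]) (use ab in auto)
  then have a: "a summable_on UNIV" by (rule abs_summable_summable)
  show "(\<lambda>M. norm (sum a (freq_box M) - sum a (freq_box N))) \<longlonglongrightarrow> norm (infsum a UNIV - sum a (freq_box N))"
    by (intro tendsto_intros sum_freq_box_tendsto a)
  show "(\<lambda>M. sum b (freq_box M) - sum b (freq_box N)) \<longlonglongrightarrow> infsum b UNIV - sum b (freq_box N)"
    by (intro tendsto_intros sum_freq_box_tendsto b)
  show "\<exists>K. \<forall>M\<ge>K. norm (sum a (freq_box M) - sum a (freq_box N))
      \<le> sum b (freq_box M) - sum b (freq_box N)"
  proof (intro exI allI impI)
    fix M assume "M \<ge> N"
    then have sub: "freq_box N \<subseteq> (freq_box M :: (int^'n) set)" by (rule freq_box_mono)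
    have "norm (sum a (freq_box M) - sum a (freq_box N)) = norm (sum a (freq_box M - freq_box N))"
      by (subst sum_diff) (use sub in auto)
    also have "\<dots> \<le> sum b (freq_box M - freq_box N)" by (rule sum_norm_le) (use ab in auto)
    also have "\<dots> = sum b (freq_box M) - sum b (freq_box N)" by (subst sum_diff) (use sub in auto)
    finally show "norm (sum a (freq_box M) - sum a (freq_box N))
        \<le> sum b (freq_box M) - sum b (freq_box N)" .
  qed
qed

lemma truncation_tendsto_0:
  fixes b :: "int^'n::finite \<Rightarrow> real"
  assumes "b summable_on UNIV"
  shows "(\<lambda>N. infsum b UNIV - sum b (freq_box N)) \<longlonglongrightarrow> 0"
  using tendsto_diff[OF tendsto_const sum_freq_box_tendsto[OF assms], of "infsum b UNIV"] by simp

lemma rapid_abs_summable: "rapid c \<Longrightarrow> (\<lambda>\<xi>. cmod (c \<xi>)) summable_on UNIV"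
  unfolding rapid_def by (drule spec[of _ 0]) simp

lemma rapid_wave_summable:
  assumes "rapid c" shows "(\<lambda>\<xi>. c \<xi> * wave \<xi> x) summable_on UNIV"
  by (rule abs_summable_summable) (use rapid_abs_summable[OF assms] in \<open>simp add: norm_mult\<close>)

lemma rapid_mult:
  assumes "rapid c" and "\<And>\<xi>. cmod (d \<xi>) \<le> K * \<rho> \<xi> * cmod (c \<xi>)"
  shows "rapid d"
  unfolding rapid_def
proof
  fix m
  have "(\<lambda>\<xi>. K * (\<rho> \<xi> ^ Suc m * cmod (c \<xi>))) summable_on UNIV"
    using assms(1) unfolding rapid_def by (intro summable_on_cmult_right) blast
  then show "(\<lambda>\<xi>. \<rho> \<xi> ^ m * cmod (d \<xi>)) summable_on UNIV"
  proof (rule summable_on_comparison_test)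
    fix \<xi>
    show "\<rho> \<xi> ^ m * cmod (d \<xi>) \<le> K * (\<rho> \<xi> ^ Suc m * cmod (c \<xi>))"
      using mult_left_mono[OF assms(2), of "\<rho> \<xi> ^ m" \<xi>] by (simp add: mult_ac)
  qed auto
qed

lemma rapid_deriv_coeff: "rapid c \<Longrightarrow> rapid (deriv_coeff j c)"
proof (rule rapid_mult)
  fix \<xi>
  show "cmod (deriv_coeff j c \<xi>) \<le> 2 * pi * \<rho> \<xi> * cmod (c \<xi>)"
    using mult_right_mono[OF order_trans[OF abs_nth_le_norm_frequency norm_frequency_le_weight], of "cmod
        (c \<xi>)" \<xi> j]
    by (simp add: deriv_coeff_def norm_mult)
qed

lemma rapid_finite_support:
  assumes "finite A" "\<And>\<xi>. \<xi> \<notin> A \<Longrightarrow> c \<xi> = 0"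
  shows "rapid c"
  unfolding rapid_def
  by (intro allI finite_nonzero_values_imp_summable_on finite_subset[OF _ assms(1)]) (use assms(2) in
      auto)

lemma rapid_restrict: "rapid c \<Longrightarrow> rapid (\<lambda>\<xi>. if \<xi> \<in> A then c \<xi> else 0)"
proof (rule rapid_mult)
  fix \<xi> show "cmod (if \<xi> \<in> A then c \<xi> else 0) \<le> 1 * \<rho> \<xi> * cmod (c \<xi>)"
    using mult_right_mono[OF sobolev_weight_ge_1, of "cmod (c \<xi>)" \<xi>] by auto
qed

lemma synth_finite_support:
  assumes "finite A" "\<And>\<xi>. \<xi> \<notin> A \<Longrightarrow> c \<xi> = 0"
  shows "synth c x = Re (\<Sum>\<xi>\<in>A. c \<xi> * wave \<xi> x)"
  unfolding synth_def
  by (subst infsum_cong_neutral[where T = A and g = "\<lambda>\<xi>. c \<xi> * wave \<xi> x"]) (use assms in auto)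

lemma synth_truncation_le:
  assumes "rapid c"
  shows "\<bar>synth c x - Re (\<Sum>\<xi>\<in>freq_box N. c \<xi> * wave \<xi> x)\<bar>
    \<le> (\<Sum>\<^sub>\<infinity>\<xi>. cmod (c \<xi>)) - (\<Sum>\<xi>\<in>freq_box N. cmod (c \<xi>))"
proof -
  have "\<bar>synth c x - Re (\<Sum>\<xi>\<in>freq_box N. c \<xi> * wave \<xi> x)\<bar>
      \<le> cmod ((\<Sum>\<^sub>\<infinity>\<xi>. c \<xi> * wave \<xi> x) - (\<Sum>\<xi>\<in>freq_box N. c \<xi> * wave \<xi> x))"
    unfolding synth_def minus_complex.sel[symmetric] by (rule abs_Re_le_cmod)
  also have "\<dots> \<le> (\<Sum>\<^sub>\<infinity>\<xi>. cmod (c \<xi>)) - (\<Sum>\<xi>\<in>freq_box N. cmod (c \<xi>))"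
    by (rule infsum_truncation_le[OF rapid_abs_summable[OF assms]]) (simp add: norm_mult)
  finally show ?thesis .
qed

text \<open>Termwise differentiation. The direction h enters the differentiated coefficients only
  through |h| times a summable sequence b, so the derivatives of the partial sums converge uniformly
  in x and relative to |h|.\<close>

lemma synth_has_derivative:
  fixes c :: "int^'n::finite \<Rightarrow> complex"
  assumes c: "rapid c"
  shows "(synth c has_derivative (\<lambda>h. synth (\<lambda>\<xi>. 2 * pi * \<i> * complex_of_real (h \<bullet> frequency \<xi>)
      * c \<xi>) x)) (at x)"
proof -
  define d where "d h \<xi> = 2 * pi * \<i> * complex_of_real (h \<bullet> frequency \<xi>) * c \<xi>" for h \<xi>
  define f where "f N x = Re (\<Sum>\<xi>\<in>freq_box N. c \<xi> * wave \<xi> x)" for N and x :: "real^'n"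
  define f' where "f' N x h = Re (\<Sum>\<xi>\<in>freq_box N. d h \<xi> * wave \<xi> x)" for N and x h :: "real^'n"
  define b where "b \<xi> = 2 * pi * (\<rho> \<xi> * cmod (c \<xi>))" for \<xi>
  have b: "b summable_on UNIV"
    unfolding b_def[abs_def] using c[unfolded rapid_def, rule_format, of 1]
        by (intro summable_on_cmult_right) simp
  have db: "cmod (d h \<xi>) \<le> norm h * b \<xi>" for h \<xi>
  proof -
    have "\<bar>h \<bullet> frequency \<xi>\<bar> \<le> norm h * \<rho> \<xi>"
      by (rule order_trans[OF Cauchy_Schwarz_ineq2 mult_left_mono[OF norm_frequency_le_weight]]) simp
    then have "2 * pi * \<bar>h \<bullet> frequency \<xi>\<bar> * cmod (c \<xi>) \<le> 2 * pi * (norm h * \<rho> \<xi>) * cmod (c \<xi>)"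
      by (intro mult_right_mono mult_left_mono) auto
    then show ?thesis by (simp add: d_def b_def norm_mult mult_ac)
  qed
  have drap: "rapid (d h)" for h
    by (rule rapid_mult[OF c, of _ "norm h * (2 * pi)"]) (use db[of h] in \<open>simp add: b_def mult_ac\<close>)
  have fd: "(f N has_derivative f' N x) (at x within UNIV)" for N x
  proof -
    have "(wave \<xi> has_derivative (\<lambda>h. 2 * pi * \<i> * complex_of_real (h \<bullet> frequency \<xi>)
        * wave \<xi> x)) (at x)" for \<xi>
    proof -
      have "((\<lambda>x. \<i> * complex_of_real (2 * pi * (x \<bullet> frequency \<xi>))) has_derivative
          (\<lambda>h. \<i> * complex_of_real (2 * pi * (h \<bullet> frequency \<xi>)))) (at x)"
        by (auto intro!: derivative_eq_intros)
      from has_derivative_compose[OF this DERIV_exp[unfolded has_field_derivative_def]]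
      show ?thesis unfolding wave_def cis_conv_exp by (simp add: mult_ac)
    qed
    then have "((\<lambda>x. \<Sum>\<xi>\<in>freq_box N. c \<xi> * wave \<xi> x) has_derivative
        (\<lambda>h. \<Sum>\<xi>\<in>freq_box N. c \<xi> * (2 * pi * \<i> * complex_of_real (h \<bullet> frequency \<xi>) * wave \<xi> x))) (at x)"
      by (intro has_derivative_sum has_derivative_mult_right) 
    from bounded_linear.has_derivative[OF bounded_linear_Re this] show ?thesis
      unfolding f_def[abs_def] f'_def[abs_def] d_def by (simp add: mult_ac)
  qed
  have "\<exists>g. \<forall>x\<in>UNIV. (\<lambda>N. f N x) \<longlonglongrightarrow> g x \<and> (g has_derivative (\<lambda>h. synth (d h) x)) (at x within UNIV)"
  proof (rule has_derivative_sequence[OF convex_UNIV fd])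
    show "0 \<in> (UNIV :: (real^'n) set)" by simp
    have lim: "(\<lambda>N. f N x) \<longlonglongrightarrow> synth c x" for x
      unfolding f_def synth_def by (intro tendsto_Re sum_freq_box_tendsto rapid_wave_summable c)
    then show "(\<lambda>N. f N 0) \<longlonglongrightarrow> synth c 0" .
    fix e :: real assume "e > 0"
    from order_tendstoD(2)[OF truncation_tendsto_0[OF b] this]
    show "\<forall>\<^sub>F N in sequentially. \<forall>x\<in>UNIV. \<forall>h. norm (f' N x h - synth (d h) x) \<le> e * norm h"
    proof eventually_elim
      case (elim N)
      have "norm (f' N x h - synth (d h) x) \<le> e * norm h" for x h
      proof -
        have "norm (f' N x h - synth (d h) x) \<le> cmod ((\<Sum>\<^sub>\<infinity>\<xi>. d h \<xi> * wave \<xi> x)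
            - (\<Sum>\<xi>\<in>freq_box N. d h \<xi> * wave \<xi> x))"
          using abs_Re_le_cmod[of "(\<Sum>\<^sub>\<infinity>\<xi>. d h \<xi> * wave \<xi> x) - (\<Sum>\<xi>\<in>freq_box N. d h \<xi> * wave \<xi> x)"]
          by (simp add: f'_def synth_def abs_minus_commute)
        also have "\<dots> \<le> infsum (\<lambda>\<xi>. norm h * b \<xi>) UNIV - sum (\<lambda>\<xi>. norm h * b \<xi>) (freq_box N)"
          by (rule infsum_truncation_le) (use b db[of h] in \<open>auto simp: norm_mult intro!:
              summable_on_cmult_right\<close>)
        also have "\<dots> = norm h * (infsum b UNIV - sum b (freq_box N))"
          using b by (simp add: infsum_cmult_right right_diff_distrib flip: sum_distrib_left)
        also have "\<dots> \<le> norm h * e" using elim by (intro mult_left_mono) auto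
        finally show ?thesis by (simp add: mult.commute)
      qed
      then show ?case by blast
    qed
  qed
  then obtain g where g: "\<And>x. (\<lambda>N. f N x) \<longlonglongrightarrow> g x" "\<And>x. (g has_derivative (\<lambda>h. synth (d h) x)) (at x)"
    by auto
  have "g = synth c"
  proof
    fix x
    have "(\<lambda>N. f N x) \<longlonglongrightarrow> synth c x"
      unfolding f_def synth_def by (intro tendsto_Re sum_freq_box_tendsto rapid_wave_summable c)
    then show "g x = synth c x" using g(1) LIMSEQ_unique by blast
  qed
  then show ?thesis using g(2)[of x] unfolding d_def by simp
qed

lemma partial_deriv_synth:
  assumes "rapid c"
  shows "partial_deriv j (synth c) = synth (deriv_coeff j c)"
proof
  fix x
  show "partial_deriv j (synth c) x = synth (deriv_coeff j c) x"
    unfolding partial_deriv_def frechet_derivative_at[OF synth_has_derivative[OF assms, of x], symmetric]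
    by (simp add: inner_axis' deriv_coeff_def[abs_def])
qed

lemma iterated_partial_synth:
  assumes "rapid c"
  shows "rapid (foldr deriv_coeff js c)" "iterated_partial js (synth c) = synth (foldr deriv_coeff js c)"
proof -
  show r: "rapid (foldr deriv_coeff js c)" for js
    by (induction js) (auto simp: assms rapid_deriv_coeff)
  show "iterated_partial js (synth c) = synth (foldr deriv_coeff js c)"
    by (induction js) (auto simp: partial_deriv_synth r)
qed

lemma synth_smooth_periodic: "rapid c \<Longrightarrow> synth c \<in> smooth_periodic"
  unfolding smooth_periodic_def smooth_fun_def periodic_def
proof (intro CollectI conjI allI)
  fix js x assume c: "rapid c"
  show "iterated_partial js (synth c) differentiable at x"
    unfolding iterated_partial_synth(2)[OF c]
    by (rule differentiableI[OF synth_has_derivative[OF iterated_partial_synth(1)[OF c]]])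
qed (simp add: synth_def wave_periodic)

lemma deriv_coeff_restrict:
  "deriv_coeff j (\<lambda>\<xi>. if \<xi> \<in> A then c \<xi> else 0) = (\<lambda>\<xi>. if \<xi> \<in> A then deriv_coeff j c \<xi> else 0)"
  by (auto simp: deriv_coeff_def)

lemma foldr_deriv_coeff_restrict:
  "foldr deriv_coeff js (\<lambda>\<xi>. if \<xi> \<in> A then c \<xi> else 0)
      = (\<lambda>\<xi>. if \<xi> \<in> A then foldr deriv_coeff js c \<xi> else 0)"
proof (induction js)
  case (Cons j js)
  then show ?case by (simp only: foldr_Cons o_apply deriv_coeff_restrict)
qed (simp only: foldr_Nil id_apply)

text \<open>Truncation commutes with the derivative symbols, so each iterated derivative converges
  uniformly by its own l^1 tail. This lets a distribution be evaluated term by term on a Fourier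
  series.\<close>

lemma synth_truncation_test_tendsto:
  assumes c: "rapid c"
  shows "test_tendsto (\<lambda>N. synth (\<lambda>\<xi>. if \<xi> \<in> freq_box N then c \<xi> else 0)) (synth c)"
  unfolding test_tendsto_def iterated_partial_synth(2)[OF c] iterated_partial_synth(2)[OF
      rapid_restrict[OF c]] foldr_deriv_coeff_restrict
proof
  fix js
  let ?d = "foldr deriv_coeff js c"
  have d: "rapid ?d" by (rule iterated_partial_synth(1)[OF c])
  show "uniform_limit UNIV (\<lambda>N. synth (\<lambda>\<xi>. if \<xi> \<in> freq_box N then ?d \<xi> else 0)) (synth ?d) sequentially"
  proof (rule uniform_limitI)
    fix e :: real assume "e > 0"
    from order_tendstoD(2)[OF truncation_tendsto_0[OF rapid_abs_summable[OF d]] this]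
    show "\<forall>\<^sub>F N in sequentially. \<forall>x\<in>UNIV. dist (synth (\<lambda>\<xi>. if \<xi>
        \<in> freq_box N then ?d \<xi> else 0) x) (synth ?d x) < e"
    proof eventually_elim
      case (elim N)
      have "synth (\<lambda>\<xi>. if \<xi> \<in> freq_box N then ?d \<xi> else 0) x = Re (\<Sum>\<xi>\<in>freq_box N. ?d \<xi> * wave \<xi> x)" for x
        by (subst synth_finite_support[of "freq_box N"]) auto
      then have "dist (synth (\<lambda>\<xi>. if \<xi> \<in> freq_box N then ?d \<xi> else 0) x) (synth ?d x)
          \<le> (\<Sum>\<^sub>\<infinity>\<xi>. cmod (?d \<xi>)) - (\<Sum>\<xi>\<in>freq_box N. cmod (?d \<xi>))" for x
        using synth_truncation_le[OF d, of x N] by (simp add: dist_real_def abs_minus_commute)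
      then show ?case using elim by (meson le_less_trans)
    qed
  qed
qed

section \<open>Integration over the torus\<close>


text \<open>As a measure space of its own the cube has total mass 1, so the results on finite
  measures apply to it directly.\<close>

abbreviation torus_measure :: "(real^'n::finite) measure"
  where "torus_measure \<equiv> restrict_space lborel torus"

lemma torus_sets [measurable]: "(torus :: (real^'n::finite) set) \<in> sets borel"
proof -
  have "(torus :: (real^'n) set) = (\<Inter>i\<in>UNIV. {x. 0 \<le> x $ i} \<inter> {x. x $ i < 1})"
    by (auto simp: torus_def)
  also have "\<dots> \<in> sets borel"
    by (intro sets.finite_INT sets.Int borel_closed borel_open closed_Collect_le open_Collect_less
        continuous_intros) auto
  finally show ?thesis .
qed

lemma One_nth: "(\<Sum>Basis :: real^'n::finite) $ i = 1"
  by (simp add: cart_eq_inner_axis inner_sum_Basis axis_in_Basis_iff)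

lemma torus_subset_cbox: "torus \<subseteq> cbox 0 (\<Sum>Basis)"
  by (auto simp: torus_def mem_box_cart One_nth less_imp_le simp del: sum_component)

lemma box_subset_torus: "box 0 (\<Sum>Basis) \<subseteq> torus"
  by (auto simp: torus_def mem_box_cart One_nth less_imp_le simp del: sum_component)

lemma emeasure_torus: "emeasure lborel (torus :: (real^'n::finite) set) = 1"
proof (rule antisym)
  have "emeasure lborel (torus :: (real^'n) set) \<le> emeasure lborel (cbox 0 (\<Sum>Basis) :: (real^'n) set)"
    by (rule emeasure_mono[OF torus_subset_cbox]) simp
  then show "emeasure lborel (torus :: (real^'n) set) \<le> 1" by simp
  have "emeasure lborel (box 0 (\<Sum>Basis) :: (real^'n) set) \<le> emeasure lborel (torus :: (real^'n) set)"
    by (rule emeasure_mono[OF box_subset_torus]) simp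
  then show "1 \<le> emeasure lborel (torus :: (real^'n) set)" by simp
qed

lemma finite_torus_measure: "finite_measure (torus_measure :: (real^'n::finite) measure)"
  by (rule finite_measureI) (simp add: space_restrict_space emeasure_restrict_space emeasure_torus)

interpretation torus: finite_measure "torus_measure :: (real^'n::finite) measure"
  by (rule finite_torus_measure)

lemma measure_torus [simp]: "measure torus_measure (space torus_measure) = 1"
  by (simp add: measure_def space_restrict_space emeasure_restrict_space emeasure_torus)

lemma integrable_torus_iff:
  fixes f :: "real^'n::finite \<Rightarrow> 'b::{banach, second_countable_topology}"
  shows "set_integrable lborel torus f \<longleftrightarrow> integrable torus_measure f"
  by (simp add: set_integrable_def integrable_restrict_space torus_sets)

lemma set_integral_torus:
  fixes f :: "real^'n::finite \<Rightarrow> 'b::{banach, second_countable_topology}"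
  shows "set_lebesgue_integral lborel torus f = integral\<^sup>L torus_measure f"
  by (simp add: set_lebesgue_integral_def integral_restrict_space torus_sets)

lemma regular_dist_torus: "regular_dist F \<phi> = (\<integral>x. F x * \<phi> x \<partial>torus_measure)"
  by (simp add: regular_dist_def set_integral_torus)

lemma measurable_continuous_torus:
  fixes f :: "real^'n::finite \<Rightarrow> 'b::topological_space"
  assumes "continuous_on UNIV f" shows "f \<in> borel_measurable torus_measure"
  by (rule measurable_restrict_space1) (use borel_measurable_continuous_onI[OF assms] in simp)

lemma integrable_continuous_torus:
  fixes f :: "real^'n::finite \<Rightarrow> 'b::{banach, second_countable_topology}"
  assumes "continuous_on UNIV f" shows "integrable torus_measure f"
  unfolding integrable_torus_iff[symmetric]
proof (rule set_integrable_subset[OF _ _ torus_subset_cbox])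
  show "set_integrable lborel (cbox 0 (\<Sum>Basis)) f"
    unfolding set_integrable_def
    by (rule borel_integrable_compact[OF compact_cbox]) (rule continuous_on_subset[OF assms], simp)
qed simp

lemma integral_lborel_shift:
  fixes f :: "'a::euclidean_space \<Rightarrow> real"
  assumes "f \<in> borel_measurable borel"
  shows "(\<integral>x. f (c + x) \<partial>lborel) = (\<integral>x. f x \<partial>lborel)"
proof -
  have "(\<integral>x. f x \<partial>lborel) = (\<integral>x. f x \<partial>distr lborel borel ((+) c))"
    by (simp add: lborel_distr_plus)
  also have "\<dots> = (\<integral>x. f (c + x) \<partial>lborel)"
    by (rule integral_distr) (use assms in auto)
  finally show ?thesis ..
qed

text \<open>Translation moves the cube onto the union of C and B, where B is the slab sticking out
  beyond x_j = 1. Periodicity carries B back onto A, the slab x_j < t that was vacated.\<close>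

lemma torus_integral_shift:
  fixes f :: "real^'n::finite \<Rightarrow> real"
  assumes cont: "continuous_on UNIV f" and per: "periodic f" and t: "0 \<le> t" "t \<le> 1"
  shows "(\<integral>x. f (x + t *\<^sub>R axis j 1) \<partial>torus_measure) = (\<integral>x. f x \<partial>torus_measure)"
proof -
  let ?e = "axis j 1 :: real^'n"
  define A where "A = {x \<in> torus. x $ j < t}"
  define B where "B = {x :: real^'n. (\<forall>i. i \<noteq> j \<longrightarrow> 0 \<le> x $ i \<and> x $ i < 1) \<and> 1 \<le> x $ j \<and> x $ j < 1 + t}"
  define C where "C = {x \<in> torus. t \<le> x $ j}"
  have ax: "(y + s *\<^sub>R ?e) $ i = (if i = j then y $ j + s else y $ i)" for y s i
    by (simp add: axis_def)
  have allj: "(\<forall>i. Q i) \<longleftrightarrow> (\<forall>i. i \<noteq> j \<longrightarrow> Q i) \<and> Q j" for Q by metis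
  have inT: "x \<in> torus \<longleftrightarrow> (\<forall>i. i \<noteq> j \<longrightarrow> 0 \<le> x $ i \<and> x $ i < 1) \<and> 0 \<le> x $ j \<and> x $ j < 1" for x :: "real^'n"
    unfolding torus_def mem_Collect_eq by (rule allj)
  have eB: "?e + x \<in> B \<longleftrightarrow> x \<in> A" for x
    unfolding A_def B_def mem_Collect_eq inT using ax[of x 1] t by (auto simp: add.commute)
  have shB: "indicator B (?e + x) = (indicator A x :: real)" for x
    by (simp add: indicator_def eB)
  have eT: "t *\<^sub>R ?e + x \<in> C \<union> B \<longleftrightarrow> x \<in> torus" for x
    unfolding C_def B_def Un_iff mem_Collect_eq inT using ax[of x t] t by (auto simp: add.commute)
  have shT: "indicator torus x = (indicator (C \<union> B) (t *\<^sub>R ?e + x) :: real)" for x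
    by (simp only: indicator_def eT)
  have [measurable]: "A \<in> sets borel" "C \<in> sets borel"
    unfolding A_def C_def Collect_conj_eq Collect_mem_eq
    by (auto intro!: sets.Int torus_sets borel_open borel_closed open_Collect_less closed_Collect_le
        continuous_intros)
  have "B = (+) (- ?e) -` A"
  proof (rule set_eqI)
    fix x show "x \<in> B \<longleftrightarrow> x \<in> (+) (- ?e) -` A"
      using eB[of "- ?e + x"] by (simp add: add.assoc[symmetric])
  qed
  then have [measurable]: "B \<in> sets borel"
    using measurable_sets[of "(+) (- ?e)" borel borel A] by simp
  have fm [measurable]: "f \<in> borel_measurable borel" by (rule borel_measurable_continuous_onI[OF cont])
  have int: "integrable lborel (\<lambda>x. indicator S x * f x)" if "S \<in> sets borel" "bounded S" for S
  proof -
    have "set_integrable lborel (closure S) f"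
      unfolding set_integrable_def using that(2)
      by (intro borel_integrable_compact continuous_on_subset[OF cont]) (auto simp: compact_closure)
    from set_integrable_subset[OF this _ closure_subset] that(1) show ?thesis
      by (simp add: set_integrable_def)
  qed
  have bT: "bounded (torus :: (real^'n) set)" using bounded_subset[OF bounded_cbox torus_subset_cbox] .
  have bA: "bounded A" "bounded C" using bT by (auto intro: bounded_subset simp: A_def C_def)
  have bB: "bounded B"
  proof (rule bounded_subset)
    show "B \<subseteq> (+) ?e ` A"
    proof
      fix x assume "x \<in> B"
      then have "x - ?e \<in> A" using eB[of "x - ?e"] by auto
      then show "x \<in> (+) ?e ` A" by (auto intro!: image_eqI[of _ _ "x - ?e"])
    qed
    show "bounded ((+) ?e ` A)" using bA(1) by (rule bounded_translation)
  qed
  have "(\<integral>x. f (x + t *\<^sub>R ?e) \<partial>torus_measure) = (\<integral>x. indicator (C \<union> B) (t *\<^sub>R ?e + x) * f (t *\<^sub>R ?e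
      + x) \<partial>lborel)"
    unfolding integral_restrict_space[of torus lborel, simplified] shT by (simp add: add.commute)
  also have "\<dots> = (\<integral>x. indicator (C \<union> B) x * f x \<partial>lborel)"
    by (rule integral_lborel_shift) measurable
  also have "\<dots> = (\<integral>x. indicator C x * f x + indicator B x * f x \<partial>lborel)"
    by (rule Bochner_Integration.integral_cong[OF refl]) (auto simp: indicator_def C_def B_def inT)
  also have "\<dots> = (\<integral>x. indicator C x * f x \<partial>lborel) + (\<integral>x. indicator B x * f x \<partial>lborel)"
    by (rule Bochner_Integration.integral_add) (auto intro!: int bA bB)
  also have "(\<integral>x. indicator B x * f x \<partial>lborel) = (\<integral>x. indicator B (?e + x) * f (?e + x) \<partial>lborel)"
    by (rule integral_lborel_shift[symmetric]) measurable
  also have "\<dots> = (\<integral>x. indicator A x * f x \<partial>lborel)"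
  proof -
    have "f (?e + x) = f x" for x using per by (simp add: periodic_def add.commute)
    then show ?thesis by (simp only: shB)
  qed
  also have "(\<integral>x. indicator C x * f x \<partial>lborel) + (\<integral>x. indicator A x * f x \<partial>lborel)
      = (\<integral>x. indicator C x * f x + indicator A x * f x \<partial>lborel)"
    by (rule Bochner_Integration.integral_add[symmetric]) (auto intro!: int bA)
  also have "\<dots> = (\<integral>x. f x \<partial>torus_measure)"
    unfolding integral_restrict_space[of torus lborel, simplified]
    by (rule Bochner_Integration.integral_cong[OF refl]) (auto simp: indicator_def C_def A_def)
  finally show ?thesis .
qed

section \<open>Periodic functions and the cube\<close>

lemma periodic_int_shift:
  fixes f :: "real^'n::finite \<Rightarrow> real"
  assumes per: "periodic f"
  shows "f (x + frequency m) = f x"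
proof -
  have nat: "f (x + real k *\<^sub>R axis i 1) = f x" for x i k
  proof (induction k arbitrary: x)
    case (Suc k)
    have "f (x + real (Suc k) *\<^sub>R axis i 1) = f ((x + real k *\<^sub>R axis i 1) + axis i 1)"
      by (simp add: algebra_simps)
    then show ?case using per Suc by (simp add: periodic_def)
  qed simp
  have int: "f (x + real_of_int k *\<^sub>R axis i 1) = f x" for x i k
  proof (cases "k \<ge> 0")
    case True
    then show ?thesis using nat[of x "nat k" i] by simp
  next
    case False
    \<comment> \<open>For negative k the natural case is applied at the shifted point and leads back
      to x.\<close>
    then show ?thesis using nat[of "x + real_of_int k *\<^sub>R axis i 1" "nat (- k)" i] by simp
  qed
  have "f (x + (\<Sum>i\<in>A. real_of_int (m $ i) *\<^sub>R axis i 1)) = f x" if "finite A" for A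
    using that
  proof (induction A rule: finite_induct)
    case (insert i A)
    then show ?case using int[of "x + (\<Sum>i\<in>A. real_of_int (m $ i) *\<^sub>R axis i 1)" "m $ i" i]
      by (simp add: algebra_simps)
  qed simp
  moreover have "(\<Sum>i\<in>UNIV. real_of_int (m $ i) *\<^sub>R axis i 1) = frequency m"
    by (simp add: vec_eq_iff axis_def if_distrib cong: if_cong)
  ultimately show ?thesis by (metis finite_class.finite_UNIV)
qed

definition torus_rep :: "real^'n \<Rightarrow> real^'n"
  where "torus_rep x = (\<chi> i. frac (x $ i))"

lemma torus_rep: "torus_rep x \<in> torus" "x = torus_rep x + frequency (\<chi> i. \<lfloor>x $ i\<rfloor>)"
  by (auto simp: torus_rep_def torus_def frac_lt_1) (simp add: vec_eq_iff frac_def)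

lemma periodic_torus_rep: "periodic f \<Longrightarrow> f (torus_rep x) = f x"
  using periodic_int_shift[of f "torus_rep x" "\<chi> i. \<lfloor>x $ i\<rfloor>"] torus_rep(2)[of x] by metis

lemma periodic_bounded:
  fixes f :: "real^'n::finite \<Rightarrow> real"
  assumes cont: "continuous_on UNIV f" and per: "periodic f"
  obtains B where "0 \<le> B" "\<And>x. \<bar>f x\<bar> \<le> B"
proof -
  have "compact (f ` cbox 0 (\<Sum>Basis))"
    by (intro compact_continuous_image continuous_on_subset[OF cont]) auto
  then have "bounded (f ` cbox 0 (\<Sum>Basis))" by (rule compact_imp_bounded)
  then obtain B where B: "\<And>x. x \<in> cbox 0 (\<Sum>Basis) \<Longrightarrow> \<bar>f x\<bar> \<le> B"
    by (auto simp: bounded_iff)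
  have fB: "\<bar>f x\<bar> \<le> B" for x
    using B[of "torus_rep x"] torus_subset_cbox torus_rep(1)[of x] periodic_torus_rep[OF per, of x] by
        auto
  then have "0 \<le> B" using abs_ge_zero order_trans by blast
  then show ?thesis using fB by (rule that)
qed

text \<open>Difference quotients in direction j have integral 0 by translation invariance. The mean
  value theorem bounds them by a bound of the derivative, so dominated convergence carries this to
  the limit.\<close>

lemma torus_integral_partial_deriv:
  fixes f :: "real^'n::finite \<Rightarrow> real"
  assumes d: "\<And>x. f differentiable (at x)" and per: "periodic f"
    and cont: "continuous_on UNIV (partial_deriv j f)" and per': "periodic (partial_deriv j f)"
  shows "(\<integral>x. partial_deriv j f x \<partial>torus_measure) = 0"
proof -
  let ?e = "axis j 1 :: real^'n" and ?g = "partial_deriv j f"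
  \<comment> \<open>Steps of length at most 1, the range covered by the shift lemma.\<close>
  define t where "t n = inverse (real (Suc n))" for n
  have t: "0 < t n" "t n \<le> 1" for n by (auto simp: t_def field_simps)
  have cf: "continuous_on UNIV f"
    using d by (auto intro!: continuous_at_imp_continuous_on differentiable_imp_continuous_within)
  have der: "((\<lambda>s. f (x + s *\<^sub>R ?e)) has_real_derivative ?g (x + s *\<^sub>R ?e)) (at s)" for x s
  proof -
    have "(f has_derivative frechet_derivative f (at (x + s *\<^sub>R ?e))) (at (x + s *\<^sub>R ?e))"
      using d frechet_derivative_works by blast
    moreover have "((\<lambda>s. x + s *\<^sub>R ?e) has_derivative (\<lambda>h. h *\<^sub>R ?e)) (at s)"
      by (auto intro!: derivative_eq_intros)
    ultimately have "((\<lambda>s. f (x + s *\<^sub>R ?e)) has_derivative (\<lambda>h. frechet_derivative f (at (x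
        + s *\<^sub>R ?e)) (h *\<^sub>R ?e))) (at s)"
      by (intro has_derivative_compose[of "\<lambda>s. x + s *\<^sub>R ?e" _ s UNIV f])
    moreover have "frechet_derivative f (at (x + s *\<^sub>R ?e)) (h *\<^sub>R ?e) = ?g (x + s *\<^sub>R ?e) * h" for h
      using linear_scale[OF linear_frechet_derivative[OF d]]
          by (simp add: partial_deriv_def mult.commute)
    ultimately show ?thesis by (simp add: has_field_derivative_def)
  qed
  obtain B where B: "0 \<le> B" "\<And>x. \<bar>?g x\<bar> \<le> B" using periodic_bounded[OF cont per'] by blast
  define q where "q n x = (f (x + t n *\<^sub>R ?e) - f x) / t n" for n x
  have cq: "continuous_on UNIV (\<lambda>x. f (x + t n *\<^sub>R ?e))" for n
    by (rule continuous_on_compose2[OF cf]) (auto intro!: continuous_intros)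
  have "(\<integral>x. q n x \<partial>torus_measure) = 0" for n
    unfolding q_def using t[of n] torus_integral_shift[OF cf per, of "t n" j]
    by (simp add: integrable_continuous_torus cf cq less_imp_le)
  moreover have "(\<lambda>n. \<integral>x. q n x \<partial>torus_measure) \<longlonglongrightarrow> (\<integral>x. ?g x \<partial>torus_measure)"
  proof (rule integral_dominated_convergence[where w = "\<lambda>_. B"])
    show "?g \<in> borel_measurable torus_measure" by (rule measurable_continuous_torus[OF cont])
    show "q n \<in> borel_measurable torus_measure" for n
      unfolding q_def[abs_def] by (intro measurable_continuous_torus continuous_intros cf cq) (use t in
          \<open>auto simp: less_imp_neq[symmetric]\<close>)
    show "AE x in torus_measure. (\<lambda>n. q n x) \<longlonglongrightarrow> ?g x"
    proof (rule AE_I2)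
      fix x
      have "((\<lambda>h. (f (x + (0 + h) *\<^sub>R ?e) - f (x + 0 *\<^sub>R ?e)) / h) \<longlongrightarrow> ?g (x + 0 *\<^sub>R ?e)) (at 0)"
        using der[of x 0] by (simp only: DERIV_def)
      moreover have "filterlim t (at 0) sequentially"
        unfolding filterlim_at t_def[abs_def] using LIMSEQ_inverse_real_of_nat
            by (auto intro!: always_eventually)
      ultimately have "(\<lambda>n. (f (x + (0 + t n) *\<^sub>R ?e) - f (x + 0 *\<^sub>R ?e)) / t n) \<longlonglongrightarrow> ?g (x + 0 *\<^sub>R ?e)"
        by (rule filterlim_compose)
      then show "(\<lambda>n. q n x) \<longlonglongrightarrow> ?g x" by (simp add: q_def)
    qed
    show "AE x in torus_measure. norm (q n x) \<le> B" for n
    proof (rule AE_I2)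
      fix x
      obtain z where "f (x + t n *\<^sub>R ?e) - f (x + 0 *\<^sub>R ?e) = (t n - 0) * ?g (x + z *\<^sub>R ?e)"
        using MVT2[OF t(1)[of n], of "\<lambda>s. f (x + s *\<^sub>R ?e)" "\<lambda>s. ?g (x + s *\<^sub>R ?e)"] der by blast
      then have "q n x = ?g (x + z *\<^sub>R ?e)" using t(1)[of n] by (simp add: q_def)
      then show "norm (q n x) \<le> B" using B by simp
    qed
  qed simp
  ultimately show ?thesis by (simp add: LIMSEQ_const_iff)
qed

section \<open>Fourier coefficients of periodic distributions\<close>


lemma smooth_differentiable: "smooth_fun f \<Longrightarrow> f differentiable (at x)"
  unfolding smooth_fun_def by (drule spec[of _ "[]"]) simp

lemma smooth_continuous: "smooth_fun f \<Longrightarrow> continuous_on A f"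
  by (intro continuous_at_imp_continuous_on ballI differentiable_imp_continuous_within
      smooth_differentiable)

lemma smooth_partial_deriv: "smooth_fun f \<Longrightarrow> smooth_fun (partial_deriv j f)"
  unfolding smooth_fun_def
proof (intro allI)
  fix js x assume "\<forall>js x. iterated_partial js f differentiable (at x)"
  \<comment> \<open>\<open>foldr\<close> applies the last entry of the list innermost, so a
    derivative taken before all others is an entry appended at the end.\<close>
  from this[rule_format, of "js @ [j]" x]
  show "iterated_partial js (partial_deriv j f) differentiable (at x)" by simp
qed

lemma periodic_partial_deriv:
  assumes d: "\<And>x. f differentiable (at x)" and per: "periodic f"
  shows "periodic (partial_deriv j f)"
  unfolding periodic_def
proof (intro allI)
  fix x i
  have "(f has_derivative frechet_derivative f (at (x + axis i 1))) (at (x + axis i 1))"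
    using d frechet_derivative_works by blast
  moreover have "((\<lambda>x. x + axis i 1) has_derivative (\<lambda>h. h)) (at x)"
    by (auto intro!: derivative_eq_intros)
  ultimately have "((\<lambda>x. f (x + axis i 1)) has_derivative (\<lambda>h. frechet_derivative f (at (x
      + axis i 1)) h)) (at x)"
    by (intro has_derivative_compose[of "\<lambda>x. x + axis i 1" _ x UNIV f])
  then have "(f has_derivative frechet_derivative f (at (x + axis i 1))) (at x)"
    using per by (simp add: periodic_def)
  from frechet_derivative_at[OF this] show "partial_deriv j f (x + axis i 1) = partial_deriv j f x"
    by (simp add: partial_deriv_def)
qed

lemma smooth_periodic_partial_deriv: "f \<in> smooth_periodic \<Longrightarrow> partial_deriv j f \<in> smooth_periodic"
  by (simp add: smooth_periodic_def smooth_partial_deriv periodic_partial_deriv smooth_differentiable)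

lemma smooth_periodicD:
  assumes "f \<in> smooth_periodic"
  shows "smooth_fun f" "periodic f" "\<And>x. f differentiable (at x)" "\<And>A. continuous_on A f"
  using assms by (auto simp: smooth_periodic_def smooth_differentiable smooth_continuous)

lemma partial_deriv_mult:
  assumes "f differentiable (at x)" "g differentiable (at x)"
  shows "partial_deriv j (\<lambda>x. f x * g x) x = f x * partial_deriv j g x + partial_deriv j f x * g x"
  using frechet_derivative_at[OF has_derivative_mult[OF assms[unfolded frechet_derivative_works]],
      symmetric]
  by (simp add: partial_deriv_def)

lemma partial_deriv_lincomb:
  assumes "f differentiable (at x)" "g differentiable (at x)"
  shows "partial_deriv j (\<lambda>x. a * f x + b * g x) x = a * partial_deriv j f x + b * partial_deriv j g x"
proof -
  have "((\<lambda>x. a * f x + b * g x) has_derivative (\<lambda>h. a * frechet_derivative f (at x) h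
      + b * frechet_derivative g (at x) h)) (at x)"
    by (intro has_derivative_add has_derivative_mult_right assms[unfolded frechet_derivative_works])
  from frechet_derivative_at[OF this, symmetric] show ?thesis by (simp add: partial_deriv_def)
qed

lemma torus_integration_by_parts:
  assumes f: "f \<in> smooth_periodic" and g: "g \<in> smooth_periodic"
  shows "(\<integral>x. partial_deriv j f x * g x \<partial>torus_measure)
      = - (\<integral>x. f x * partial_deriv j g x \<partial>torus_measure)"
proof -
  note F = smooth_periodicD[OF f] and G = smooth_periodicD[OF g]
  note F' = smooth_periodicD[OF smooth_periodic_partial_deriv[OF f, of j]]
    and G' = smooth_periodicD[OF smooth_periodic_partial_deriv[OF g, of j]]
  have eq: "partial_deriv j (\<lambda>x. f x * g x) = (\<lambda>x. f x * partial_deriv j g x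
      + partial_deriv j f x * g x)"
    by (rule ext) (rule partial_deriv_mult[OF F(3) G(3)])
  have "(\<integral>x. partial_deriv j (\<lambda>x. f x * g x) x \<partial>torus_measure) = 0"
  proof (rule torus_integral_partial_deriv)
    show "(\<lambda>x. f x * g x) differentiable (at x)" for x
      by (intro differentiable_mult F G)
    show "periodic (\<lambda>x. f x * g x)" using F(2) G(2) by (simp add: periodic_def)
    show "continuous_on UNIV (partial_deriv j (\<lambda>x. f x * g x))"
      unfolding eq by (intro continuous_intros F G F' G')
    show "periodic (partial_deriv j (\<lambda>x. f x * g x))"
      unfolding eq using F(2) G(2) F'(2) G'(2) by (simp add: periodic_def)
  qed
  then have "(\<integral>x. f x * partial_deriv j g x + partial_deriv j f x * g x \<partial>torus_measure) = 0"
    by (simp only: eq)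
  moreover have "(\<integral>x. f x * partial_deriv j g x + partial_deriv j f x * g x \<partial>torus_measure)
     = (\<integral>x. f x * partial_deriv j g x \<partial>torus_measure) + (\<integral>x. partial_deriv j f x * g x \<partial>torus_measure)"
    by (intro Bochner_Integration.integral_add integrable_continuous_torus continuous_intros F G F' G')
  ultimately show ?thesis by simp
qed

text \<open>The sequence behind a single real wave: z = 1 gives the cosine and z = -i the sine, so
  their smoothness and derivatives follow from the general results on \<open>synth\<close>.\<close>

definition single_freq :: "int^'n \<Rightarrow> complex \<Rightarrow> int^'n \<Rightarrow> complex"
  where "single_freq \<xi> z \<eta> = (if \<eta> = \<xi> then z else 0)"

lemma rapid_single_freq: "rapid (single_freq \<xi> z)"
  by (rule rapid_finite_support[of "{\<xi>}"]) (auto simp: single_freq_def)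

lemma synth_single_freq: "synth (single_freq \<xi> z) x = Re (z * wave \<xi> x)"
  by (subst synth_finite_support[of "{\<xi>}"]) (auto simp: single_freq_def)

lemma cos_eq_synth: "(\<lambda>x. cos (2 * pi * (x \<bullet> frequency \<xi>))) = synth (single_freq \<xi> 1)"
  by (simp add: fun_eq_iff synth_single_freq wave_def)

lemma sin_eq_synth: "(\<lambda>x. sin (2 * pi * (x \<bullet> frequency \<xi>))) = synth (single_freq \<xi> (- \<i>))"
  by (simp add: fun_eq_iff synth_single_freq wave_def)

lemma cos_smooth_periodic: "(\<lambda>x. cos (2 * pi * (x \<bullet> frequency \<xi>))) \<in> smooth_periodic"
  unfolding cos_eq_synth by (rule synth_smooth_periodic[OF rapid_single_freq])

lemma sin_smooth_periodic: "(\<lambda>x. sin (2 * pi * (x \<bullet> frequency \<xi>))) \<in> smooth_periodic"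
  unfolding sin_eq_synth by (rule synth_smooth_periodic[OF rapid_single_freq])

lemma deriv_coeff_single_freq: "deriv_coeff j (single_freq \<xi> z)
    = single_freq \<xi> (2 * pi * \<i> * of_int (\<xi> $ j) * z)"
  by (auto simp: deriv_coeff_def single_freq_def)

lemma partial_deriv_cos: "partial_deriv j (\<lambda>x. cos (2 * pi * (x \<bullet> frequency \<xi>)))
    = (\<lambda>x. - (2 * pi * \<xi> $ j) * sin (2 * pi * (x \<bullet> frequency \<xi>)))"
  unfolding cos_eq_synth partial_deriv_synth[OF rapid_single_freq] deriv_coeff_single_freq
  by (simp add: fun_eq_iff synth_single_freq wave_def)

lemma partial_deriv_sin: "partial_deriv j (\<lambda>x. sin (2 * pi * (x \<bullet> frequency \<xi>)))
    = (\<lambda>x. (2 * pi * \<xi> $ j) * cos (2 * pi * (x \<bullet> frequency \<xi>)))"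
  unfolding sin_eq_synth partial_deriv_synth[OF rapid_single_freq] deriv_coeff_single_freq
  by (simp add: fun_eq_iff synth_single_freq wave_def)

section \<open>Closure properties of periodic distributions\<close>

lemma distribution_lincomb:
  assumes "g \<in> periodic_distributions" "\<phi> \<in> smooth_periodic" "\<psi> \<in> smooth_periodic"
  shows "g (\<lambda>x. a * \<phi> x + b * \<psi> x) = a * g \<phi> + b * g \<psi>"
  using assms unfolding periodic_distributions_def by blast

lemma distribution_scale:
  assumes "g \<in> periodic_distributions" "\<phi> \<in> smooth_periodic"
  shows "g (\<lambda>x. a * \<phi> x) = a * g \<phi>"
  using distribution_lincomb[OF assms assms(2), of a 0] by simp

lemma distribution_tendsto:
  assumes "g \<in> periodic_distributions" "\<And>m. \<phi> m \<in> smooth_periodic" "\<psi>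
      \<in> smooth_periodic" "test_tendsto \<phi> \<psi>"
  shows "(\<lambda>m. g (\<phi> m)) \<longlonglongrightarrow> g \<psi>"
  using assms unfolding periodic_distributions_def by blast

lemma periodic_distributionI:
  assumes "\<And>\<phi> \<psi> a b. \<phi> \<in> smooth_periodic \<Longrightarrow> \<psi> \<in> smooth_periodic \<Longrightarrow>
      g (\<lambda>x. a * \<phi> x + b * \<psi> x) = a * g \<phi> + b * g \<psi>"
    and "\<And>\<phi> \<psi>. (\<And>m. \<phi> m \<in> smooth_periodic) \<Longrightarrow> \<psi> \<in> smooth_periodic \<Longrightarrow> test_tendsto \<phi> \<psi> \<Longrightarrow>
        (\<lambda>m. g (\<phi> m)) \<longlonglongrightarrow> g \<psi>"
  shows "g \<in> periodic_distributions"
  using assms unfolding periodic_distributions_def by blast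

lemma test_tendsto_partial_deriv:
  assumes "test_tendsto \<phi> \<psi>"
  shows "test_tendsto (\<lambda>m. partial_deriv j (\<phi> m)) (partial_deriv j \<psi>)"
  unfolding test_tendsto_def
proof
  fix js
  show "uniform_limit UNIV (\<lambda>m. iterated_partial js (partial_deriv j (\<phi> m))) (iterated_partial js
      (partial_deriv j \<psi>)) sequentially"
    using assms[unfolded test_tendsto_def, rule_format, of "js @ [j]"] by simp
qed

lemma dist_deriv_periodic_distribution:
  assumes g: "g \<in> periodic_distributions"
  shows "dist_deriv j g \<in> periodic_distributions"
proof (rule periodic_distributionI)
  fix \<phi> \<psi> :: "real^'a \<Rightarrow> real" and a b assume P: "\<phi> \<in> smooth_periodic" "\<psi> \<in> smooth_periodic"
  have "partial_deriv j (\<lambda>x. a * \<phi> x + b * \<psi> x) = (\<lambda>x. a * partial_deriv j \<phi> x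
      + b * partial_deriv j \<psi> x)"
    by (rule ext) (rule partial_deriv_lincomb[OF smooth_periodicD(3)[OF P(1)] smooth_periodicD(3)[OF
        P(2)]])
  then show "dist_deriv j g (\<lambda>x. a * \<phi> x + b * \<psi> x) = a * dist_deriv j g \<phi> + b * dist_deriv j g \<psi>"
    using distribution_lincomb[OF g smooth_periodic_partial_deriv smooth_periodic_partial_deriv, OF P, of
        a j b j]
    by (simp add: dist_deriv_def)
next
  fix \<phi> and \<psi> :: "real^'a \<Rightarrow> real" assume "\<And>m. \<phi> m \<in> smooth_periodic" "\<psi>
      \<in> smooth_periodic" "test_tendsto \<phi> \<psi>"
  then show "(\<lambda>m. dist_deriv j g (\<phi> m)) \<longlonglongrightarrow> dist_deriv j g \<psi>"
    unfolding dist_deriv_def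
    by (intro tendsto_minus distribution_tendsto[OF g] smooth_periodic_partial_deriv
        test_tendsto_partial_deriv)
qed

lemma periodic_distribution_add:
  assumes "g \<in> periodic_distributions" "h \<in> periodic_distributions"
  shows "(\<lambda>\<phi>. g \<phi> + h \<phi>) \<in> periodic_distributions"
  by (rule periodic_distributionI)
    (auto simp: distribution_lincomb assms distrib_left intro!: tendsto_add distribution_tendsto[OF
        assms(1)] distribution_tendsto[OF assms(2)])

lemma periodic_distribution_cmult:
  assumes "g \<in> periodic_distributions"
  shows "(\<lambda>\<phi>. c * g \<phi>) \<in> periodic_distributions"
  by (rule periodic_distributionI)
    (auto simp: distribution_lincomb assms algebra_simps intro!: tendsto_mult_left
        distribution_tendsto[OF assms])

lemma periodic_distribution_uminus:
  "g \<in> periodic_distributions \<Longrightarrow> (\<lambda>\<phi>. - g \<phi>) \<in> periodic_distributions"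
  using periodic_distribution_cmult[of g "-1"] by simp

lemma periodic_distribution_diff:
  assumes "g \<in> periodic_distributions" "h \<in> periodic_distributions"
  shows "(\<lambda>\<phi>. g \<phi> - h \<phi>) \<in> periodic_distributions"
  using periodic_distribution_add[OF assms(1) periodic_distribution_uminus[OF assms(2)]] by simp

lemma periodic_distribution_0: "(\<lambda>\<phi>. 0) \<in> periodic_distributions"
  by (rule periodic_distributionI) auto

lemma periodic_distribution_sum:
  assumes "finite J" "\<And>j. j \<in> J \<Longrightarrow> g j \<in> periodic_distributions"
  shows "(\<lambda>\<phi>. \<Sum>j\<in>J. g j \<phi>) \<in> periodic_distributions"
  using assms
  by (induction J rule: finite_induct) (auto intro: periodic_distribution_0 periodic_distribution_add)

lemma fourier_coeff_dist_deriv: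
  assumes "g \<in> periodic_distributions"
  shows "fourier_coeff (dist_deriv j g) \<xi> = 2 * pi * \<i> * of_int (\<xi> $ j) * fourier_coeff g \<xi>"
  by (simp add: fourier_coeff_def dist_deriv_def partial_deriv_cos partial_deriv_sin complex_eq_iff
      distribution_scale[OF assms cos_smooth_periodic] distribution_scale[OF assms sin_smooth_periodic]
      distribution_scale[OF assms sin_smooth_periodic, where a
          = "- (2 * pi * real_of_int (\<xi> $ j))", simplified])

lemma hermitian_fourier_coeff:
  assumes "g \<in> periodic_distributions"
  shows "fourier_coeff g (- \<xi>) = cnj (fourier_coeff g \<xi>)"
  using distribution_scale[OF assms sin_smooth_periodic, of "-1" \<xi>]
  by (simp add: fourier_coeff_def complex_eq_iff)

lemma integrable_mult_smooth:
  assumes F: "integrable torus_measure F" and \<phi>: "\<phi> \<in> smooth_periodic"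
  shows "integrable torus_measure (\<lambda>x. F x * \<phi> x)"
proof -
  obtain B where B: "0 \<le> B" "\<And>x. \<bar>\<phi> x\<bar> \<le> B" using periodic_bounded smooth_periodicD[OF \<phi>] by metis
  show ?thesis
  proof (rule Bochner_Integration.integrable_bound)
    show "integrable torus_measure (\<lambda>x. B * F x)" using F by simp
    show "(\<lambda>x. F x * \<phi> x) \<in> borel_measurable torus_measure"
      using F measurable_continuous_torus[OF smooth_periodicD(4)[OF \<phi>]]
          by (intro borel_measurable_times) auto
    show "AE x in torus_measure. norm (F x * \<phi> x) \<le> norm (B * F x)"
    proof (rule AE_I2)
      fix x show "norm (F x * \<phi> x) \<le> norm (B * F x)"
        using B(1) mult_right_mono[OF B(2), of "\<bar>F x\<bar>" x] by (simp add: abs_mult mult.commute)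
    qed
  qed
qed

lemma regular_dist_periodic_distribution:
  assumes F: "integrable torus_measure F"
  shows "regular_dist F \<in> periodic_distributions"
proof (rule periodic_distributionI)
  fix \<phi> \<psi> :: "real^'a \<Rightarrow> real" and a b assume P: "\<phi> \<in> smooth_periodic" "\<psi> \<in> smooth_periodic"
  have "regular_dist F (\<lambda>x. a * \<phi> x + b * \<psi> x) = (\<integral>x. a * (F x * \<phi> x) + b * (F x * \<psi> x) \<partial>torus_measure)"
    unfolding regular_dist_torus by (simp add: algebra_simps)
  also have "\<dots> = a * regular_dist F \<phi> + b * regular_dist F \<psi>"
    unfolding regular_dist_torus using integrable_mult_smooth[OF F] P by simp
  finally show "regular_dist F (\<lambda>x. a * \<phi> x + b * \<psi> x) = a * regular_dist F \<phi> + b * regular_dist F \<psi>" .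
next
  fix \<phi> and \<psi> :: "real^'a \<Rightarrow> real"
  assume P: "\<And>m. \<phi> m \<in> smooth_periodic" "\<psi> \<in> smooth_periodic" and t: "test_tendsto \<phi> \<psi>"
  have u: "uniform_limit UNIV \<phi> \<psi> sequentially"
    using t[unfolded test_tendsto_def, rule_format, of "[]"] by simp
  show "(\<lambda>m. regular_dist F (\<phi> m)) \<longlonglongrightarrow> regular_dist F \<psi>"
  proof (rule LIMSEQ_I)
    fix e :: real assume e: "e > 0"
    define I where "I = (\<integral>x. \<bar>F x\<bar> \<partial>torus_measure)"
    have I: "0 \<le> I" by (simp add: I_def)
    \<comment> \<open>The 1 in the denominator covers functions F with vanishing L^1 norm.\<close>
    have "\<forall>\<^sub>F m in sequentially. \<forall>x\<in>UNIV. dist (\<phi> m x) (\<psi> x) < e / (I + 1)"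
      using e I by (intro uniform_limitD[OF u]) simp
    then obtain M where M: "\<And>m x. m \<ge> M \<Longrightarrow> \<bar>\<phi> m x - \<psi> x\<bar> < e / (I + 1)"
      by (auto simp: eventually_sequentially dist_real_def)
    show "\<exists>no. \<forall>n\<ge>no. norm (regular_dist F (\<phi> n) - regular_dist F \<psi>) < e"
    proof (intro exI allI impI)
      fix m assume m: "m \<ge> M"
      have "regular_dist F (\<phi> m) - regular_dist F \<psi> = (\<integral>x. F x * \<phi> m x - F x * \<psi> x \<partial>torus_measure)"
        unfolding regular_dist_torus using integrable_mult_smooth[OF F] P by simp
      also have "norm \<dots> \<le> (\<integral>x. \<bar>F x\<bar> * (e / (I + 1)) \<partial>torus_measure)"
      proof (rule Bochner_Integration.integral_norm_bound_integral)
        show "integrable torus_measure (\<lambda>x. F x * \<phi> m x - F x * \<psi> x)"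
          using integrable_mult_smooth[OF F] P by simp
        show "integrable torus_measure (\<lambda>x. \<bar>F x\<bar> * (e / (I + 1)))" using F by simp
        fix x
        show "norm (F x * \<phi> m x - F x * \<psi> x) \<le> \<bar>F x\<bar> * (e / (I + 1))"
          using mult_left_mono[OF less_imp_le[OF M[OF m, of x]], of "\<bar>F x\<bar>"]
          by (simp add: abs_mult flip: right_diff_distrib)
      qed
      also have "\<dots> = I * (e / (I + 1))" by (simp only: I_def integral_mult_left_zero)
      also have "\<dots> < e" using e I by (simp add: field_simps)
      finally show "norm (regular_dist F (\<phi> m) - regular_dist F \<psi>) < e" .
    qed
  qed
qed

lemma integrable_mult_wave:
  assumes "integrable torus_measure (F :: real^'n::finite \<Rightarrow> complex)"
  shows "integrable torus_measure (\<lambda>x. F x * cnj (wave \<xi> x))"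
proof (rule Bochner_Integration.integrable_bound[OF assms])
  show "(\<lambda>x. F x * cnj (wave \<xi> x)) \<in> borel_measurable torus_measure"
    by (rule borel_measurable_times[OF borel_measurable_integrable[OF assms]
        measurable_continuous_torus])
      (intro continuous_intros continuous_on_wave)
qed (simp add: norm_mult)

lemma fourier_coeff_regular_dist:
  assumes "integrable torus_measure F"
  shows "fourier_coeff (regular_dist F) \<xi> = (\<integral>x. complex_of_real (F x) * cnj (wave \<xi> x) \<partial>torus_measure)"
proof -
  have i: "integrable torus_measure (\<lambda>x. complex_of_real (F x) * cnj (wave \<xi> x))"
    by (rule integrable_mult_wave) (use assms in simp)
  show ?thesis
    unfolding complex_eq_iff integral_Re[OF i, symmetric] integral_Im[OF i, symmetric]
    by (simp add: fourier_coeff_def regular_dist_torus wave_def)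
qed

lemma cmod_fourier_coeff_le:
  assumes "integrable torus_measure F"
  shows "cmod (fourier_coeff (regular_dist F) \<xi>) \<le> (\<integral>x. \<bar>F x\<bar> \<partial>torus_measure)"
  unfolding fourier_coeff_regular_dist[OF assms]
  by (rule Bochner_Integration.integral_norm_bound_integral) (use assms in \<open>auto intro!:
      integrable_mult_wave simp: norm_mult\<close>)

lemma dist_deriv_regular:
  assumes "\<phi> \<in> smooth_periodic"
  shows "dist_eq (dist_deriv j (regular_dist \<phi>)) (regular_dist (partial_deriv j \<phi>))"
  unfolding dist_eq_def dist_deriv_def regular_dist_torus
  using torus_integration_by_parts[OF assms] by simp

lemma fourier_coeff_cong: "dist_eq g h \<Longrightarrow> fourier_coeff g = fourier_coeff h"
  by (simp add: dist_eq_def fourier_coeff_def cos_smooth_periodic sin_smooth_periodic fun_eq_iff)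

lemma integrable_smooth: "\<phi> \<in> smooth_periodic \<Longrightarrow> integrable torus_measure \<phi>"
  by (intro integrable_continuous_torus smooth_periodicD)

lemma fourier_coeff_partial_deriv:
  assumes "\<phi> \<in> smooth_periodic"
  shows "fourier_coeff (regular_dist (partial_deriv j \<phi>)) \<xi>
      = 2 * pi * \<i> * of_int (\<xi> $ j) * fourier_coeff (regular_dist \<phi>) \<xi>"
  using fourier_coeff_cong[OF dist_deriv_regular[OF assms]]
    fourier_coeff_dist_deriv[OF regular_dist_periodic_distribution[OF integrable_smooth[OF assms]]] by
        metis

text \<open>Induction on m for all smooth functions at once: the weight is at most 1 plus the sum of
  the |\<xi>_j|, and each |\<xi>_j| is absorbed by passing to the j-th derivative, to which the
  induction hypothesis applies.\<close>

lemma fourier_coeff_decay: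
  "\<phi> \<in> smooth_periodic \<Longrightarrow> \<exists>C. \<forall>\<xi>. \<rho> \<xi> ^ m * cmod (fourier_coeff (regular_dist \<phi>) \<xi>) \<le> C"
proof (induction m arbitrary: \<phi>)
  case 0
  then show ?case using cmod_fourier_coeff_le[OF integrable_smooth] by auto
next
  case (Suc m)
  obtain C where C: "\<And>\<xi>. \<rho> \<xi> ^ m * cmod (fourier_coeff (regular_dist \<phi>) \<xi>) \<le> C"
    using Suc by blast
  have "\<forall>j. \<exists>D. \<forall>\<xi>. \<rho> \<xi> ^ m * cmod (fourier_coeff (regular_dist (partial_deriv j \<phi>)) \<xi>) \<le> D"
    using Suc smooth_periodic_partial_deriv by blast
  then obtain D where D: "\<And>j \<xi>. \<rho> \<xi> ^ m * cmod (fourier_coeff (regular_dist (partial_deriv j \<phi>)) \<xi>)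
      \<le> D j"
    by metis
  have "\<rho> \<xi> ^ Suc m * cmod (fourier_coeff (regular_dist \<phi>) \<xi>) \<le> C + (\<Sum>j\<in>UNIV. D j)" for \<xi>
  proof -
    let ?f = "cmod (fourier_coeff (regular_dist \<phi>) \<xi>)"
    have "\<rho> \<xi> \<le> 1 + norm (frequency \<xi>)"
      by (rule power2_le_imp_le) (auto simp: sobolev_weight_sq power2_sum)
    also have "norm (frequency \<xi>) \<le> (\<Sum>j\<in>UNIV. \<bar>real_of_int (\<xi> $ j)\<bar>)"
      using norm_le_l1_cart[of "frequency \<xi>"] by simp
    finally have "\<rho> \<xi> ^ m * (\<rho> \<xi> * ?f) \<le> \<rho> \<xi> ^ m * ((1 + (\<Sum>j\<in>UNIV. \<bar>real_of_int (\<xi> $ j)\<bar>)) * ?f)"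
      by (intro mult_left_mono mult_right_mono) auto
    also have "\<dots> = \<rho> \<xi> ^ m * ?f + (\<Sum>j\<in>UNIV. \<rho> \<xi> ^ m * (\<bar>real_of_int (\<xi> $ j)\<bar> * ?f))"
      by (simp add: distrib_right distrib_left sum_distrib_right sum_distrib_left)
    also have "\<dots> \<le> C + (\<Sum>j\<in>UNIV. D j)"
    proof (intro add_mono C sum_mono)
      fix j
      have "1 * (\<bar>real_of_int (\<xi> $ j)\<bar> * ?f) \<le> (2 * pi) * (\<bar>real_of_int (\<xi> $ j)\<bar> * ?f)"
        using pi_gt3 by (intro mult_right_mono) auto
      then have "\<bar>real_of_int (\<xi> $ j)\<bar> * ?f \<le> cmod (fourier_coeff (regular_dist (partial_deriv j \<phi>)) \<xi>)"
        by (simp add: fourier_coeff_partial_deriv[OF Suc.prems] norm_mult mult.assoc)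
      then have "\<rho> \<xi> ^ m * (\<bar>real_of_int (\<xi> $ j)\<bar> * ?f)
          \<le> \<rho> \<xi> ^ m * cmod (fourier_coeff (regular_dist (partial_deriv j \<phi>)) \<xi>)"
        by (intro mult_left_mono) auto
      then show "\<rho> \<xi> ^ m * (\<bar>real_of_int (\<xi> $ j)\<bar> * ?f) \<le> D j"
        using D[of \<xi> j] by (rule order_trans)
    qed
    finally show ?thesis by (simp add: mult_ac)
  qed
  then show ?case by blast
qed

text \<open>Four extra powers of decay dominate the summable power -7/2 of the weight.\<close>

lemma rapid_if_decay:
  fixes c :: "int^'n::finite \<Rightarrow> complex"
  assumes dim: "CARD('n) \<le> 3" and d: "\<And>m. \<exists>C. \<forall>\<xi>. \<rho> \<xi> ^ m * cmod (c \<xi>) \<le> C"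
  shows "rapid c"
  unfolding rapid_def
proof
  fix m
  obtain C where C: "\<And>\<xi>. \<rho> \<xi> ^ (m + 4) * cmod (c \<xi>) \<le> C" using d by blast
  show "(\<lambda>\<xi>. \<rho> \<xi> ^ m * cmod (c \<xi>)) summable_on UNIV"
  proof (rule summable_on_comparison_test)
    show "(\<lambda>\<xi>::int^'n. C * \<rho> \<xi> powr (-(7/2))) summable_on UNIV"
      by (intro summable_on_cmult_right summable_weight dim)
    fix \<xi>
    have C0: "0 \<le> C" by (rule order_trans[OF _ C[of 0]]) simp
    have "\<rho> \<xi> ^ m * cmod (c \<xi>) = \<rho> \<xi> ^ (m + 4) * cmod (c \<xi>) * \<rho> \<xi> powr (-4)"
      using powr_realpow[of "\<rho> \<xi>" 4] by (simp add: powr_minus power_add)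
    also have "\<dots> \<le> C * \<rho> \<xi> powr (-(7/2))"
      by (intro mult_mono C powr_mono C0) auto
    finally show "\<rho> \<xi> ^ m * cmod (c \<xi>) \<le> C * \<rho> \<xi> powr (-(7/2))" .
  qed auto
qed

lemma rapid_fourier_coeff:
  fixes \<phi> :: "real^'n::finite \<Rightarrow> real"
  assumes "CARD('n) \<le> 3" "\<phi> \<in> smooth_periodic"
  shows "rapid (fourier_coeff (regular_dist \<phi>))"
  by (rule rapid_if_decay[OF assms(1)]) (rule fourier_coeff_decay[OF assms(2)])

section \<open>Uniqueness of Fourier coefficients\<close>


text \<open>For \<xi>_j \<noteq> 0 sine and cosine are, up to a non-zero factor, j-th derivatives of
  each other, and derivatives of smooth periodic functions integrate to 0.\<close>

lemma integral_wave: "(\<integral>x. wave \<xi> x \<partial>torus_measure) = (if \<xi> = 0 then 1 else 0)"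
proof (cases "\<xi> = 0")
  case False
  then obtain j where j: "\<xi> $ j \<noteq> 0" by (auto simp: vec_eq_iff)
  have i: "integrable torus_measure (wave \<xi>)"
    by (rule integrable_continuous_torus[OF continuous_on_wave])
  have ibp: "(\<integral>x. partial_deriv j \<phi> x \<partial>torus_measure)
      = 0" if \<phi>: "\<phi> \<in> smooth_periodic" for \<phi> :: "real^'a \<Rightarrow> real"
    by (intro torus_integral_partial_deriv smooth_periodicD[OF \<phi>] smooth_periodicD[OF
        smooth_periodic_partial_deriv[OF \<phi>]])
  have c: "(\<integral>x. cos (2 * pi * (x \<bullet> frequency \<xi>)) \<partial>torus_measure) = 0"
    using ibp[OF sin_smooth_periodic[of \<xi>]] j by (simp add: partial_deriv_sin)
  have s: "(\<integral>x. sin (2 * pi * (x \<bullet> frequency \<xi>)) \<partial>torus_measure) = 0"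
    using ibp[OF cos_smooth_periodic[of \<xi>]] j by (simp add: partial_deriv_cos)
  show ?thesis
    unfolding complex_eq_iff integral_Re[OF i, symmetric] integral_Im[OF i, symmetric]
    using False c s by (simp add: wave_def)
next
  case True
  have "(\<integral>x. 1 \<partial>(torus_measure :: (real^'a) measure)) = (1::complex)"
    by (subst lebesgue_integral_const) (simp only: measure_torus scaleR_one)
  then show ?thesis using True by (simp add: fun_eq_iff[of "wave 0"])
qed

lemma hermitian_synth_complex:
  assumes c: "rapid c" and h: "\<And>\<xi>. c (- \<xi>) = cnj (c \<xi>)"
  shows "complex_of_real (synth c x) = (\<Sum>\<^sub>\<infinity>\<xi>. c \<xi> * wave \<xi> x)"
proof -
  have bij: "bij_betw uminus UNIV (UNIV :: (int^'a) set)"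
    by (rule bij_betw_byWitness[where f' = uminus]) auto
  have "cnj (\<Sum>\<^sub>\<infinity>\<xi>. c \<xi> * wave \<xi> x) = (\<Sum>\<^sub>\<infinity>\<xi>. c (- \<xi>) * wave (- \<xi>) x)"
    by (simp add: h wave_uminus flip: infsum_cnj)
  also have "\<dots> = (\<Sum>\<^sub>\<infinity>\<xi>. c \<xi> * wave \<xi> x)"
    using infsum_reindex_bij_betw[OF bij, of "\<lambda>\<xi>. c \<xi> * wave \<xi> x"] by simp
  finally have "(\<Sum>\<^sub>\<infinity>\<xi>. c \<xi> * wave \<xi> x) \<in> \<real>" by (simp add: Reals_cnj_iff)
  then show ?thesis by (simp add: synth_def)
qed

lemma integral_trig_sum_wave:
  assumes "finite A"
  shows "(\<integral>x. (\<Sum>\<eta>\<in>A. c \<eta> * wave \<eta> x) * cnj (wave \<xi> x) \<partial>torus_measure) = (if \<xi> \<in> A then c \<xi> else 0)"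
proof -
  have "(\<integral>x. (\<Sum>\<eta>\<in>A. c \<eta> * wave \<eta> x) * cnj (wave \<xi> x) \<partial>torus_measure)
      = (\<integral>x. (\<Sum>\<eta>\<in>A. c \<eta> * wave (\<eta> - \<xi>) x) \<partial>torus_measure)"
    by (intro Bochner_Integration.integral_cong refl)
      (simp add: sum_distrib_right wave_uminus[symmetric] mult.assoc wave_add[symmetric])
  also have "\<dots> = (\<Sum>\<eta>\<in>A. c \<eta> * (\<integral>x. wave (\<eta> - \<xi>) x \<partial>torus_measure))"
    by (subst Bochner_Integration.integral_sum)
      (auto intro!: integrable_continuous_torus continuous_on_mult continuous_on_const
          continuous_on_wave)
  also have "\<dots> = (\<Sum>\<eta>\<in>A. if \<eta> = \<xi> then c \<eta> else 0)"
    by (intro sum.cong refl) (simp add: integral_wave)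
  also have "\<dots> = (if \<xi> \<in> A then c \<xi> else 0)" using assms by simp
  finally show ?thesis .
qed

text \<open>The partial sums are dominated by the l^1 norm of c, so integration against a wave is
  termwise; hermitian symmetry makes \<open>synth\<close> the full complex sum.\<close>

lemma fourier_coeff_synth:
  assumes c: "rapid c" and h: "\<And>\<xi>. c (- \<xi>) = cnj (c \<xi>)"
  shows "fourier_coeff (regular_dist (synth c)) \<xi> = c \<xi>"
proof -
  define B where "B = (\<Sum>\<^sub>\<infinity>\<xi>. cmod (c \<xi>))"
  have i: "integrable torus_measure (synth c)" by (rule integrable_smooth[OF synth_smooth_periodic[OF
      c]])
  have "(\<lambda>N. \<integral>x. (\<Sum>\<eta>\<in>freq_box N. c \<eta> * wave \<eta> x) * cnj (wave \<xi> x) \<partial>torus_measure)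
     \<longlonglongrightarrow> (\<integral>x. complex_of_real (synth c x) * cnj (wave \<xi> x) \<partial>torus_measure)"
  proof (rule integral_dominated_convergence[where w = "\<lambda>_. B"])
    show "(\<lambda>x. complex_of_real (synth c x) * cnj (wave \<xi> x)) \<in> borel_measurable torus_measure"
      by (intro borel_measurable_integrable integrable_mult_wave) (use i in simp)
    show "(\<lambda>x. (\<Sum>\<eta>\<in>freq_box N. c \<eta> * wave \<eta> x) * cnj (wave \<xi> x)) \<in> borel_measurable torus_measure" for N
      by (intro measurable_continuous_torus continuous_intros continuous_on_wave)
    show "AE x in torus_measure. (\<lambda>N. (\<Sum>\<eta>\<in>freq_box N. c \<eta> * wave \<eta> x) * cnj (wave \<xi> x))
        \<longlonglongrightarrow> complex_of_real (synth c x) * cnj (wave \<xi> x)"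
      unfolding hermitian_synth_complex[OF assms]
      by (intro AE_I2 tendsto_intros sum_freq_box_tendsto rapid_wave_summable c)
    show "AE x in torus_measure. norm ((\<Sum>\<eta>\<in>freq_box N. c \<eta> * wave \<eta> x) * cnj (wave \<xi> x)) \<le> B" for N
    proof (rule AE_I2)
      fix x
      have "cmod (\<Sum>\<eta>\<in>freq_box N. c \<eta> * wave \<eta> x) \<le> (\<Sum>\<eta>\<in>freq_box N. cmod (c \<eta>))"
        by (rule sum_norm_le) (simp add: norm_mult)
      also have "\<dots> \<le> B"
        unfolding B_def by (rule finite_sum_le_infsum[OF rapid_abs_summable[OF c]]) auto
      finally show "norm ((\<Sum>\<eta>\<in>freq_box N. c \<eta> * wave \<eta> x) * cnj (wave \<xi> x)) \<le> B" by (simp add: norm_mult)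
    qed
  qed simp
  moreover have "(\<lambda>N. if \<xi> \<in> freq_box N then c \<xi> else 0) \<longlonglongrightarrow> c \<xi>"
    by (rule freq_box_truncation_tendsto)
  ultimately show ?thesis
    unfolding fourier_coeff_regular_dist[OF i] by (simp add: integral_trig_sum_wave LIMSEQ_unique)
qed

text \<open>Only linear operations are constructors. Closure under products is derived from the
  product formulas for sine and cosine, which keeps inductions over this set linear.\<close>

inductive_set trig_poly :: "(real^'n::finite \<Rightarrow> real) set" where
  trig_cos: "(\<lambda>x. cos (2 * pi * (x \<bullet> frequency \<xi>))) \<in> trig_poly"
| trig_sin: "(\<lambda>x. sin (2 * pi * (x \<bullet> frequency \<xi>))) \<in> trig_poly"
| trig_add: "p \<in> trig_poly \<Longrightarrow> q \<in> trig_poly \<Longrightarrow> (\<lambda>x. p x + q x) \<in> trig_poly"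
| trig_scale: "p \<in> trig_poly \<Longrightarrow> (\<lambda>x. b * p x) \<in> trig_poly"

lemma trig_diff:
  assumes "p \<in> trig_poly" "q \<in> trig_poly" shows "(\<lambda>x. p x - q x) \<in> trig_poly"
  using trig_add[OF assms(1) trig_scale[OF assms(2), of "-1"]] by simp

lemma trig_half: "p \<in> trig_poly \<Longrightarrow> (\<lambda>x. p x / 2) \<in> trig_poly"
  using trig_scale[of p "1/2"] by simp

lemma trig_const: "(\<lambda>x. b) \<in> trig_poly"
  using trig_scale[OF trig_cos[of 0], of b] by simp

lemma phase_add: "2 * pi * (x \<bullet> frequency (\<xi> + \<eta>)) = 2 * pi * (x \<bullet> frequency \<xi>)
    + 2 * pi * (x \<bullet> frequency \<eta>)"
  by (simp add: frequency_add inner_add_right distrib_left)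

lemma phase_diff: "2 * pi * (x \<bullet> frequency (\<xi> - \<eta>))
    = 2 * pi * (x \<bullet> frequency \<xi>) - 2 * pi * (x \<bullet> frequency \<eta>)"
  by (simp add: frequency_diff inner_diff_right right_diff_distrib)

lemma trig_mult_base:
  assumes "q \<in> trig_poly"
  shows "(\<lambda>x. cos (2 * pi * (x \<bullet> frequency \<xi>)) * q x) \<in> trig_poly"
    and "(\<lambda>x. sin (2 * pi * (x \<bullet> frequency \<xi>)) * q x) \<in> trig_poly"
proof -
  have "(\<lambda>x. cos (2 * pi * (x \<bullet> frequency \<xi>)) * q x)
      \<in> trig_poly \<and> (\<lambda>x. sin (2 * pi * (x \<bullet> frequency \<xi>)) * q x) \<in> trig_poly"
    using assms
  proof induction
    case (trig_cos \<eta>)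
    have "(\<lambda>x. (cos (2 * pi * (x \<bullet> frequency (\<xi> - \<eta>))) + cos (2 * pi * (x \<bullet> frequency (\<xi> + \<eta>)))) / 2)
        \<in> trig_poly"
      "(\<lambda>x. (sin (2 * pi * (x \<bullet> frequency (\<xi> + \<eta>))) + sin (2 * pi * (x \<bullet> frequency (\<xi> - \<eta>)))) / 2)
          \<in> trig_poly"
      by (intro trig_half trig_add trig_poly.trig_cos trig_poly.trig_sin)+
    then show ?case by (simp only: cos_times_cos sin_times_cos phase_add phase_diff simp_thms)
  next
    case (trig_sin \<eta>)
    have "(\<lambda>x. (sin (2 * pi * (x \<bullet> frequency (\<xi> + \<eta>))) - sin (2 * pi * (x \<bullet> frequency (\<xi> - \<eta>)))) / 2)
        \<in> trig_poly"
      "(\<lambda>x. (cos (2 * pi * (x \<bullet> frequency (\<xi> - \<eta>))) - cos (2 * pi * (x \<bullet> frequency (\<xi> + \<eta>)))) / 2)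
          \<in> trig_poly"
      by (intro trig_half trig_diff trig_poly.trig_cos trig_poly.trig_sin)+
    then show ?case by (simp only: cos_times_sin sin_times_sin phase_add phase_diff simp_thms)
  next
    case (trig_add p q)
    then show ?case by (simp add: distrib_left trig_poly.trig_add)
  next
    case (trig_scale p b)
    from trig_poly.trig_scale[OF conjunct1[OF trig_scale.IH], of b] trig_poly.trig_scale[OF conjunct2[OF
        trig_scale.IH], of b]
    show ?case by (simp add: mult.left_commute)
  qed
  then show "(\<lambda>x. cos (2 * pi * (x \<bullet> frequency \<xi>)) * q x) \<in> trig_poly"
    and "(\<lambda>x. sin (2 * pi * (x \<bullet> frequency \<xi>)) * q x) \<in> trig_poly" by auto
qed

lemma trig_mult:
  assumes "p \<in> trig_poly" "q \<in> trig_poly" shows "(\<lambda>x. p x * q x) \<in> trig_poly"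
  using assms(1)
proof induction
  case (trig_add p r)
  then show ?case by (simp add: distrib_right trig_poly.trig_add)
next
  case (trig_scale p b)
  then show ?case using trig_poly.trig_scale[OF trig_scale.IH, of b] by (simp add: mult.assoc)
qed (intro trig_mult_base assms)+

text \<open>Identifies the torus with a compact set of points in C^n on which the coordinates
  separate points, as Stone-Weierstrass requires; the fibres are the orbits of integer
  translations.\<close>

definition torus_embed :: "real^'n \<Rightarrow> complex^'n"
  where "torus_embed x = (\<chi> i. cis (2 * pi * (x $ i)))"

lemma torus_embed_eq:
  fixes D :: "real^'n::finite \<Rightarrow> real"
  assumes "periodic D" "torus_embed x = torus_embed y"
  shows "D x = D y"
proof -
  have "\<exists>n::int. x $ i = y $ i + n" for i
  proof -
    have "cis (2 * pi * (x $ i)) = cis (2 * pi * (y $ i))"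
      using assms(2) by (simp add: torus_embed_def vec_eq_iff)
    then obtain n :: int where "2 * pi * (x $ i) = 2 * pi * (y $ i) + 2 * pi * n"
      using sin_cos_eq_iff[of "2 * pi * (x $ i)" "2 * pi * (y $ i)"] by (auto simp: complex_eq_iff)
    then have "2 * pi * (x $ i) = 2 * pi * (y $ i + n)" by (simp add: distrib_left)
    then show ?thesis by (intro exI[of _ n]) simp
  qed
  then obtain n :: "'n \<Rightarrow> int" where "\<And>i. x $ i = y $ i + n i" by metis
  then have "x = y + frequency (\<chi> i. n i)" by (simp add: vec_eq_iff)
  then show ?thesis using periodic_int_shift[OF assms(1)] by simp
qed

lemma torus_embed_rep: "torus_embed (torus_rep x) = torus_embed x"
proof -
  have "cis (2 * pi * frac (x $ i)) = cis (2 * pi * (x $ i))" for i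
  proof -
    have "2 * pi * (x $ i) = 2 * pi * frac (x $ i) + 2 * pi * of_int \<lfloor>x $ i\<rfloor>"
      by (simp add: frac_def algebra_simps)
    then have "cis (2 * pi * (x $ i)) = cis (2 * pi * frac (x $ i)) * cis (2 * pi * of_int \<lfloor>x $ i\<rfloor>)"
      by (simp only: cis_mult)
    also have "cis (2 * pi * of_int \<lfloor>x $ i\<rfloor>) = 1" by (rule cis_multiple_2pi) simp
    finally show ?thesis by simp
  qed
  then show ?thesis by (simp add: torus_embed_def torus_rep_def)
qed

text \<open>Stone-Weierstrass on the image of the torus in a product of circles.\<close>

lemma trig_poly_dense:
  fixes D :: "real^'n::finite \<Rightarrow> real"
  assumes cont: "continuous_on UNIV D" and per: "periodic D" and e: "e > 0"
  obtains p where "p \<in> trig_poly" "\<And>x. \<bar>D x - p x\<bar> < e"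
proof -
  let ?Q = "cbox 0 (\<Sum>Basis) :: (real^'n) set" and ?E = "torus_embed :: real^'n \<Rightarrow> complex^'n"
  define S where "S = ?E ` ?Q"
  have contE: "continuous_on A ?E" for A
    unfolding torus_embed_def by (intro continuous_intros)
  have compS: "compact S" unfolding S_def by (intro compact_continuous_image contE compact_cbox)
  have ES: "?E x \<in> S" for x
    unfolding S_def using torus_embed_rep[of x] torus_rep(1)[of x] torus_subset_cbox
        by (metis imageI subsetD)
  \<comment> \<open>\<open>D\<close> pushed down to the image; by periodicity the choice of the
    preimage is immaterial.\<close>
  define D' where "D' z = D (SOME x. ?E x = z)" for z
  have D'E: "D' (?E x) = D x" for x
    unfolding D'_def by (rule torus_embed_eq[OF per]) (rule someI[of "\<lambda>y. ?E y = ?E x" x], simp)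
  \<comment> \<open>A quotient argument: within \<open>S\<close>, the preimage of a closed set under
    \<open>D'\<close> is the image of a compact part of the cube, hence closed.\<close>
  have contD': "continuous_on S D'"
    unfolding continuous_on_closed_invariant
  proof (intro allI impI)
    fix B :: "real set" assume B: "closed B"
    have "closed (D -` B)"
      by (rule continuous_closed_vimage[OF B]) (use cont in \<open>simp add: continuous_on_eq_continuous_at\<close>)
    then have "compact (D -` B \<inter> ?Q)" by (rule closed_Int_compact) (rule compact_cbox)
    then have "closed (?E ` (D -` B \<inter> ?Q))"
      by (intro compact_imp_closed compact_continuous_image contE)
    moreover have "?E ` (D -` B \<inter> ?Q) \<inter> S = D' -` B \<inter> S"
      unfolding S_def using D'E by auto
    ultimately show "\<exists>A. closed A \<and> A \<inter> S = D' -` B \<inter> S" by blast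
  qed
  \<comment> \<open>Continuous functions on the image whose pullback is a trigonometric polynomial;
    the real and imaginary parts of the coordinates are among them.\<close>
  define R where "R = {P :: complex^'n \<Rightarrow> real. continuous_on S P \<and> (\<lambda>x. P (?E x)) \<in> trig_poly}"
  have fr: "x \<bullet> frequency (axis i 1) = x $ i" for x :: "real^'n" and i
  proof -
    have "frequency (axis i 1) = (axis i 1 :: real^'n)" by (simp add: vec_eq_iff axis_def)
    then show ?thesis by (simp add: inner_axis)
  qed
  have Rcos: "(\<lambda>z. Re (z $ i)) \<in> R" and Rsin: "(\<lambda>z. Im (z $ i)) \<in> R" for i
    using trig_cos[of "axis i 1"] trig_sin[of "axis i 1"] unfolding fr
    by (auto simp: R_def torus_embed_def intro!: continuous_intros)
  interpret function_ring_on R S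
  proof
    show "compact S" by (rule compS)
    show "\<exists>f\<in>R. f x \<noteq> f y" if "x \<noteq> y" for x y
    proof -
      obtain i where "x $ i \<noteq> y $ i" using \<open>x \<noteq> y\<close> by (auto simp: vec_eq_iff)
      then have "Re (x $ i) \<noteq> Re (y $ i) \<or> Im (x $ i) \<noteq> Im (y $ i)" by (auto simp: complex_eq_iff)
      then show ?thesis
      proof
        assume "Re (x $ i) \<noteq> Re (y $ i)"
        then show ?thesis by (rule bexI[OF _ Rcos])
      next
        assume "Im (x $ i) \<noteq> Im (y $ i)"
        then show ?thesis by (rule bexI[OF _ Rsin])
      qed
    qed
  qed (auto simp: R_def trig_const intro!: continuous_intros trig_add trig_mult)
  obtain P where P: "P \<in> R" "\<And>z. z \<in> S \<Longrightarrow> \<bar>D' z - P z\<bar> < e"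
    using Stone_Weierstrass_basic[OF contD' e] by blast
  show ?thesis
  proof (rule that)
    show "(\<lambda>x. P (?E x)) \<in> trig_poly" using P(1) by (simp add: R_def)
    show "\<bar>D x - P (?E x)\<bar> < e" for x using P(2)[OF ES[of x]] by (simp add: D'E)
  qed
qed

lemma trig_poly_continuous: "p \<in> trig_poly \<Longrightarrow> continuous_on A p"
  by (induction rule: trig_poly.induct) (auto intro!: continuous_intros)

text \<open>\<open>D\<close> is orthogonal to all trigonometric polynomials, hence by density to
  itself, and a continuous function whose square has integral 0 vanishes.\<close>

lemma continuous_fourier_unique:
  fixes D :: "real^'n::finite \<Rightarrow> real"
  assumes cont: "continuous_on UNIV D" and per: "periodic D"
    and zero: "\<And>\<xi>. fourier_coeff (regular_dist D) \<xi> = 0"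
  shows "D x = 0"
proof -
  have c: "(\<integral>x. D x * cos (2 * pi * (x \<bullet> frequency \<xi>)) \<partial>torus_measure) = 0"
    and s: "(\<integral>x. D x * sin (2 * pi * (x \<bullet> frequency \<xi>)) \<partial>torus_measure) = 0" for \<xi>
    using zero[of \<xi>] by (auto simp: fourier_coeff_def regular_dist_torus complex_eq_iff)
  have i: "integrable torus_measure (\<lambda>x. D x * q x)" if "continuous_on UNIV q" for q
    by (intro integrable_continuous_torus continuous_intros cont that)
  have p0: "(\<integral>x. D x * p x \<partial>torus_measure) = 0" if "p \<in> trig_poly" for p
    using that
  proof induction
    case (trig_add p q)
    then show ?case
      using i[OF trig_poly_continuous[OF trig_add(1)]] i[OF trig_poly_continuous[OF trig_add(2)]]
          by (simp add: distrib_left)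
  next
    case (trig_scale p b)
    then show ?case by (simp add: mult.left_commute)
  qed (use c s in auto)
  obtain B where B: "0 \<le> B" "\<And>x. \<bar>D x\<bar> \<le> B" using periodic_bounded[OF cont per] by blast
  have "(\<integral>x. D x * D x \<partial>torus_measure) \<le> e" if e: "e > 0" for e
  proof -
    have e': "e / (B + 1) > 0" using e B(1) by simp
    obtain p where p: "p \<in> trig_poly" "\<And>x. \<bar>D x - p x\<bar> < e / (B + 1)"
      using trig_poly_dense[OF cont per e'] by blast
    have ip: "integrable torus_measure (\<lambda>x. D x * p x)" by (rule i[OF trig_poly_continuous[OF p(1)]])
    have "(\<integral>x. D x * D x \<partial>torus_measure) = (\<integral>x. D x * D x - D x * p x \<partial>torus_measure)"
      using ip i[OF cont] p0[OF p(1)] by simp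
    also have "\<dots> \<le> (\<integral>x. e \<partial>(torus_measure :: (real^'n) measure))"
    proof (rule integral_mono)
      show "integrable torus_measure (\<lambda>x. D x * D x - D x * p x)" using ip i[OF cont] by simp
      show "integrable torus_measure (\<lambda>x :: real^'n. e)" by simp
      fix x
      have "D x * D x - D x * p x \<le> \<bar>D x\<bar> * \<bar>D x - p x\<bar>"
        by (metis abs_ge_self abs_mult right_diff_distrib)
      also have "\<dots> \<le> (B + 1) * (e / (B + 1))"
        using B(2)[of x] less_imp_le[OF p(2)[of x]] B(1) by (intro mult_mono) auto
      also have "\<dots> = e" using B(1) by simp
      finally show "D x * D x - D x * p x \<le> e" .
    qed
    also have "\<dots> = e" by (subst lebesgue_integral_const) (simp only: measure_torus scaleR_one)
    finally show ?thesis .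
  qed
  then have "(\<integral>x. D x * D x \<partial>torus_measure) \<le> 0" by (meson dense not_le)
  moreover have "0 \<le> (\<integral>x. D x * D x \<partial>torus_measure)" by simp
  ultimately have z: "(\<integral>x. D x * D x \<partial>torus_measure) = 0" by linarith
  have cDD: "continuous_on A (\<lambda>x. D x * D x)" for A
    by (intro continuous_intros continuous_on_subset[OF cont]) auto
  \<comment> \<open>The criterion for a vanishing integral concerns closed boxes, so the half-open
    cube is replaced by its closure, from which it differs by part of the boundary.\<close>
  have "set_lebesgue_integral lborel torus (\<lambda>x. D x * D x) = integral torus (\<lambda>x. D x * D x)"
    by (rule set_borel_integral_eq_integral(2)) (simp only: integrable_torus_iff i[OF cont])
  then have "integral torus (\<lambda>x. D x * D x) = 0" using z by (simp only: set_integral_torus)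
  moreover have "integral torus (\<lambda>x. D x * D x) = integral (cbox 0 (\<Sum>Basis)) (\<lambda>x. D x * D x)"
  proof (rule integral_subset_negligible)
    have "cbox 0 (\<Sum>Basis) - torus \<subseteq> cbox 0 (\<Sum>Basis) - (box 0 (\<Sum>Basis) :: (real^'n) set)"
      using box_subset_torus by blast
    then show "negligible (cbox 0 (\<Sum>Basis) - (torus :: (real^'n) set))"
      using negligible_frontier_interval negligible_subset by blast
  qed (rule torus_subset_cbox)
  ultimately have "integral (cbox 0 (\<Sum>Basis)) (\<lambda>x. D x * D x) = 0" by simp
  then have "D (torus_rep x) * D (torus_rep x) = 0"
    using integral_cbox_eq_0_iff[OF cDD, of 0 "\<Sum>Basis"] torus_rep(1)[of x] torus_subset_cbox
        by (auto simp: box_ne_empty)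
  then show ?thesis using periodic_torus_rep[OF per] by simp
qed

text \<open>Rapid decay makes the series converge to a smooth function; it has the same coefficients
  as \<phi>, so uniqueness for continuous functions applies to the difference.\<close>

lemma smooth_eq_synth:
  fixes \<phi> :: "real^'n::finite \<Rightarrow> real"
  assumes dim: "CARD('n) \<le> 3" and \<phi>: "\<phi> \<in> smooth_periodic"
  shows "\<phi> = synth (fourier_coeff (regular_dist \<phi>))"
proof
  fix x
  let ?c = "fourier_coeff (regular_dist \<phi>)"
  have r: "rapid ?c" by (rule rapid_fourier_coeff[OF dim \<phi>])
  have h: "?c (- \<xi>) = cnj (?c \<xi>)" for \<xi>
    by (rule hermitian_fourier_coeff[OF regular_dist_periodic_distribution[OF integrable_smooth[OF \<phi>]]])
  note S = synth_smooth_periodic[OF r]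
  have "\<phi> x - synth ?c x = 0"
  proof (rule continuous_fourier_unique)
    show "continuous_on UNIV (\<lambda>x. \<phi> x - synth ?c x)"
      by (intro continuous_intros smooth_periodicD[OF \<phi>] smooth_periodicD[OF S])
    show "periodic (\<lambda>x. \<phi> x - synth ?c x)"
      using smooth_periodicD(2)[OF \<phi>] smooth_periodicD(2)[OF S] by (simp add: periodic_def)
    fix \<xi>
    have i: "integrable torus_measure (\<lambda>x. complex_of_real (\<phi> x) * cnj (wave \<xi> x))"
        "integrable torus_measure (\<lambda>x. complex_of_real (synth ?c x) * cnj (wave \<xi> x))"
      using integrable_smooth[OF \<phi>] integrable_smooth[OF S] by (auto intro!: integrable_mult_wave)
    have "fourier_coeff (regular_dist (\<lambda>x. \<phi> x - synth ?c x)) \<xi>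
        = ?c \<xi> - fourier_coeff (regular_dist (synth ?c)) \<xi>"
      using integrable_smooth[OF \<phi>] integrable_smooth[OF S] i
      by (simp add: fourier_coeff_regular_dist left_diff_distrib)
    then show "fourier_coeff (regular_dist (\<lambda>x. \<phi> x - synth ?c x)) \<xi> = 0"
      by (simp add: fourier_coeff_synth[OF r h])
  qed
  then show "\<phi> x = synth ?c x" by simp
qed

text \<open>Finite real form of Parseval's pairing: the real part of c times a wave is Re c times
  the cosine minus Im c times the sine, and g maps this to
  \<open>Re (c * cnj (fourier_coeff g))\<close> at that frequency.\<close>

lemma distribution_synth_truncation:
  assumes g: "g \<in> periodic_distributions" and A: "finite A"
  shows "g (synth (\<lambda>\<xi>. if \<xi> \<in> A then c \<xi> else 0)) = (\<Sum>\<xi>\<in>A. Re (c \<xi> * cnj (fourier_coeff g \<xi>)))"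
  using A
proof (induction A rule: finite_induct)
  case empty
  have z: "synth (\<lambda>\<xi>. 0) = (\<lambda>x. 0)" by (simp add: fun_eq_iff synth_def)
  have "synth (\<lambda>\<xi>. 0) \<in> smooth_periodic" by (rule synth_smooth_periodic) (simp add: rapid_def)
  then have "g (synth (\<lambda>\<xi>. 0)) = 0" using distribution_scale[OF g, of "synth (\<lambda>\<xi>. 0)" 0] by (simp add: z)
  then show ?case by simp
next
  case (insert \<eta> A)
  let ?T = "synth (\<lambda>\<xi>. if \<xi> \<in> A then c \<xi> else 0)"
  let ?C = "\<lambda>x. cos (2 * pi * (x \<bullet> frequency \<eta>))" and ?S = "\<lambda>x. sin (2 * pi * (x \<bullet> frequency \<eta>))"
  have sp: "?T \<in> smooth_periodic" "synth (single_freq \<eta> (c \<eta>)) \<in> smooth_periodic"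
    by (auto intro!: synth_smooth_periodic rapid_single_freq rapid_finite_support[OF insert(1)])
  have "synth (\<lambda>\<xi>. if \<xi> \<in> insert \<eta> A then c \<xi> else 0) x
      = 1 * ?T x + 1 * synth (single_freq \<eta> (c \<eta>)) x" for x
  proof -
    have "synth (\<lambda>\<xi>. if \<xi> \<in> insert \<eta> A then c \<xi> else 0) x
        = Re (\<Sum>\<xi>\<in>insert \<eta> A. (if \<xi> \<in> insert \<eta> A then c \<xi> else 0) * wave \<xi> x)"
      by (rule synth_finite_support) (use insert in auto)
    also have "\<dots> = Re (c \<eta> * wave \<eta> x) + Re (\<Sum>\<xi>\<in>A. (if \<xi> \<in> A then c \<xi> else 0) * wave \<xi> x)"
      using insert by simp
    also have "Re (\<Sum>\<xi>\<in>A. (if \<xi> \<in> A then c \<xi> else 0) * wave \<xi> x) = ?T x"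
      by (rule synth_finite_support[symmetric]) (use insert in auto)
    finally show ?thesis by (simp add: synth_single_freq)
  qed
  then have eqf: "synth (\<lambda>\<xi>. if \<xi> \<in> insert \<eta> A then c \<xi> else 0)
      = (\<lambda>x. 1 * ?T x + 1 * synth (single_freq \<eta> (c \<eta>)) x)"
    by (rule ext)
  have "g (synth (\<lambda>\<xi>. if \<xi> \<in> insert \<eta> A then c \<xi> else 0)) = g ?T + g (synth (single_freq \<eta> (c \<eta>)))"
    unfolding eqf distribution_lincomb[OF g sp] by simp
  moreover have "synth (single_freq \<eta> (c \<eta>)) = (\<lambda>x. Re (c \<eta>) * ?C x + (- Im (c \<eta>)) * ?S x)"
    by (simp add: fun_eq_iff synth_single_freq wave_def)
  then have "g (synth (single_freq \<eta> (c \<eta>))) = Re (c \<eta>) * g ?C + (- Im (c \<eta>)) * g ?S"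
    using distribution_lincomb[OF g cos_smooth_periodic sin_smooth_periodic, of "Re (c \<eta>)" \<eta> "- Im (c \<eta>)"
        \<eta>] by simp
  then have "g (synth (single_freq \<eta> (c \<eta>))) = Re (c \<eta> * cnj (fourier_coeff g \<eta>))"
    by (simp add: fourier_coeff_def)
  ultimately show ?case using insert by simp
qed

text \<open>Truncated Fourier series of a test function converge to it in the test topology, and on
  them both distributions agree. This turns the identities between distributions below into
  identities between sequences.\<close>

lemma dist_eq_if_fourier_coeff_eq:
  fixes g h :: "('n::finite) functional"
  assumes dim: "CARD('n) \<le> 3" and g: "g \<in> periodic_distributions" and h: "h \<in> periodic_distributions"
    and eq: "\<And>\<xi>. fourier_coeff g \<xi> = fourier_coeff h \<xi>"
  shows "dist_eq g h"
  unfolding dist_eq_def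
proof
  fix \<phi> :: "real^'n \<Rightarrow> real" assume \<phi>: "\<phi> \<in> smooth_periodic"
  define c where "c = fourier_coeff (regular_dist \<phi>)"
  have r: "rapid c" unfolding c_def by (rule rapid_fourier_coeff[OF dim \<phi>])
  have s: "\<phi> = synth c" unfolding c_def by (rule smooth_eq_synth[OF dim \<phi>])
  have lim: "(\<lambda>N. k (synth (\<lambda>\<xi>. if \<xi> \<in> freq_box N then c \<xi> else 0)))
      \<longlonglongrightarrow> k \<phi>" if "k \<in> periodic_distributions" for k
    unfolding s by (rule distribution_tendsto[OF that _ _ synth_truncation_test_tendsto[OF r]])
      (auto intro!: synth_smooth_periodic rapid_restrict r)
  have "(\<lambda>N. g (synth (\<lambda>\<xi>. if \<xi> \<in> freq_box N then c \<xi> else 0))) \<longlonglongrightarrow> h \<phi>"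
    using lim[OF h] by (simp only: distribution_synth_truncation[OF g finite_freq_box]
        distribution_synth_truncation[OF h finite_freq_box] eq)
  then show "g \<phi> = h \<phi>" using lim[OF g] LIMSEQ_unique by blast
qed

section \<open>Square integrable functions and their products\<close>


definition trig_sum :: "(int^'n::finite \<Rightarrow> complex) \<Rightarrow> nat \<Rightarrow> real^'n \<Rightarrow> real"
  where "trig_sum c N x = Re (\<Sum>\<xi>\<in>freq_box N. c \<xi> * wave \<xi> x)"

text \<open>Mean square convergence of continuous approximants to F. Integrability is listed
  explicitly because the integral of a non-integrable function is 0 by default.\<close>

definition L2_limit :: "(real^'n::finite \<Rightarrow> real) \<Rightarrow> (nat \<Rightarrow> real^'n \<Rightarrow> real) \<Rightarrow> bool"
  where "L2_limit F T \<longleftrightarrow> F \<in> borel_measurable torus_measure \<and> integrable torus_measure (\<lambda>x. (F x)\<^sup>2) \<and>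
     (\<forall>N. continuous_on UNIV (T N)) \<and> (\<forall>N. integrable torus_measure (\<lambda>x. (F x - T N x)\<^sup>2)) \<and>
     (\<lambda>N. \<integral>x. (F x - T N x)\<^sup>2 \<partial>torus_measure) \<longlonglongrightarrow> 0"

lemma continuous_trig_sum: "continuous_on A (trig_sum c N)"
  unfolding trig_sum_def by (intro continuous_intros continuous_on_wave)

lemma integral_norm_trig_sum:
  assumes "finite A"
  shows "(\<integral>x. (cmod (\<Sum>\<xi>\<in>A. c \<xi> * wave \<xi> x))\<^sup>2 \<partial>torus_measure) = (\<Sum>\<xi>\<in>A. (cmod (c \<xi>))\<^sup>2)"
proof -
  let ?S = "\<lambda>x. \<Sum>\<xi>\<in>A. c \<xi> * wave \<xi> x"
  have i: "integrable torus_measure (\<lambda>x. ?S x * cnj (wave \<xi> x))" for \<xi>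
    by (intro integrable_mult_wave integrable_continuous_torus continuous_intros continuous_on_wave)
  have "complex_of_real (\<integral>x. (cmod (?S x))\<^sup>2 \<partial>torus_measure) = (\<integral>x. ?S x * cnj (?S x) \<partial>torus_measure)"
    unfolding integral_complex_of_real[symmetric] complex_norm_square ..
  also have "\<dots> = (\<integral>x. (\<Sum>\<xi>\<in>A. cnj (c \<xi>) * (?S x * cnj (wave \<xi> x))) \<partial>torus_measure)"
    by (intro Bochner_Integration.integral_cong refl) (simp add: sum_distrib_left mult_ac)
  also have "\<dots> = (\<Sum>\<xi>\<in>A. cnj (c \<xi>) * (\<integral>x. ?S x * cnj (wave \<xi> x) \<partial>torus_measure))"
    by (subst Bochner_Integration.integral_sum) (use i in auto)
  also have "\<dots> = (\<Sum>\<xi>\<in>A. complex_of_real ((cmod (c \<xi>))\<^sup>2))"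
    unfolding integral_trig_sum_wave[OF assms] by (intro sum.cong refl) (simp only: if_True
        complex_norm_square mult.commute)
  finally have "complex_of_real (\<integral>x. (cmod (?S x))\<^sup>2 \<partial>torus_measure)
      = complex_of_real (\<Sum>\<xi>\<in>A. (cmod (c \<xi>))\<^sup>2)"
    by simp
  then show ?thesis by (simp only: of_real_eq_iff)
qed

lemma trig_sum_diff_le:
  assumes c: "(\<lambda>\<xi>. (cmod (c \<xi>))\<^sup>2) summable_on UNIV" and "M \<le> N"
  shows "(\<integral>x. (trig_sum c N x - trig_sum c M x)\<^sup>2 \<partial>torus_measure)
     \<le> (\<Sum>\<^sub>\<infinity>\<xi>. (cmod (c \<xi>))\<^sup>2) - (\<Sum>\<xi>\<in>freq_box M. (cmod (c \<xi>))\<^sup>2)"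
proof -
  let ?A = "freq_box N - freq_box M :: (int^'a) set"
  have sub: "freq_box M \<subseteq> (freq_box N :: (int^'a) set)" by (rule freq_box_mono[OF assms(2)])
  have eq: "trig_sum c N x - trig_sum c M x = Re (\<Sum>\<xi>\<in>?A. c \<xi> * wave \<xi> x)" for x
    unfolding trig_sum_def by (subst sum_diff) (use sub in auto)
  have "(\<integral>x. (trig_sum c N x - trig_sum c M x)\<^sup>2 \<partial>torus_measure)
      \<le> (\<integral>x. (cmod (\<Sum>\<xi>\<in>?A. c \<xi> * wave \<xi> x))\<^sup>2 \<partial>torus_measure)"
    unfolding eq
  proof (rule integral_mono)
    show "integrable torus_measure (\<lambda>x. (Re (\<Sum>\<xi>\<in>?A. c \<xi> * wave \<xi> x))\<^sup>2)"
      by (intro integrable_continuous_torus continuous_intros continuous_on_wave)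
    show "integrable torus_measure (\<lambda>x. (cmod (\<Sum>\<xi>\<in>?A. c \<xi> * wave \<xi> x))\<^sup>2)"
      by (intro integrable_continuous_torus continuous_intros continuous_on_wave)
    fix x
    show "(Re (\<Sum>\<xi>\<in>?A. c \<xi> * wave \<xi> x))\<^sup>2 \<le> (cmod (\<Sum>\<xi>\<in>?A. c \<xi> * wave \<xi> x))\<^sup>2"
      by (simp add: cmod_power2 del: Re_sum)
  qed
  also have "\<dots> = (\<Sum>\<xi>\<in>?A. (cmod (c \<xi>))\<^sup>2)" by (rule integral_norm_trig_sum) simp
  also have "\<dots> = (\<Sum>\<xi>\<in>freq_box N. (cmod (c \<xi>))\<^sup>2) - (\<Sum>\<xi>\<in>freq_box M. (cmod (c \<xi>))\<^sup>2)"
    by (subst sum_diff) (use sub in auto)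
  also have "(\<Sum>\<xi>\<in>freq_box N. (cmod (c \<xi>))\<^sup>2) \<le> (\<Sum>\<^sub>\<infinity>\<xi>. (cmod (c \<xi>))\<^sup>2)"
    by (rule finite_sum_le_infsum[OF c]) auto
  finally show ?thesis by simp
qed

text \<open>On a space of mass 1 this controls the L^1 norm by the mean square with a free scale d;
  the choice d = e turns a mean square below e^2 into an L^1 norm below e.\<close>

lemma abs_le_square_plus: "\<bar>h\<bar> \<le> (h\<^sup>2 / d + d) / 2" if "d > 0" for h d :: real
proof -
  have "2 * \<bar>h\<bar> * d \<le> \<bar>h\<bar>\<^sup>2 + d\<^sup>2" by (rule sum_squares_bound)
  then show ?thesis using that by (simp add: field_simps power2_eq_square)
qed

text \<open>The partial sums are Cauchy in L^1, a subsequence converges almost everywhere, and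
  Fatou's lemma transfers the mean square tail bound \<tau> to its limit F, now for every partial
  sum and not only along the subsequence.\<close>

lemma riesz_fischer:
  fixes c :: "int^'n::finite \<Rightarrow> complex"
  assumes "sobolev_seq 0 c"
  shows "\<exists>F. L2_limit F (trig_sum c)"
proof -
  let ?T = "trig_sum c"
  have c: "(\<lambda>\<xi>. (cmod (c \<xi>))\<^sup>2) summable_on UNIV" using assms by (simp add: sobolev_seq_0)
  define \<tau> where "\<tau> N = (\<Sum>\<^sub>\<infinity>\<xi>. (cmod (c \<xi>))\<^sup>2) - (\<Sum>\<xi>\<in>freq_box N. (cmod (c \<xi>))\<^sup>2)" for N
  have \<tau>: "\<tau> \<longlonglongrightarrow> 0" unfolding \<tau>_def by (rule truncation_tendsto_0[OF c])
  have diff: "(\<integral>x. (?T N x - ?T M x)\<^sup>2 \<partial>torus_measure) \<le> \<tau> M" if "M \<le> N" for M N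
    unfolding \<tau>_def by (rule trig_sum_diff_le[OF c that])
  have \<tau>0: "0 \<le> \<tau> N" for N using diff[of N N] by simp
  have int: "integrable torus_measure (?T N)" for N
    by (rule integrable_continuous_torus[OF continuous_trig_sum])
  have int2: "integrable torus_measure (\<lambda>x. (?T N x - ?T M x)\<^sup>2)" for N M
    by (intro integrable_continuous_torus continuous_intros continuous_trig_sum)
  have cauchy: "\<exists>N. \<forall>i\<ge>N. \<forall>j\<ge>N. (\<integral>x. norm (?T i x - ?T j x) \<partial>torus_measure) < e" if e: "e > 0" for e
  proof -
    have "\<forall>\<^sub>F N in sequentially. \<tau> N < e\<^sup>2" using order_tendstoD(2)[OF \<tau>] e by simp
    then obtain N where N: "\<And>n. n \<ge> N \<Longrightarrow> \<tau> n < e\<^sup>2" by (auto simp: eventually_sequentially)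
    have main: "(\<integral>x. norm (?T i x - ?T j x) \<partial>torus_measure) < e" if ij: "N \<le> j" "j \<le> i" for i j
    proof -
      have "(\<integral>x. norm (?T i x - ?T j x) \<partial>torus_measure)
          \<le> (\<integral>x. ((?T i x - ?T j x)\<^sup>2 / e + e) / 2 \<partial>torus_measure)"
        by (rule integral_mono) (use int int2 abs_le_square_plus[OF e] in auto)
      also have "\<dots> = ((\<integral>x. (?T i x - ?T j x)\<^sup>2 \<partial>torus_measure) / e
          + (\<integral>x. e \<partial>(torus_measure :: (real^'n) measure))) / 2"
        using int2 by simp
      also have "(\<integral>x. e \<partial>(torus_measure :: (real^'n) measure)) = e"
        by (subst lebesgue_integral_const) (simp only: measure_torus scaleR_one)
      also have "((\<integral>x. (?T i x - ?T j x)\<^sup>2 \<partial>torus_measure) / e + e) / 2 < (e\<^sup>2 / e + e) / 2"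
        using diff[OF ij(2)] N[OF ij(1)] e by (intro divide_strict_right_mono add_strict_right_mono) auto
      also have "\<dots> = e" using e by (simp add: power2_eq_square)
      finally show ?thesis .
    qed
    have "(\<integral>x. norm (?T i x - ?T j x) \<partial>torus_measure) < e" if "N \<le> i" "N \<le> j" for i j
      using main[of j i] main[of i j] that by (cases "j \<le> i") (auto simp: abs_minus_commute)
    then show ?thesis by blast
  qed
  obtain r where r: "strict_mono r" "AE x in torus_measure. Cauchy (\<lambda>i. ?T (r i) x)"
    using cauchy_L1_AE_cauchy_subseq[of torus_measure ?T, OF int cauchy] by blast
  \<comment> \<open>Off the set of convergence, which has full measure, \<open>lim\<close> is an
    arbitrary default value.\<close>
  define F where "F x = lim (\<lambda>i. ?T (r i) x)" for x
  have Tm [measurable]: "?T N \<in> borel_measurable torus_measure" for N using int by auto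
  have Fm [measurable]: "F \<in> borel_measurable torus_measure"
    unfolding F_def by (rule borel_measurable_lim_metric) (rule Tm)
  have lim: "AE x in torus_measure. (\<lambda>i. ?T (r i) x) \<longlonglongrightarrow> F x"
    using r(2) by eventually_elim (simp add: F_def Cauchy_convergent_iff convergent_LIMSEQ_iff)
  have nn: "(\<integral>\<^sup>+x. ennreal ((F x - ?T N x)\<^sup>2) \<partial>torus_measure) \<le> ennreal (\<tau> N)" for N
  proof -
    have "(\<integral>\<^sup>+x. ennreal ((F x - ?T N x)\<^sup>2) \<partial>torus_measure)
       = (\<integral>\<^sup>+x. liminf (\<lambda>i. ennreal ((?T (r i) x - ?T N x)\<^sup>2)) \<partial>torus_measure)"
    proof (rule nn_integral_cong_AE)
      show "AE x in torus_measure. ennreal ((F x - ?T N x)\<^sup>2)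
          = liminf (\<lambda>i. ennreal ((?T (r i) x - ?T N x)\<^sup>2))"
        using lim
      proof eventually_elim
        case (elim x)
        have "(\<lambda>i. ennreal ((?T (r i) x - ?T N x)\<^sup>2)) \<longlonglongrightarrow> ennreal ((F x - ?T N x)\<^sup>2)"
          by (intro tendsto_ennrealI tendsto_intros elim)
        from lim_imp_Liminf[OF _ this] show ?case by simp
      qed
    qed
    also have "\<dots> \<le> liminf (\<lambda>i. \<integral>\<^sup>+x. ennreal ((?T (r i) x - ?T N x)\<^sup>2) \<partial>torus_measure)"
      by (rule nn_integral_liminf) measurable
    also have "\<dots> \<le> liminf (\<lambda>i. ennreal (\<tau> N))"
    proof (rule Liminf_mono)
      show "\<forall>\<^sub>F i in sequentially. (\<integral>\<^sup>+x. ennreal ((?T (r i) x - ?T N x)\<^sup>2) \<partial>torus_measure)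
          \<le> ennreal (\<tau> N)"
        using eventually_ge_at_top[of N]
      proof eventually_elim
        case (elim i)
        then have "N \<le> r i" using seq_suble[OF r(1), of i] by linarith
        have "(\<integral>\<^sup>+x. ennreal ((?T (r i) x - ?T N x)\<^sup>2) \<partial>torus_measure)
            = ennreal (\<integral>x. (?T (r i) x - ?T N x)\<^sup>2 \<partial>torus_measure)"
          by (rule nn_integral_eq_integral[OF int2]) simp
        also have "\<dots> \<le> ennreal (\<tau> N)" by (intro ennreal_leI diff \<open>N \<le> r i\<close>)
        finally show ?case .
      qed
    qed
    also have "\<dots> = ennreal (\<tau> N)" by (simp add: Liminf_const)
    finally show ?thesis .
  qed
  have iF: "integrable torus_measure (\<lambda>x. (F x - ?T N x)\<^sup>2)" for N
    by (rule integrableI_nonneg) (use le_less_trans[OF nn, of N] in auto)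
  have bF: "(\<integral>x. (F x - ?T N x)\<^sup>2 \<partial>torus_measure) \<le> \<tau> N" for N
    using nn[of N] \<tau>0[of N] by (subst (asm) nn_integral_eq_integral[OF iF]) auto
  have "(\<lambda>N. \<integral>x. (F x - ?T N x)\<^sup>2 \<partial>torus_measure) \<longlonglongrightarrow> 0"
    by (rule tendsto_sandwich[OF _ _ tendsto_const \<tau>]) (auto intro!: always_eventually bF)
  moreover have "integrable torus_measure (\<lambda>x. (F x)\<^sup>2)"
  proof (rule Bochner_Integration.integrable_bound)
    show "integrable torus_measure (\<lambda>x. 2 * (F x - ?T 0 x)\<^sup>2 + 2 * (?T 0 x)\<^sup>2)"
      by (intro Bochner_Integration.integrable_add integrable_mult_right iF integrable_continuous_torus
          continuous_intros continuous_trig_sum)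
    show "AE x in torus_measure. norm ((F x)\<^sup>2) \<le> norm (2 * (F x - ?T 0 x)\<^sup>2 + 2 * (?T 0 x)\<^sup>2)"
    proof (rule AE_I2)
      fix x
      have "0 \<le> (F x - 2 * ?T 0 x)\<^sup>2" by simp
      then have "(F x)\<^sup>2 \<le> 2 * (F x - ?T 0 x)\<^sup>2 + 2 * (?T 0 x)\<^sup>2"
          by (simp add: power2_eq_square algebra_simps)
      then show "norm ((F x)\<^sup>2) \<le> norm (2 * (F x - ?T 0 x)\<^sup>2 + 2 * (?T 0 x)\<^sup>2)" by simp
    qed
  qed simp
  ultimately have "L2_limit F ?T"
    unfolding L2_limit_def using iF continuous_trig_sum[of UNIV c] Fm by blast
  then show ?thesis by (rule exI[of _ F])
qed

lemma L2_limit_integrable: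
  assumes "L2_limit F T" shows "integrable torus_measure F"
proof (rule Bochner_Integration.integrable_bound)
  show "integrable torus_measure (\<lambda>x. ((F x)\<^sup>2 / 1 + 1) / 2)" using assms by (simp add: L2_limit_def)
  show "AE x in torus_measure. norm (F x) \<le> norm (((F x)\<^sup>2 / 1 + 1) / 2)"
    using abs_le_square_plus[of 1] by (intro AE_I2) auto
qed (use assms in \<open>simp add: L2_limit_def\<close>)

lemma abs_mult_le_squares: "\<bar>x * y\<bar> \<le> x\<^sup>2 / d + d * y\<^sup>2" if "d > 0" for x y d :: real
proof -
  have "2 * \<bar>x\<bar> * (d * \<bar>y\<bar>) \<le> \<bar>x\<bar>\<^sup>2 + (d * \<bar>y\<bar>)\<^sup>2" by (rule sum_squares_bound)
  then have "2 * (d * \<bar>x * y\<bar>) \<le> x\<^sup>2 + d\<^sup>2 * y\<^sup>2" by (simp add: abs_mult power_mult_distrib mult_ac)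
  then have "d * \<bar>x * y\<bar> \<le> x\<^sup>2 + d\<^sup>2 * y\<^sup>2" using that by (smt (verit) mult_nonneg_nonneg abs_ge_zero)
  then have "d * \<bar>x * y\<bar> / d \<le> (x\<^sup>2 + d\<^sup>2 * y\<^sup>2) / d" using that by (intro divide_right_mono) auto
  then show ?thesis using that by (simp add: power2_eq_square add_divide_distrib)
qed

lemma L2_limit_mult_integrable:
  assumes F: "F \<in> borel_measurable torus_measure" "integrable torus_measure (\<lambda>x. (F x)\<^sup>2)"
    and G: "G \<in> borel_measurable torus_measure" "integrable torus_measure (\<lambda>x. (G x :: real)\<^sup>2)"
  shows "integrable torus_measure (\<lambda>x. F x * G x)"
proof (rule Bochner_Integration.integrable_bound)
  show "integrable torus_measure (\<lambda>x. (F x)\<^sup>2 / 1 + 1 * (G x)\<^sup>2)" using F G by simp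
  show "AE x in torus_measure. norm (F x * G x) \<le> norm ((F x)\<^sup>2 / 1 + 1 * (G x)\<^sup>2)"
    using abs_mult_le_squares[of 1] by (intro AE_I2) (auto intro: order_trans[OF _ abs_ge_self])
qed (use F G in simp)

lemma integral_young_bound:
  fixes p q f g :: "'a \<Rightarrow> real"
  assumes "integrable M p" "integrable M q" "integrable M f" "integrable M g"
  shows "(\<integral>x. (p x + q x) + (q x / d + d * f x) + (p x / d + d * g x) \<partial>M)
    = (1 + 1 / d) * (integral\<^sup>L M p + integral\<^sup>L M q) + d * (integral\<^sup>L M f + integral\<^sup>L M g)"
proof -
  have "(\<integral>x. (p x + q x) + (q x / d + d * f x) + (p x / d + d * g x) \<partial>M)
    = (integral\<^sup>L M p + integral\<^sup>L M q) + (integral\<^sup>L M q / d + d * integral\<^sup>L M f) + (integral\<^sup>L M p / d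
        + d * integral\<^sup>L M g)"
    using assms by simp
  then show ?thesis by (simp add: algebra_simps add_divide_distrib)
qed

text \<open>The difference T S - F G splits into the product of the two errors and two mixed terms.
  Young's inequality puts the large weight 1/d on the errors, which tend to 0, and the small weight
  d on the fixed squares of F and G.\<close>

lemma L2_limit_product:
  assumes F: "L2_limit F T" and G: "L2_limit G S"
  shows "(\<lambda>N. \<integral>x. complex_of_real (T N x * S N x) * cnj (wave \<xi> x) \<partial>torus_measure)
     \<longlonglongrightarrow> (\<integral>x. complex_of_real (F x * G x) * cnj (wave \<xi> x) \<partial>torus_measure)"
proof (rule LIMSEQ_I)
  fix e :: real assume e: "e > 0"
  note F' = F[unfolded L2_limit_def] and G' = G[unfolded L2_limit_def]
  have [measurable]: "F \<in> borel_measurable torus_measure" "G \<in> borel_measurable torus_measure"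
      using F' G' by auto
  have [measurable]: "T N \<in> borel_measurable torus_measure" "S N \<in> borel_measurable torus_measure" for N
    using F' G' by (auto intro: measurable_continuous_torus)
  define I where "I = (\<integral>x. (F x)\<^sup>2 \<partial>torus_measure) + (\<integral>x. (G x)\<^sup>2 \<partial>torus_measure)"
  have I0: "0 \<le> I" by (simp add: I_def)
  \<comment> \<open>Makes d * I at most e / 2; the other half of e is left for the errors.\<close>
  define d where "d = e / (2 * (I + 1))"
  have d: "d > 0" using e I0 by (simp add: d_def)
  define h where "h N = (\<integral>x. (F x - T N x)\<^sup>2 \<partial>torus_measure)
      + (\<integral>x. (G x - S N x)\<^sup>2 \<partial>torus_measure)" for N
  have "(\<lambda>N. (1 + 1 / d) * h N) \<longlonglongrightarrow> (1 + 1 / d) * (0 + 0)"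
    unfolding h_def using F' G' by (intro tendsto_intros) auto
  then have "\<forall>\<^sub>F N in sequentially. (1 + 1 / d) * h N < e / 2"
    using e by (intro order_tendstoD(2)) auto
  then obtain M where M: "\<And>N. N \<ge> M \<Longrightarrow> (1 + 1 / d) * h N < e / 2" by (auto simp: eventually_sequentially)
  have iFG: "integrable torus_measure (\<lambda>x. F x * G x)"
    by (rule L2_limit_mult_integrable) (use F' G' in auto)
  have iTS: "integrable torus_measure (\<lambda>x. T N x * S N x)" for N
    using F' G' by (intro integrable_continuous_torus continuous_intros) auto
  have ip: "integrable torus_measure (\<lambda>x. (F x - T N x)\<^sup>2)"
      and ig: "integrable torus_measure (\<lambda>x. (G x - S N x)\<^sup>2)"
    and iF2: "integrable torus_measure (\<lambda>x. (F x)\<^sup>2)"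
        and iG2: "integrable torus_measure (\<lambda>x. (G x)\<^sup>2)" for N
    using F' G' by blast+
  show "\<exists>no. \<forall>n\<ge>no. norm ((\<integral>x. complex_of_real (T n x * S n x) * cnj (wave \<xi> x) \<partial>torus_measure)
      - (\<integral>x. complex_of_real (F x * G x) * cnj (wave \<xi> x) \<partial>torus_measure)) < e"
  proof (intro exI allI impI)
    fix N assume N: "N \<ge> M"
    have i1: "integrable torus_measure (\<lambda>x. complex_of_real (T N x * S N x) * cnj (wave \<xi> x))"
      "integrable torus_measure (\<lambda>x. complex_of_real (F x * G x) * cnj (wave \<xi> x))"
      using iTS iFG by (intro integrable_mult_wave integrable_of_real; simp)+
    let ?b = "\<lambda>x. ((F x - T N x)\<^sup>2 + (G x - S N x)\<^sup>2) + ((G x - S N x)\<^sup>2 / d + d * (F x)\<^sup>2)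
        + ((F x - T N x)\<^sup>2 / d + d * (G x)\<^sup>2)"
    have eqd: "(\<integral>x. complex_of_real (T N x * S N x) * cnj (wave \<xi> x) \<partial>torus_measure)
        - (\<integral>x. complex_of_real (F x * G x) * cnj (wave \<xi> x) \<partial>torus_measure)
       = (\<integral>x. complex_of_real (T N x * S N x) * cnj (wave \<xi> x)
           - complex_of_real (F x * G x) * cnj (wave \<xi> x) \<partial>torus_measure)"
      by (rule Bochner_Integration.integral_diff[symmetric]) (use i1 in auto)
    have "norm ((\<integral>x. complex_of_real (T N x * S N x) * cnj (wave \<xi> x) \<partial>torus_measure)
        - (\<integral>x. complex_of_real (F x * G x) * cnj (wave \<xi> x) \<partial>torus_measure)) \<le> (\<integral>x. ?b x \<partial>torus_measure)"
      unfolding eqd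
    proof (rule Bochner_Integration.integral_norm_bound_integral)
      show "integrable torus_measure (\<lambda>x. complex_of_real (T N x * S N x) * cnj (wave \<xi> x)
          - complex_of_real (F x * G x) * cnj (wave \<xi> x))"
        by (rule Bochner_Integration.integrable_diff[OF i1])
      show "integrable torus_measure ?b" using F' G' by simp
      fix x
      have "norm (complex_of_real (T N x * S N x) * cnj (wave \<xi> x)
          - complex_of_real (F x * G x) * cnj (wave \<xi> x)) = \<bar>T N x * S N x - F x * G x\<bar>"
        by (simp only: left_diff_distrib[symmetric] norm_mult of_real_diff[symmetric] norm_of_real
            complex_mod_cnj norm_wave mult_1_right)
      also have "T N x * S N x - F x * G x = (F x - T N x) * (G x - S N x) - (G x - S N x) * F x - (F x
          - T N x) * G x"
        by (simp add: algebra_simps)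
      also have "\<bar>\<dots>\<bar> \<le> \<bar>(F x - T N x) * (G x - S N x)\<bar> + \<bar>(G x - S N x) * F x\<bar>
          + \<bar>(F x - T N x) * G x\<bar>" by linarith
      also have "\<dots> \<le> ?b x"
        using abs_mult_le_squares[of 1 "F x - T N x" "G x - S N x"]
            by (intro add_mono abs_mult_le_squares d) auto
      finally show "norm (complex_of_real (T N x * S N x) * cnj (wave \<xi> x)
          - complex_of_real (F x * G x) * cnj (wave \<xi> x)) \<le> ?b x" .
    qed
    also have "\<dots> = (1 + 1 / d) * h N + d * I"
      unfolding h_def I_def by (rule integral_young_bound[OF ip ig iF2 iG2])
    also have "(1 + 1 / d) * h N + d * I \<le> (1 + 1 / d) * h N + e / 2"
    proof -
      have "d * I \<le> d * (I + 1)" using d by simp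
      also have "\<dots> = e / 2" using I0 by (simp add: d_def divide_simps)
      finally show ?thesis by simp
    qed
    finally show "norm ((\<integral>x. complex_of_real (T N x * S N x) * cnj (wave \<xi> x) \<partial>torus_measure)
        - (\<integral>x. complex_of_real (F x * G x) * cnj (wave \<xi> x) \<partial>torus_measure)) < e"
      using M[OF N] by linarith
  qed
qed

lemma trig_sum_complex:
  assumes "hermitian c"
  shows "complex_of_real (trig_sum c N x) = (\<Sum>\<xi>\<in>freq_box N. c \<xi> * wave \<xi> x)"
proof -
  have "cnj (\<Sum>\<xi>\<in>freq_box N. c \<xi> * wave \<xi> x) = (\<Sum>\<xi>\<in>freq_box N. c (- \<xi>) * wave (- \<xi>) x)"
    by (simp add: hermitianD[OF assms] wave_uminus)
  also have "\<dots> = (\<Sum>\<xi>\<in>freq_box N. c \<xi> * wave \<xi> x)"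
    by (rule sum.reindex_bij_witness[of _ uminus uminus]) auto
  finally have "(\<Sum>\<xi>\<in>freq_box N. c \<xi> * wave \<xi> x) \<in> \<real>" by (simp only: Reals_cnj_iff)
  then show ?thesis unfolding trig_sum_def by (rule of_real_Re)
qed

text \<open>Convergence of products with the second factor constantly 1, combined with the
  orthogonality of the waves.\<close>

lemma L2_limit_fourier_coeff:
  assumes F: "L2_limit F (trig_sum c)" and c: "hermitian c"
  shows "fourier_coeff (regular_dist F) \<xi> = c \<xi>"
proof -
  have one: "L2_limit (\<lambda>x. 1) (\<lambda>N x. 1)" by (simp add: L2_limit_def)
  have "(\<lambda>N. \<integral>x. complex_of_real (trig_sum c N x * 1) * cnj (wave \<xi> x) \<partial>torus_measure)
      \<longlonglongrightarrow> fourier_coeff (regular_dist F) \<xi>"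
    using L2_limit_product[OF F one, of \<xi>] by (simp add: fourier_coeff_regular_dist[OF
        L2_limit_integrable[OF F]])
  then have "(\<lambda>N. if \<xi> \<in> freq_box N then c \<xi> else 0) \<longlonglongrightarrow> fourier_coeff (regular_dist F) \<xi>"
    by (simp add: trig_sum_complex[OF c] integral_trig_sum_wave)
  moreover have "(\<lambda>N. if \<xi> \<in> freq_box N then c \<xi> else 0) \<longlonglongrightarrow> c \<xi>"
    by (rule freq_box_truncation_tendsto)
  ultimately show ?thesis by (rule LIMSEQ_unique)
qed

text \<open>The product of two partial sums has as coefficient the convolution sum over
  \<open>A N\<close>, the set of \<eta> for which both \<eta> and \<xi> - \<eta> lie in the box.
  These sets exhaust the lattice, and the convolution converges absolutely.\<close>

lemma L2_limit_product_fourier_coeff: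
  fixes c d :: "int^'n::finite \<Rightarrow> complex"
  assumes F: "L2_limit F (trig_sum c)" and G: "L2_limit G (trig_sum d)"
    and c: "hermitian c" and d: "hermitian d"
    and cd: "sobolev_seq 0 c" "sobolev_seq 0 d"
  shows "fourier_coeff (regular_dist (\<lambda>x. F x * G x)) \<xi> = conv c d \<xi>"
proof -
  define A where "A N = {\<eta> \<in> freq_box N. \<xi> - \<eta> \<in> freq_box N}" for N
  have fA: "finite (A N)" for N by (simp add: A_def)
  have iFG: "integrable torus_measure (\<lambda>x. F x * G x)"
    by (rule L2_limit_mult_integrable) (use F G in \<open>auto simp: L2_limit_def\<close>)
  have eq: "(\<integral>x. complex_of_real (trig_sum c N x * trig_sum d N x) * cnj (wave \<xi> x) \<partial>torus_measure)
      = (\<Sum>\<eta>\<in>A N. c (\<xi> - \<eta>) * d \<eta>)" for N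
  proof -
    let ?C = "\<lambda>x. \<Sum>\<zeta>\<in>freq_box N. c \<zeta> * wave \<zeta> x"
    have w: "wave \<eta> x * cnj (wave \<xi> x) = cnj (wave (\<xi> - \<eta>) x)" for \<eta> x
      by (simp add: wave_uminus[symmetric] wave_add[symmetric] algebra_simps)
    have "(\<integral>x. complex_of_real (trig_sum c N x * trig_sum d N x) * cnj (wave \<xi> x) \<partial>torus_measure)
       = (\<integral>x. (\<Sum>\<eta>\<in>freq_box N. d \<eta> * (?C x * cnj (wave (\<xi> - \<eta>) x))) \<partial>torus_measure)"
      unfolding of_real_mult trig_sum_complex[OF c] trig_sum_complex[OF d] w[symmetric]
      by (intro Bochner_Integration.integral_cong refl) (simp add: sum_distrib_left sum_distrib_right
          mult_ac)
    also have "\<dots> = (\<Sum>\<eta>\<in>freq_box N. d \<eta> * (\<integral>x. ?C x * cnj (wave (\<xi> - \<eta>) x) \<partial>torus_measure))"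
      by (subst Bochner_Integration.integral_sum)
        (auto intro!: integrable_mult_right integrable_mult_wave integrable_continuous_torus
            continuous_on_sum continuous_on_mult continuous_on_const continuous_on_cnj
            continuous_on_wave)
    also have "\<dots> = (\<Sum>\<eta>\<in>freq_box N. if \<xi> - \<eta> \<in> freq_box N then c (\<xi> - \<eta>) * d \<eta> else 0)"
      by (intro sum.cong refl) (simp add: integral_trig_sum_wave)
    also have "\<dots> = (\<Sum>\<eta>\<in>A N. c (\<xi> - \<eta>) * d \<eta>)"
      unfolding A_def by (rule sum.inter_filter[symmetric]) simp
    finally show ?thesis .
  qed
  have "filterlim A (finite_subsets_at_top UNIV) sequentially"
    unfolding filterlim_finite_subsets_at_top
  proof (intro allI impI)
    fix X :: "(int^'n) set" assume X: "finite X \<and> X \<subseteq> UNIV"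
    then obtain M where M: "X \<union> (\<lambda>\<eta>. \<xi> - \<eta>) ` X \<subseteq> freq_box M"
      using finite_subset_freq_box[of "X \<union> (\<lambda>\<eta>. \<xi> - \<eta>) ` X"] by auto
    show "\<forall>\<^sub>F y in sequentially. finite (A y) \<and> X \<subseteq> A y \<and> A y \<subseteq> UNIV"
      using eventually_ge_at_top[of M]
    proof eventually_elim
      case (elim N)
      from freq_box_mono[OF elim, where 'a = 'n] show ?case using M fA by (auto simp: A_def)
    qed
  qed
  then have "(\<lambda>N. \<Sum>\<eta>\<in>A N. c (\<xi> - \<eta>) * d \<eta>) \<longlonglongrightarrow> conv c d \<xi>"
    unfolding conv_def
    by (rule filterlim_compose[OF infsum_tendsto[OF abs_summable_summable[OF abs_summable_conv[OF cd]]]])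
  moreover have "(\<lambda>N. \<Sum>\<eta>\<in>A N. c (\<xi> - \<eta>) * d \<eta>) \<longlonglongrightarrow> fourier_coeff (regular_dist (\<lambda>x. F x * G x)) \<xi>"
    using L2_limit_product[OF F G, of \<xi>] unfolding eq fourier_coeff_regular_dist[OF iFG] .
  ultimately show ?thesis by (rule LIMSEQ_unique[rotated])
qed

section \<open>The Navier-Stokes equation\<close>


lemma finite_sum_infsum:
  fixes f :: "'j \<Rightarrow> 'a \<Rightarrow> complex"
  assumes "finite J" "\<And>j. j \<in> J \<Longrightarrow> f j summable_on A"
  shows "(\<Sum>j\<in>J. infsum (f j) A) = (\<Sum>\<^sub>\<infinity>x\<in>A. \<Sum>j\<in>J. f j x)"
  using assms
proof (induction J rule: finite_induct)
  case (insert i J)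
  have "(\<Sum>\<^sub>\<infinity>x\<in>A. f i x + (\<Sum>j\<in>J. f j x)) = infsum (f i) A + (\<Sum>\<^sub>\<infinity>x\<in>A. \<Sum>j\<in>J. f j x)"
    by (rule infsum_add) (use insert in \<open>auto intro!: summable_on_finite_sum\<close>)
  then show ?case using insert by simp
qed simp

lemma fourier_coeff_add: "fourier_coeff (\<lambda>\<phi>. g \<phi> + h \<phi>) \<xi> = fourier_coeff g \<xi> + fourier_coeff h \<xi>"
  by (simp add: fourier_coeff_def complex_eq_iff)

lemma fourier_coeff_diff: "fourier_coeff (\<lambda>\<phi>. g \<phi> - h \<phi>) \<xi> = fourier_coeff g \<xi> - fourier_coeff h \<xi>"
  by (simp add: fourier_coeff_def complex_eq_iff)

lemma fourier_coeff_uminus: "fourier_coeff (\<lambda>\<phi>. - g \<phi>) \<xi> = - fourier_coeff g \<xi>"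
  by (simp add: fourier_coeff_def complex_eq_iff)

lemma fourier_coeff_cmult: "fourier_coeff (\<lambda>\<phi>. r * g \<phi>) \<xi> = complex_of_real r * fourier_coeff g \<xi>"
  by (simp add: fourier_coeff_def complex_eq_iff)

lemma fourier_coeff_half: "fourier_coeff (\<lambda>\<phi>. g \<phi> / 2) \<xi> = fourier_coeff g \<xi> / 2"
  by (simp add: fourier_coeff_def complex_eq_iff)

lemma fourier_coeff_zero: "fourier_coeff (\<lambda>\<phi>. 0) \<xi> = 0"
  by (simp add: fourier_coeff_def complex_eq_iff)

lemma fourier_coeff_sum: "fourier_coeff (\<lambda>\<phi>. \<Sum>j\<in>J. g j \<phi>) \<xi> = (\<Sum>j\<in>J. fourier_coeff (g j) \<xi>)"
  by (simp add: fourier_coeff_def complex_eq_iff sum_negf)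

lemma sobolev_iff: "g \<in> sobolev s \<longleftrightarrow> g \<in> periodic_distributions \<and> sobolev_seq s (fourier_coeff g)"
  by (simp add: sobolev_def sobolev_seq_def)

lemma fourier_coeff_at_0: "fourier_coeff g 0 = Complex (g (\<lambda>_. 1)) (- g (\<lambda>_. 0))"
  by (simp add: fourier_coeff_def)

lemma strain_periodic_distribution:
  assumes "\<And>k. u k \<in> periodic_distributions"
  shows "strain u j \<beta> \<in> periodic_distributions"
proof -
  have "(\<lambda>\<phi>. (1/2) * (dist_deriv j (u \<beta>) \<phi> + dist_deriv \<beta> (u j) \<phi>)) \<in> periodic_distributions"
    by (intro periodic_distribution_cmult periodic_distribution_add dist_deriv_periodic_distribution
        assms)
  then show ?thesis by (simp add: strain_def[abs_def])
qed

lemma fourier_coeff_strain: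
  assumes "\<And>k. u k \<in> periodic_distributions"
  shows "fourier_coeff (strain u j \<beta>) \<xi> = pi * \<i> * (of_int (\<xi> $ j) * fourier_coeff (u \<beta>) \<xi>
      + of_int (\<xi> $ \<beta>) * fourier_coeff (u j) \<xi>)"
  unfolding strain_def fourier_coeff_half fourier_coeff_add fourier_coeff_dist_deriv[OF assms]
  by (simp add: field_simps)

lemma viscous_op_periodic_distribution:
  assumes "\<And>k. u k \<in> periodic_distributions"
  shows "viscous_op a u k \<in> periodic_distributions"
  unfolding viscous_op_def
  by (intro periodic_distribution_sum dist_deriv_periodic_distribution periodic_distribution_cmult
      strain_periodic_distribution assms) auto

text \<open>Exchanging j with \<beta> under the symmetry of the tensor makes both halves of the
  strain contribute alike, so the strain acts as the full gradient.\<close>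

lemma fourier_coeff_viscous_op:
  fixes a :: "('n::finite) tensor"
  assumes u: "\<And>k. u k \<in> periodic_distributions" and sym: "tensor_symmetric a"
  shows "fourier_coeff (viscous_op a u k) \<xi> = - viscous_symbol a (frequency \<xi>) (\<lambda>j. fourier_coeff (u j)
      \<xi>) k"
proof -
  let ?U = "\<lambda>j. fourier_coeff (u j) \<xi>" and ?x = "\<lambda>j. complex_of_int (\<xi> $ j)"
  have inner: "(\<lambda>\<psi>. \<Sum>j\<in>UNIV. \<Sum>\<beta>\<in>UNIV. a k j \<alpha> \<beta> * strain u j \<beta> \<psi>) \<in> periodic_distributions" for \<alpha>
    by (intro periodic_distribution_sum periodic_distribution_cmult strain_periodic_distribution u) auto
  have s: "a k j \<alpha> \<beta> = a k \<beta> \<alpha> j" for j \<alpha> \<beta> using sym unfolding tensor_symmetric_def by blast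
  let ?S = "\<lambda>\<alpha> z. \<Sum>j\<in>UNIV. \<Sum>\<beta>\<in>UNIV. complex_of_real (a k j \<alpha> \<beta>) * (pi * \<i> * z j \<beta>)"
  have S: "?S \<alpha> (\<lambda>j \<beta>. ?x j * ?U \<beta> + ?x \<beta> * ?U j) = 2 * ?S \<alpha> (\<lambda>j \<beta>. ?x \<beta> * ?U j)" for \<alpha>
  proof -
    have "?S \<alpha> (\<lambda>j \<beta>. ?x j * ?U \<beta>) = (\<Sum>\<beta>\<in>UNIV. \<Sum>j\<in>UNIV. complex_of_real (a k j \<alpha> \<beta>) * (pi * \<i> * (?x j
        * ?U \<beta>)))"
      by (rule sum.swap)
    also have "\<dots> = ?S \<alpha> (\<lambda>j \<beta>. ?x \<beta> * ?U j)"
      by (intro sum.cong refl) (simp add: s[symmetric])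
    finally show ?thesis
      by (simp only: distrib_left sum.distrib mult_2)
  qed
  have "fourier_coeff (viscous_op a u k) \<xi> = (\<Sum>\<alpha>\<in>UNIV. 2 * pi * \<i> * ?x \<alpha> * ?S \<alpha> (\<lambda>j \<beta>. ?x j * ?U \<beta>
      + ?x \<beta> * ?U j))"
    unfolding viscous_op_def fourier_coeff_sum fourier_coeff_dist_deriv[OF inner] fourier_coeff_cmult
        fourier_coeff_strain[OF u] ..
  also have "\<dots> = (\<Sum>\<alpha>\<in>UNIV. 2 * pi * \<i> * ?x \<alpha> * (2 * ?S \<alpha> (\<lambda>j \<beta>. ?x \<beta> * ?U j)))"
    by (simp only: S)
  also have "\<dots> = - viscous_symbol a (frequency \<xi>) ?U k"
    unfolding viscous_symbol_def sum_distrib_left sum_negf[symmetric]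
    by (intro sum.cong refl) (simp add: power2_eq_square algebra_simps)
  finally show ?thesis .
qed

lemma hermitian_deriv_coeff: "hermitian c \<Longrightarrow> hermitian (deriv_coeff j c)"
  by (simp add: hermitian_def deriv_coeff_def)

lemma sobolev_seq_deriv_coeff: "sobolev_seq s c \<Longrightarrow> t \<le> s - 1 \<Longrightarrow> sobolev_seq t (deriv_coeff j c)"
proof (rule sobolev_seq_weight[of "{()}" s "\<lambda>_. c" _ "2 * pi" 1])
  fix \<xi>
  show "cmod (deriv_coeff j c \<xi>) \<le> 2 * pi * \<rho> \<xi> powr 1 * (\<Sum>j\<in>{()}. cmod (c \<xi>))"
    using mult_right_mono[OF order_trans[OF abs_nth_le_norm_frequency norm_frequency_le_weight], of "cmod
        (c \<xi>)" \<xi> j]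
    by (simp add: deriv_coeff_def norm_mult)
qed auto

text \<open>Since (\<xi> - \<eta>) . U(\<xi> - \<eta>) = 0, the factor \<eta> of the derivative may
  be replaced by \<xi>, which leaves the sum: u_j \<partial>_j u_k = \<partial>_j (u_j u_k) for
  solenoidal u. Being in H^1 makes the series with the derivative absolutely convergent.\<close>

lemma convection_coeff_eq:
  assumes sol: "solenoidal U" and U: "\<And>k. sobolev_seq 1 (U k)"
  shows "(\<Sum>j\<in>UNIV. conv (U j) (deriv_coeff j (U k)) \<xi>) = convection_coeff U k \<xi>"
proof -
  have s0: "sobolev_seq 0 (U j)" and s1: "sobolev_seq 0 (deriv_coeff j (U k))" for j k
    by (rule sobolev_seq_mono[OF U], simp) (rule sobolev_seq_deriv_coeff[OF U], simp)
  have "(\<Sum>j\<in>UNIV. conv (U j) (deriv_coeff j (U k)) \<xi>)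
      = (\<Sum>\<^sub>\<infinity>\<eta>. \<Sum>j\<in>UNIV. U j (\<xi> - \<eta>) * deriv_coeff j (U k) \<eta>)"
    unfolding conv_def
    by (rule finite_sum_infsum) (auto intro: abs_summable_summable[OF abs_summable_conv[OF s0 s1]])
  also have "\<dots> = (\<Sum>\<^sub>\<infinity>\<eta>. \<Sum>j\<in>UNIV. (2 * pi * \<i> * of_int (\<xi> $ j)) * (U j (\<xi> - \<eta>) * U k \<eta>))"
  proof (rule infsum_cong)
    fix \<eta>
    have "(\<Sum>j\<in>UNIV. of_int ((\<xi> - \<eta>) $ j) * U j (\<xi> - \<eta>)) = 0"
      using sol by (simp only: solenoidal_def)
    then have "(\<Sum>j\<in>UNIV. of_int (\<eta> $ j) * U j (\<xi> - \<eta>)) = (\<Sum>j\<in>UNIV. of_int (\<xi> $ j) * U j (\<xi> - \<eta>))"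
      by (simp add: left_diff_distrib sum_subtractf)
    moreover have "(\<Sum>j\<in>UNIV. U j (\<xi> - \<eta>) * deriv_coeff j (U k) \<eta>)
        = 2 * pi * \<i> * U k \<eta> * (\<Sum>j\<in>UNIV. of_int (\<eta> $ j) * U j (\<xi> - \<eta>))"
      by (simp add: deriv_coeff_def sum_distrib_left mult_ac)
    moreover have "(\<Sum>j\<in>UNIV. (2 * pi * \<i> * of_int (\<xi> $ j)) * (U j (\<xi> - \<eta>) * U k \<eta>))
        = 2 * pi * \<i> * U k \<eta> * (\<Sum>j\<in>UNIV. of_int (\<xi> $ j) * U j (\<xi> - \<eta>))"
      by (simp add: sum_distrib_left mult_ac)
    ultimately show "(\<Sum>j\<in>UNIV. U j (\<xi> - \<eta>) * deriv_coeff j (U k) \<eta>)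
        = (\<Sum>j\<in>UNIV. (2 * pi * \<i> * of_int (\<xi> $ j)) * (U j (\<xi> - \<eta>) * U k \<eta>))"
      by simp
  qed
  also have "\<dots> = (\<Sum>j\<in>UNIV. \<Sum>\<^sub>\<infinity>\<eta>. (2 * pi * \<i> * of_int (\<xi> $ j)) * (U j (\<xi> - \<eta>) * U k \<eta>))"
    by (rule finite_sum_infsum[symmetric])
      (auto intro!: summable_on_cmult_right abs_summable_summable[OF abs_summable_conv[OF s0 s0]])
  also have "\<dots> = convection_coeff U k \<xi>"
    unfolding convection_coeff_def conv_def sum_distrib_left
    by (intro sum.cong refl) (simp add: infsum_cmult_right abs_summable_summable[OF abs_summable_conv[OF
        s0 s0]])
  finally show ?thesis .
qed

text \<open>For U in H^1 each u_j and each derivative of u_k is represented by a square integrable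
  function, so the products are integrable as \<open>dist_product\<close> demands, and their
  coefficients are convolutions.\<close>

lemma convection_exists:
  fixes u :: "'n::finite \<Rightarrow> 'n functional"
  assumes dim: "CARD('n) \<le> 3" and u: "\<And>k. u k \<in> periodic_distributions"
    and U: "\<And>k. fourier_coeff (u k) = U k" "\<And>k. sobolev_seq 1 (U k)" "solenoidal U"
  obtains N where "is_convection u N" "\<And>k. N k \<in> periodic_distributions" "\<And>k \<xi>. fourier_coeff (N k) \<xi>
      = convection_coeff U k \<xi>"
proof -
  have h: "hermitian (U k)" for k using hermitian_fourier_coeff[OF u]
      by (simp add: hermitian_def flip: U(1))
  have s0: "sobolev_seq 0 (U j)" and s1: "sobolev_seq 0 (deriv_coeff j (U k))" for j k
    by (rule sobolev_seq_mono[OF U(2)], simp) (rule sobolev_seq_deriv_coeff[OF U(2)], simp)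
  define F where "F j = (SOME F. L2_limit F (trig_sum (U j)))" for j
  define G where "G j k = (SOME G. L2_limit G (trig_sum (deriv_coeff j (U k))))" for j k
  have F: "L2_limit (F j) (trig_sum (U j))" for j
    unfolding F_def by (rule someI_ex[OF riesz_fischer[OF s0]])
  have G: "L2_limit (G j k) (trig_sum (deriv_coeff j (U k)))" for j k
    unfolding G_def by (rule someI_ex[OF riesz_fischer[OF s1]])
  note hd = hermitian_deriv_coeff[OF h]
  define w where "w k j = regular_dist (\<lambda>x. F j x * G j k x)" for k j
  define N where "N k = (\<lambda>\<phi>. \<Sum>j\<in>UNIV. w k j \<phi>)" for k
  have iFG: "integrable torus_measure (\<lambda>x. F j x * G j k x)" for j k
    by (rule L2_limit_mult_integrable) (use F[of j] G[of j k] in \<open>auto simp: L2_limit_def\<close>)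
  have w: "w k j \<in> periodic_distributions" for k j
    unfolding w_def by (rule regular_dist_periodic_distribution[OF iFG])
  have dF: "dist_eq (u j) (regular_dist (F j))" for j
    by (rule dist_eq_if_fourier_coeff_eq[OF dim u regular_dist_periodic_distribution[OF
        L2_limit_integrable[OF F]]])
      (simp add: U(1) L2_limit_fourier_coeff[OF F h])
  have dG: "dist_eq (dist_deriv j (u k)) (regular_dist (G j k))" for j k
    by (rule dist_eq_if_fourier_coeff_eq[OF dim dist_deriv_periodic_distribution[OF u]
        regular_dist_periodic_distribution[OF L2_limit_integrable[OF G]]])
      (simp add: fourier_coeff_dist_deriv[OF u] U(1) L2_limit_fourier_coeff[OF G hd] deriv_coeff_def)
  show ?thesis
  proof (rule that[of N])
    have "dist_product (u j) (dist_deriv j (u k)) (w k j)" for k j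
      unfolding dist_product_def
    proof (intro exI conjI)
      show "dist_eq (w k j) (regular_dist (\<lambda>x. F j x * G j k x))" by (simp add: w_def dist_eq_def)
    qed (use dF dG iFG L2_limit_integrable[OF F] L2_limit_integrable[OF G] in \<open>auto simp:
        integrable_torus_iff\<close>)
    then show "is_convection u N"
      unfolding is_convection_def by (intro exI[of _ w]) (simp add: N_def dist_eq_def)
    show "N k \<in> periodic_distributions" for k
      unfolding N_def by (rule periodic_distribution_sum) (auto intro: w)
    show "fourier_coeff (N k) \<xi> = convection_coeff U k \<xi>" for k \<xi>
      unfolding N_def fourier_coeff_sum w_def L2_limit_product_fourier_coeff[OF F G h hd s0 s1]
      by (rule convection_coeff_eq[OF U(3,2)])
  qed
qed

lemma navier_stokes_if_coefficients:
  fixes a :: "('n::finite) tensor"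
  assumes dim: "CARD('n) \<le> 3" and sym: "tensor_symmetric a"
    and f: "\<And>k. f k \<in> periodic_distributions" and u: "\<And>k. u k \<in> periodic_distributions"
        and p: "p \<in> periodic_distributions"
    and U: "\<And>k. fourier_coeff (u k) = U k" "\<And>k. sobolev_seq 1 (U k)" "solenoidal U"
    and eq: "\<And>k \<xi>. momentum a (\<lambda>k. fourier_coeff (f k)) U k \<xi>
        + 2 * pi * \<i> * of_int (\<xi> $ k) * fourier_coeff p \<xi> = 0"
  shows "navier_stokes a f u p"
proof -
  obtain N where N: "is_convection u N" "\<And>k. N k \<in> periodic_distributions" "\<And>k \<xi>. fourier_coeff (N k) \<xi>
      = convection_coeff U k \<xi>"
    using convection_exists[OF dim u U] by blast
  have "dist_eq (\<lambda>\<phi>. - stokes_op a u p k \<phi>) (\<lambda>\<phi>. f k \<phi> - N k \<phi>)" for k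
  proof (rule dist_eq_if_fourier_coeff_eq[OF dim])
    show "(\<lambda>\<phi>. - stokes_op a u p k \<phi>) \<in> periodic_distributions"
      unfolding stokes_op_def
      by (intro periodic_distribution_uminus periodic_distribution_diff viscous_op_periodic_distribution
          dist_deriv_periodic_distribution u p)
    show "(\<lambda>\<phi>. f k \<phi> - N k \<phi>) \<in> periodic_distributions"
      by (intro periodic_distribution_diff f N)
    fix \<xi>
    have "fourier_coeff (\<lambda>\<phi>. - stokes_op a u p k \<phi>) \<xi>
        = viscous_symbol a (frequency \<xi>) (\<lambda>j. U j \<xi>) k + 2 * pi * \<i> * of_int (\<xi> $ k) * fourier_coeff p \<xi>"
      unfolding stokes_op_def fourier_coeff_uminus fourier_coeff_diff fourier_coeff_viscous_op[OF u sym]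
          fourier_coeff_dist_deriv[OF p] U(1) by simp
    also have "\<dots> = fourier_coeff (f k) \<xi> - convection_coeff U k \<xi>"
      using eq[of k \<xi>] by (simp add: momentum_def algebra_simps)
    finally show "fourier_coeff (\<lambda>\<phi>. - stokes_op a u p k \<phi>) \<xi> = fourier_coeff (\<lambda>\<phi>. f k \<phi> - N k \<phi>) \<xi>"
      unfolding fourier_coeff_diff N(3) .
  qed
  then show ?thesis unfolding navier_stokes_def using N(1) by blast
qed

lemma dist_div_zero_if_solenoidal:
  fixes u :: "'n::finite \<Rightarrow> 'n functional"
  assumes dim: "CARD('n) \<le> 3" and u: "\<And>k. u k \<in> periodic_distributions"
    and sol: "solenoidal (\<lambda>k. fourier_coeff (u k))"
  shows "dist_eq (dist_div u) (\<lambda>_. 0)"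
proof (rule dist_eq_if_fourier_coeff_eq[OF dim])
  show "dist_div u \<in> periodic_distributions"
    unfolding dist_div_def by (intro periodic_distribution_sum dist_deriv_periodic_distribution u) simp
  show "(\<lambda>_. 0) \<in> periodic_distributions" by (rule periodic_distribution_0)
  fix \<xi>
  have "fourier_coeff (dist_div u) \<xi> = 2 * pi * \<i> * (\<Sum>k\<in>UNIV. of_int (\<xi> $ k) * fourier_coeff (u k) \<xi>)"
    unfolding dist_div_def fourier_coeff_sum fourier_coeff_dist_deriv[OF u]
        by (simp add: sum_distrib_left mult.assoc)
  then show "fourier_coeff (dist_div u) \<xi> = fourier_coeff (\<lambda>_. 0) \<xi>"
    using sol by (simp add: solenoidal_def fourier_coeff_zero)
qed

text \<open>The regularity clause ranges over all s for one and the same pair U, P. No uniqueness is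
  at hand, so the smooth case needs a single solution that lies in every Sobolev space.\<close>

definition stationary_solution ::
    "('n::finite) tensor \<Rightarrow> ('n \<Rightarrow> int^'n \<Rightarrow> complex) \<Rightarrow> ('n \<Rightarrow> int^'n \<Rightarrow> complex) \<Rightarrow> (int^'n \<Rightarrow> complex) \<Rightarrow> bool"
  where "stationary_solution a f U P \<longleftrightarrow>
    (\<forall>k. hermitian (U k)) \<and> (\<forall>k. U k 0 = 0) \<and> solenoidal U \<and> hermitian P \<and> P 0 = 0 \<and>
    (\<forall>s\<ge>1. (\<forall>k. sobolev_seq (s - 2) (f k)) \<longrightarrow> (\<forall>k. sobolev_seq s (U k)) \<and> sobolev_seq (s - 1) P) \<and>
    (\<forall>k \<xi>. momentum a f U k \<xi> + 2 * pi * \<i> * of_int (\<xi> $ k) * P \<xi> = 0)"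

lemma stationary_solution_exists:
  fixes a :: "('n::finite) tensor"
  assumes dim: "CARD('n) \<le> 3" and sym: "tensor_symmetric a" and ell: "relaxed_elliptic a"
    and hf: "\<And>k. hermitian (f k)" and f0: "\<And>k. f k 0 = 0" and f: "\<And>k. sobolev_seq (-1) (f k)"
  shows "\<exists>U P. stationary_solution a f U P"
proof -
  obtain c where c: "c > 0" and coer: "\<And>x z. (\<Sum>k\<in>UNIV. complex_of_real (x $ k) * z k) = 0 \<Longrightarrow>
    c * (norm x)\<^sup>2 * (\<Sum>k\<in>UNIV. (cmod (z k))\<^sup>2) \<le> Re (\<Sum>k\<in>UNIV. viscous_symbol a x z k * cnj (z k))"
    using viscous_symbol_coercive[OF sym ell] by blast
  interpret coercive_system a c f by unfold_locales (rule c, erule coer, rule hf)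
  obtain U where U: "\<And>k. hermitian (U k)" "\<And>k. U k 0 = 0" "solenoidal U" "\<And>k. sobolev_seq 1 (U k)"
    and L: "\<And>k \<xi>. \<xi> \<noteq> 0 \<Longrightarrow> leray (frequency \<xi>) (\<lambda>k. momentum a f U k \<xi>) k = 0"
    using stationary_coefficients[OF f] by metis
  have reg: "sobolev_seq s (U k)" if "1 \<le> s" "\<And>k. sobolev_seq (s - 2) (f k)" for s k
    by (rule regularity[OF dim U(2,3,4) that(1) L that(2)])
  have eq: "momentum a f U k \<xi> + 2 * pi * \<i> * of_int (\<xi> $ k) * pressure_coeff a f U \<xi> = 0" for k \<xi>
  proof (cases "\<xi> = 0")
    case True
    \<comment> \<open>At \<xi> = 0 no projected equation is available; viscosity and convection
      carry a factor \<xi>, and the mean value zero of f closes the equation.\<close>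
    have "momentum a f U k 0 = 0"
      by (simp add: momentum_def viscous_symbol_def convection_coeff_def f0)
    then show ?thesis using True by simp
  qed (rule pressure_coeff_eq[OF L])
  have P: "sobolev_seq (s - 1) (pressure_coeff a f U)" if "1 \<le> s" "\<And>k. sobolev_seq (s - 2) (f k)" for s
    by (rule sobolev_seq_pressure[OF dim that(1) reg[OF that] that(2)])
  have "stationary_solution a f U (pressure_coeff a f U)"
    unfolding stationary_solution_def
    using U eq hermitian_pressure_coeff[OF hf U(1)] by (auto intro: reg P)
  then show ?thesis by blast
qed

text \<open>Bounding one factor |c| by the l^1 norm reduces the square to a first power, whose decay
  absorbs any weight.\<close>

lemma rapid_sobolev_seq:
  assumes "rapid c" shows "sobolev_seq s c"
proof (rule sobolev_seq_dominated)
  define m where "m = nat \<lceil>2 * s\<rceil>"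
  define C where "C = (\<Sum>\<^sub>\<infinity>\<xi>. cmod (c \<xi>))"
  show "(\<lambda>\<xi>. C * (\<rho> \<xi> ^ m * cmod (c \<xi>))) summable_on UNIV"
    using assms unfolding rapid_def by (intro summable_on_cmult_right) blast
  fix \<xi>
  have "cmod (c \<xi>) \<le> C"
    using finite_sum_le_infsum[OF rapid_abs_summable[OF assms], of "{\<xi>}"] by (simp add: C_def)
  moreover from this have "0 \<le> C" using norm_ge_zero order_trans by blast
  moreover have "\<rho> \<xi> powr (2 * s) \<le> \<rho> \<xi> ^ m"
    unfolding powr_realpow[OF sobolev_weight_pos, symmetric] m_def by (intro powr_mono) (linarith, simp)
  ultimately have "\<rho> \<xi> powr (2 * s) * (cmod (c \<xi>) * cmod (c \<xi>)) \<le> \<rho> \<xi> ^ m * (C * cmod (c \<xi>))"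
    by (intro mult_mono) auto
  then show "\<rho> \<xi> powr (2 * s) * (cmod (c \<xi>))\<^sup>2 \<le> C * (\<rho> \<xi> ^ m * cmod (c \<xi>))"
    by (simp add: power2_eq_square mult_ac)
qed

text \<open>A single term of the H^m sum is at most the whole sum, which gives decay of every
  polynomial order.\<close>

lemma rapid_if_all_sobolev:
  fixes c :: "int^'n::finite \<Rightarrow> complex"
  assumes dim: "CARD('n) \<le> 3" and s: "\<And>m::nat. sobolev_seq (real m) c"
  shows "rapid c"
proof (rule rapid_if_decay[OF dim])
  fix m
  let ?g = "\<lambda>\<xi>. \<rho> \<xi> powr (2 * real m) * (cmod (c \<xi>))\<^sup>2"
  have "\<rho> \<xi> ^ m * cmod (c \<xi>) \<le> sqrt (infsum ?g UNIV)" for \<xi>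
  proof (rule real_le_rsqrt)
    have "(\<rho> \<xi> ^ m * cmod (c \<xi>))\<^sup>2 = ?g \<xi>"
      using powr_realpow[of "\<rho> \<xi>" "2 * m"] by (simp add: power_mult_distrib power_mult[symmetric]
          mult.commute)
    also have "\<dots> \<le> infsum ?g UNIV"
      using finite_sum_le_infsum[OF s[of m, unfolded sobolev_seq_def], of "{\<xi>}"] by simp
    finally show "(\<rho> \<xi> ^ m * cmod (c \<xi>))\<^sup>2 \<le> infsum ?g UNIV" .
  qed
  then show "\<exists>C. \<forall>\<xi>. \<rho> \<xi> ^ m * cmod (c \<xi>) \<le> C" by blast
qed

text \<open>Square summability is all that is asked: s \<ge> 1 for the velocity and s - 1 \<ge> 0
  for the pressure allow both to be realised by functions.\<close>

lemma distribution_with_coefficients: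
  fixes c :: "int^'n::finite \<Rightarrow> complex"
  assumes "hermitian c" "sobolev_seq 0 c"
  obtains g where "g \<in> periodic_distributions" "fourier_coeff g = c"
proof -
  obtain F where F: "L2_limit F (trig_sum c)" using riesz_fischer[OF assms(2)] by blast
  show ?thesis
    by (rule that[of "regular_dist F"])
      (auto intro: regular_dist_periodic_distribution L2_limit_integrable[OF F] L2_limit_fourier_coeff[OF
          F assms(1)])
qed

text \<open>Both parts take their coefficients from \<open>stationary_solution_exists\<close> and
  differ in the synthesis: square integrable functions in the first, uniformly convergent series in
  the second, where U and P lie in every Sobolev space and hence decay rapidly.\<close>

theorem theorem6:
  fixes a :: "('n::finite) tensor"
  assumes dim: "CARD('n) = 2 \<or> CARD('n) = 3"
    and sym: "tensor_symmetric a"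
    and ell: "relaxed_elliptic a"
  shows "(\<forall>s\<ge>1. \<forall>f\<in>sobolev0_vec (s - 2).
            \<exists>u\<in>sobolev0_sigma s. \<exists>p\<in>sobolev0 (s - 1). navier_stokes a f u p)
       \<and> (\<forall>f\<in>smooth_periodic0_vec.
            \<exists>u\<in>smooth_periodic0_vec. \<exists>p\<in>smooth_periodic0.
              dist_eq (dist_div (\<lambda>k. regular_dist (u k))) (\<lambda>_. 0) \<and>
              navier_stokes a (\<lambda>k. regular_dist (f k)) (\<lambda>k. regular_dist (u k)) (regular_dist p))"
proof (intro conjI allI ballI impI)
  have dim3: "CARD('n) \<le> 3" using dim by auto
  \<comment> \<open>Up to sign, the imaginary part of the coefficient at frequency 0 is the value of
    \<open>g\<close> at the zero function; hermitian symmetry makes this coefficient real.\<close>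
  have zero_const: "g (\<lambda>_. 0) = 0" if "g \<in> periodic_distributions" for g :: "'n functional"
    using hermitian_fourier_coeff[OF that, of 0] by (simp add: fourier_coeff_at_0 complex_eq_iff)
  {
    fix s :: real and f :: "'n \<Rightarrow> 'n functional"
    assume s: "1 \<le> s" and "f \<in> sobolev0_vec (s - 2)"
    then have f: "\<And>k. f k \<in> periodic_distributions" "\<And>k. sobolev_seq (s
        - 2) (fourier_coeff (f k))" "\<And>k. f k (\<lambda>_. 1) = 0"
      by (auto simp: sobolev0_vec_def sobolev0_def sobolev_iff)
    have hf: "hermitian (fourier_coeff (f k))" for k
      using hermitian_fourier_coeff[OF f(1)] by (simp add: hermitian_def)
    have f0: "fourier_coeff (f k) 0 = 0" for k
      by (simp add: fourier_coeff_at_0 f(3) zero_const[OF f(1)] complex_eq_iff)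
    \<comment> \<open>The bound s \<ge> 1 places f in H^(-1), where the energy estimate
      starts.\<close>
    have f1: "sobolev_seq (-1) (fourier_coeff (f k))" for k
      by (rule sobolev_seq_mono[OF f(2)]) (use s in simp)
    obtain U P where UP: "stationary_solution a (\<lambda>k. fourier_coeff (f k)) U P"
      using stationary_solution_exists[of a "\<lambda>k. fourier_coeff (f k)", OF dim3 sym ell hf f0 f1] by blast
    note UP = UP[unfolded stationary_solution_def]
    have U: "\<And>k. hermitian (U k)" "\<And>k. U k 0 = 0" "solenoidal U" and P: "hermitian P" "P 0 = 0"
      and eq: "\<And>k \<xi>. momentum a (\<lambda>k. fourier_coeff (f k)) U k \<xi> + 2 * pi * \<i> * of_int (\<xi> $ k) * P \<xi> = 0"
      using UP by blast+
    have U': "sobolev_seq s (U k)" and P': "sobolev_seq (s - 1) P" for k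
      using UP s f(2) by blast+
    have U0: "sobolev_seq 0 (U k)" for k by (rule sobolev_seq_mono[OF U']) (use s in simp)
    have "\<exists>u. \<forall>k. u k \<in> periodic_distributions \<and> fourier_coeff (u k) = U k"
      by (intro choice allI) (rule distribution_with_coefficients[OF U(1) U0], blast)
    then obtain u where u: "\<And>k. u k \<in> periodic_distributions" "\<And>k. fourier_coeff (u k) = U k" by blast
    obtain p where p: "p \<in> periodic_distributions" "fourier_coeff p = P"
      using distribution_with_coefficients[OF P(1) sobolev_seq_mono[OF P']] s by auto
    have "u k \<in> sobolev0 s" for k
      using u U' U(2)[of k] fourier_coeff_at_0[of "u k"]
          by (simp add: sobolev0_def sobolev_iff complex_eq_iff)
    then have "u \<in> sobolev0_sigma s"
      using dist_div_zero_if_solenoidal[OF dim3 u(1)] U(3)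
          by (simp add: sobolev0_sigma_def sobolev0_vec_def u(2))
    moreover have "p \<in> sobolev0 (s - 1)"
      using p P' P(2) fourier_coeff_at_0[of p] by (simp add: sobolev0_def sobolev_iff complex_eq_iff)
    moreover have "navier_stokes a f u p"
      by (rule navier_stokes_if_coefficients[OF dim3 sym f(1) u(1) p(1) u(2) sobolev_seq_mono[OF U' s]
          U(3)])
        (simp only: eq p(2))
    ultimately show "\<exists>u\<in>sobolev0_sigma s. \<exists>p\<in>sobolev0 (s - 1). navier_stokes a f u p" by blast
  }
  {
    fix f :: "'n \<Rightarrow> real^'n \<Rightarrow> real"
    assume "f \<in> smooth_periodic0_vec"
    then have f: "\<And>k. f k \<in> smooth_periodic" "\<And>k. regular_dist (f k) (\<lambda>_. 1) = 0"
      by (auto simp: smooth_periodic0_vec_def smooth_periodic0_def)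
    let ?f = "\<lambda>k. fourier_coeff (regular_dist (f k))"
    have fd: "regular_dist (f k) \<in> periodic_distributions" for k
      by (rule regular_dist_periodic_distribution[OF integrable_smooth[OF f(1)]])
    have hf: "hermitian (?f k)" for k
      using hermitian_fourier_coeff[OF fd] by (simp add: hermitian_def)
    have f0: "?f k 0 = 0" for k
      by (simp add: fourier_coeff_at_0 f(2) zero_const[OF fd] complex_eq_iff)
    have fs: "sobolev_seq s (?f k)" for s k
      by (rule rapid_sobolev_seq[OF rapid_fourier_coeff[OF dim3 f(1)]])
    obtain U P where UP: "stationary_solution a ?f U P"
      using stationary_solution_exists[of a ?f, OF dim3 sym ell hf f0 fs] by blast
    note UP = UP[unfolded stationary_solution_def]
    have U: "\<And>k. hermitian (U k)" "\<And>k. U k 0 = 0" "solenoidal U" and P: "hermitian P" "P 0 = 0"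
      and eq: "\<And>k \<xi>. momentum a ?f U k \<xi> + 2 * pi * \<i> * of_int (\<xi> $ k) * P \<xi> = 0"
      using UP by blast+
    have Us: "sobolev_seq s (U k)" and Ps: "sobolev_seq (s - 1) P" if "1 \<le> s" for s k
      using UP fs that by blast+
    \<comment> \<open>The index m + 1 stays in the range s \<ge> 1 of the regularity clause even for
      m = 0, and it leaves exactly m for the pressure.\<close>
    have "sobolev_seq (real m) (U k)" for m k
      by (rule sobolev_seq_mono[OF Us[of "real m + 1"]]) auto
    then have rU: "rapid (U k)" for k by (rule rapid_if_all_sobolev[OF dim3])
    have "sobolev_seq (real m) P" for m
      using Ps[of "real m + 1"] by simp
    then have rP: "rapid P" by (rule rapid_if_all_sobolev[OF dim3])
    define u where "u k = synth (U k)" for k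
    define p where "p = synth P"
    have us: "u k \<in> smooth_periodic" for k unfolding u_def by (rule synth_smooth_periodic[OF rU])
    have ps: "p \<in> smooth_periodic" unfolding p_def by (rule synth_smooth_periodic[OF rP])
    have ud: "regular_dist (u k) \<in> periodic_distributions" for k
      by (rule regular_dist_periodic_distribution[OF integrable_smooth[OF us]])
    have pd: "regular_dist p \<in> periodic_distributions"
      by (rule regular_dist_periodic_distribution[OF integrable_smooth[OF ps]])
    have uc: "fourier_coeff (regular_dist (u k)) = U k" for k
      unfolding u_def by (rule ext, rule fourier_coeff_synth[OF rU hermitianD[OF U(1)]])
    have pc: "fourier_coeff (regular_dist p) = P"
      unfolding p_def by (rule ext, rule fourier_coeff_synth[OF rP hermitianD[OF P(1)]])
    have "u \<in> smooth_periodic0_vec"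
      unfolding smooth_periodic0_vec_def smooth_periodic0_def
      using us uc U(2) fourier_coeff_at_0[of "regular_dist (u _)"] by (auto simp: complex_eq_iff)
    moreover have "p \<in> smooth_periodic0"
      using ps pc P(2) fourier_coeff_at_0[of "regular_dist p"]
          by (auto simp: smooth_periodic0_def complex_eq_iff)
    moreover have "dist_eq (dist_div (\<lambda>k. regular_dist (u k))) (\<lambda>_. 0)"
      by (rule dist_div_zero_if_solenoidal[OF dim3 ud]) (simp add: uc U(3))
    moreover have "navier_stokes a (\<lambda>k. regular_dist (f k)) (\<lambda>k. regular_dist (u k)) (regular_dist p)"
      by (rule navier_stokes_if_coefficients[OF dim3 sym fd ud pd uc Us[OF order_refl] U(3)])
        (simp only: eq pc)
    ultimately show "\<exists>u\<in>smooth_periodic0_vec. \<exists>p\<in>smooth_periodic0.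
              dist_eq (dist_div (\<lambda>k. regular_dist (u k))) (\<lambda>_. 0) \<and>
              navier_stokes a (\<lambda>k. regular_dist (f k)) (\<lambda>k. regular_dist (u k)) (regular_dist p)"
      by blast
  }
qed

end
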